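(* Let $m\ge 1$ and $n\ge 0$ be integers, let $\rho\in\mathcal{R}(\omega_0^{(m+n)})$ be a reduced word of the longest permutation $\omega_0^{(m+n)}\in\mathfrak{S}_{m+n}$, and let $C$ be the chain of permutations corresponding to $\rho$. The following are equivalent. 1. $\rho\in\mathcal{CS}(m,n)$. 2. $T=\mathrm{EG}_Q(\rho)$ is an $n$-row-shiftable tableau of shape $(m+n-1,m+n-2,\ldots,2,1)$ (the $(m+n)$-staircase). 3. $C\in\mathcal{LMC}(L_{m,n})$, i.e. $C$ is a chain of maximum length in the tubing lattice $\mathfrak{L}(L_{m,n})$.
   Context: **Permutations and chains.** $\mathfrak{S}_N$ is the set of permutations of $[N]$ in one-line notation, $s_i$ is the adjacent transposition of $i,i+1$, and $w\circ s_i$ is $w$ with the entries in positions $i,i+1$ swapped. A reduced word of $w$ is a minimal-length sequence $i_1\cdots i_\ell$ with $w=s_{i_1}\circ\cdots\circ s_{i_\ell}$; $\mathcal{R}(w)$ is the set of these. $\omega_0^{(N)}=[N,N-1,\ldots,1]$. The (right) weak order on $\mathfrak{S}_N$ has cover relations $u\lessdot u\circ s_i$ when $u(i)<u(i+1)$. The chain of permutations corresponding to $\rho=\rho_1\rho_2\cdots\rho_M\in\mathcal{R}(\omega_0^{(N)})$, $M=\binom N2$, is $\{w^{(0)}\lessdot w^{(1)}\lessdot\cdots\lessdot w^{(M)}\}$ with $w^{(k)}=s_{\rho_1}\circ\cdots\circ s_{\rho_k}$. **Tubing lattice.** $L_{m,n}$ is the graph on $[m+n]$ which is the complete graph on $\{1,\ldots,m\}$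 together with the path on $m,m+1,\ldots,m+n$ (edges $\{i,i+1\}$, $m\le i<m+n$). For a graph $G$ on $[N]$, $w\in\mathfrak{S}_N$ is a $G$-permutation if for every $i\in[N]$, $w(i)$ lies in the same connected component as $\max\{w(1),\ldots,w(i)\}$ of the induced subgraph $G|_{\{w(1),\ldots,w(i)\}}$. $\mathfrak{L}(L_{m,n})$ is identified with the subposet of the weak order on $\mathfrak{S}_{m+n}$ induced by the $L_{m,n}$-permutations. $\mathcal{LMC}(L_{m,n})$ is the set of chains of maximum length in $\mathfrak{L}(L_{m,n})$ (so in item 3 all permutations of $C$ are $L_{m,n}$-permutations and $C$ has maximum length among chains of $\mathfrak{L}(L_{m,n})$). **Edelman–Greene insertion.** For a reduced word $\alpha=\alpha_1\cdots\alpha_k$, start with empty tableaux $P,Q$ and insert $\alpha_1,\alpha_2,\ldots$ successively. To insert $x_0=\alpha_t$: for $i=1,2,\ldots$, insert $x_{i-1}$ in row $i$ of $P$. If $x_{i-1}$ is larger than all entries of row $i$ (or the row is empty), append it to row $i$ and stop. Otherwise let $z$ be the smallest entry of row $i$ with $z\ge x_{i-1}$; if $z=x_{i-1}$, leave row $i$ unchanged and put $x_i=z+1$; if $z>x_{i-1}$, replace $z$ by $x_{i-1}$ and put $x_i=z$; continue with row $i+1$. When the insertion of $\alpha_t$ ends, $Q$ gets the entry $t$ in the new cell of $P$. The final $Q$ is $\mathrm{EG}_Q(\alpha)$. Rows are numbered from the top, columns from the left. **Shiftable tableaux.** A standard Young tableau $T$ of shape $(\lambda_1,\ldots,\lambda_k)$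 is shiftable if $T_{i,j}<T_{i+1,j-1}$ for all $1\le i\le k-1$ and $2\le j\le\lambda_i$ such that the cell $(i+1,j-1)$ is in the shape. $\mathcal{SR}(\omega_0^{(n+1)})$ is the set of $\tau\in\mathcal{R}(\omega_0^{(n+1)})$ with $\mathrm{EG}_Q(\tau)$ shiftable. With $N=m+n$, a standard Young tableau $T$ of staircase shape $(N-1,\ldots,2,1)$ is $n$-row-shiftable if $T_{i,j}<T_{i+1,j-1}$ for all $i$ with $N-n-1\le i\le N-2$ and all $2\le j\le N-i$; when $n=N-1$, entries of "row $0$" are taken to be $0$, so $i=0$ imposes no condition. **Commuting shuffles.** Let $v_{m,n}=[m,m+1,\ldots,m+n,m-1,m-2,\ldots,2,1]\in\mathfrak{S}_{m+n}$. For reduced words $\sigma$ (length $k$) and $\tau$ (length $j$) with $\sigma\tau$ reduced, $\mathcal{CS}(\sigma,\tau)$ is defined inductively: $\sigma\tau\in\mathcal{CS}(\sigma,\tau)$ with $\sigma$-index set $I=\{1,\ldots,k\}$ and $\tau$-index set $J=\{k+1,\ldots,k+j\}$; and if $\rho\in\mathcal{CS}(\sigma,\tau)$ with index sets $I,J$, and $i\in I$, $i+1\in J$, $|\rho_i-\rho_{i+1}|>1$, then the word obtained from $\rho$ by swapping its $i$-th and $(i+1)$-st letters is in $\mathcal{CS}(\sigma,\tau)$, with index sets $(I\cup\{i+1\})\setminus\{i\}$ and $(J\cup\{i\})\setminus\{i+1\}$. Finally $\mathcal{CS}(m,n)=\bigcup\mathcal{CS}(\sigma,\tau)$ over $\sigma\in\mathcal{R}(v_{m,n})$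 and $\tau\in\mathcal{SR}(\omega_0^{(n+1)})$. *)

theory Defs
  imports "HOL-Combinatorics.Permutations"
begin

text \<open>
  A permutation of $[N]$ is a function \<open>w :: nat \<Rightarrow> nat\<close> with \<open>w permutes {1..N}\<close>; its one-line
  notation is $[w(1),\ldots,w(N)]$. All positions, letters, rows and columns are numbered from 1,
  so a list \<open>\<alpha>\<close> has $k$-th letter \<open>\<alpha> ! (k - 1)\<close>.
\<close>

section \<open>Words and permutations\<close>

abbreviation adj_transp :: "nat \<Rightarrow> nat \<Rightarrow> nat" where
  "adj_transp i \<equiv> Transposition.transpose i (Suc i)"

primrec word_perm :: "nat list \<Rightarrow> nat \<Rightarrow> nat" where
  "word_perm [] = id"
| "word_perm (i # \<alpha>) = adj_transp i \<circ> word_perm \<alpha>"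

definition words_for :: "nat \<Rightarrow> (nat \<Rightarrow> nat) \<Rightarrow> nat list set" where
  "words_for N w = {\<alpha>. set \<alpha> \<subseteq> {1..<N} \<and> word_perm \<alpha> = w}"

definition reduced_words :: "nat \<Rightarrow> (nat \<Rightarrow> nat) \<Rightarrow> nat list set" where
  "reduced_words N w = {\<alpha> \<in> words_for N w. \<forall>\<beta> \<in> words_for N w. length \<alpha> \<le> length \<beta>}"

definition longest_perm :: "nat \<Rightarrow> nat \<Rightarrow> nat" where
  "longest_perm N i = (if i \<in> {1..N} then N + 1 - i else i)"

text \<open>The permutation $[m, m+1, \ldots, m+n, m-1, m-2, \ldots, 2, 1]$.\<close>

definition v_perm :: "nat \<Rightarrow> nat \<Rightarrow> nat \<Rightarrow> nat" where
  "v_perm m n i =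
     (if i \<in> {1..n + 1} then m + i - 1
      else if i \<in> {n + 2..m + n} then m + n + 1 - i
      else i)"

definition chain_of_word :: "nat list \<Rightarrow> (nat \<Rightarrow> nat) set" where
  "chain_of_word \<rho> = (\<lambda>k. word_perm (take k \<rho>)) ` {0..length \<rho>}"


section \<open>The tubing lattice of \<open>L\<^bsub>m,n\<^esub>\<close>\<close>

definition weak_cover :: "nat \<Rightarrow> (nat \<Rightarrow> nat) \<Rightarrow> (nat \<Rightarrow> nat) \<Rightarrow> bool" where
  "weak_cover N u v \<longleftrightarrow>
     u permutes {1..N} \<and> (\<exists>i \<in> {1..<N}. u i < u (Suc i) \<and> v = u \<circ> adj_transp i)"

definition weak_le :: "nat \<Rightarrow> (nat \<Rightarrow> nat) \<Rightarrow> (nat \<Rightarrow> nat) \<Rightarrow> bool" where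
  "weak_le N = (weak_cover N)\<^sup>*\<^sup>*"

text \<open>A graph on $[N]$ is given by its set of edges, each a two-element set of vertices.\<close>

definition L_edges :: "nat \<Rightarrow> nat \<Rightarrow> nat set set" where
  "L_edges m n = {{i, j} | i j. 1 \<le> i \<and> i < j \<and> j \<le> m} \<union> {{i, Suc i} | i. m \<le> i \<and> i < m + n}"

text \<open>\<open>same_component E V a b\<close>: the vertices \<open>a\<close> and \<open>b\<close> lie in the same connected component of
  the subgraph induced on \<open>V\<close>.\<close>

definition same_component :: "nat set set \<Rightarrow> nat set \<Rightarrow> nat \<Rightarrow> nat \<Rightarrow> bool" where
  "same_component E V a b \<longleftrightarrow>
     a \<in> V \<and> b \<in> V \<and> (a, b) \<in> {(x, y). x \<in> V \<and> y \<in> V \<and> {x, y} \<in> E}\<^sup>*"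

definition graph_perm :: "nat \<Rightarrow> nat set set \<Rightarrow> (nat \<Rightarrow> nat) \<Rightarrow> bool" where
  "graph_perm N E w \<longleftrightarrow>
     w permutes {1..N} \<and>
     (\<forall>i \<in> {1..N}. same_component E (w ` {1..i}) (w i) (Max (w ` {1..i})))"

definition L_perms :: "nat \<Rightarrow> nat \<Rightarrow> (nat \<Rightarrow> nat) set" where
  "L_perms m n = {w. graph_perm (m + n) (L_edges m n) w}"

definition tubing_chains :: "nat \<Rightarrow> nat \<Rightarrow> (nat \<Rightarrow> nat) set set" where
  "tubing_chains m n =
     {C. C \<subseteq> L_perms m n \<and> Complete_Partial_Order.chain (weak_le (m + n)) C}"

text \<open>\<open>L_perms m n\<close> is finite, so maximum length is maximum cardinality.\<close>

definition LMC :: "nat \<Rightarrow> nat \<Rightarrow> (nat \<Rightarrow> nat) set set" where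
  "LMC m n = {C \<in> tubing_chains m n. \<forall>D \<in> tubing_chains m n. card D \<le> card C}"


section \<open>Edelman--Greene insertion\<close>

text \<open>A tableau is the list of its rows from top to bottom. Inserting into a single row returns
  the new row and the value to be inserted into the next row, or \<open>None\<close> if the insertion stops.
  The rows that arise are strictly increasing, so the replacement affects a single entry.\<close>

definition eg_row :: "nat \<Rightarrow> nat list \<Rightarrow> nat list \<times> nat option" where
  "eg_row x r =
     (if \<forall>y \<in> set r. y < x then (r @ [x], None)
      else let z = Min {y \<in> set r. x \<le> y} in
        if z = x then (r, Some (z + 1))
        else (map (\<lambda>y. if y = z then x else y) r, Some z))"

text \<open>The second component of the result is the list index of the row that got the new cell.\<close>

fun eg_insert :: "nat \<Rightarrow> nat list list \<Rightarrow> nat list list \<times> nat" where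
  "eg_insert x [] = ([[x]], 0)"
| "eg_insert x (r # P) =
     (case eg_row x r of
        (r', None) \<Rightarrow> (r' # P, 0)
      | (r', Some y) \<Rightarrow> (let (P', i) = eg_insert y P in (r' # P', Suc i)))"

definition add_cell :: "nat \<Rightarrow> nat \<Rightarrow> nat list list \<Rightarrow> nat list list" where
  "add_cell i t Q = (if i < length Q then Q[i := Q ! i @ [t]] else Q @ [[t]])"

definition eg_step :: "nat \<times> nat \<Rightarrow> nat list list \<times> nat list list \<Rightarrow> nat list list \<times> nat list list" where
  "eg_step = (\<lambda>(t, x) (P, Q). let (P', i) = eg_insert x P in (P', add_cell i t Q))"

definition EG :: "nat list \<Rightarrow> nat list list \<times> nat list list" where
  "EG \<alpha> = fold eg_step (enumerate 1 \<alpha>) ([], [])"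

definition EG_Q :: "nat list \<Rightarrow> nat list list" where
  "EG_Q \<alpha> = snd (EG \<alpha>)"


section \<open>Shiftable tableaux\<close>

text \<open>The convention that the entries of row 0 are 0 is needed for \<open>n_row_shiftable\<close> below.\<close>

definition tab_entry :: "nat list list \<Rightarrow> nat \<Rightarrow> nat \<Rightarrow> nat" where
  "tab_entry T i j = (if i = 0 then 0 else T ! (i - 1) ! (j - 1))"

definition tab_cells :: "nat list list \<Rightarrow> (nat \<times> nat) set" where
  "tab_cells T = {(i, j). i \<in> {1..length T} \<and> j \<in> {1..length (T ! (i - 1))}}"

definition standard_tableau :: "nat list \<Rightarrow> nat list list \<Rightarrow> bool" where
  "standard_tableau shape T \<longleftrightarrow>
     sorted_wrt (\<ge>) shape \<and> 0 \<notin> set shape \<and> map length T = shape \<and>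
     bij_betw (\<lambda>(i, j). tab_entry T i j) (tab_cells T) {1..sum_list shape} \<and>
     (\<forall>i j. (i, j) \<in> tab_cells T \<and> (i, j + 1) \<in> tab_cells T
        \<longrightarrow> tab_entry T i j < tab_entry T i (j + 1)) \<and>
     (\<forall>i j. (i, j) \<in> tab_cells T \<and> (i + 1, j) \<in> tab_cells T
        \<longrightarrow> tab_entry T i j < tab_entry T (i + 1) j)"

definition shiftable :: "nat list list \<Rightarrow> bool" where
  "shiftable T \<longleftrightarrow>
     (\<exists>shape. standard_tableau shape T) \<and>
     (\<forall>i j. 2 \<le> j \<and> (i, j) \<in> tab_cells T \<and> (i + 1, j - 1) \<in> tab_cells T
        \<longrightarrow> tab_entry T i j < tab_entry T (i + 1) (j - 1))"

definition shiftable_words :: "nat \<Rightarrow> nat list set" where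
  "shiftable_words n = {\<tau> \<in> reduced_words (n + 1) (longest_perm (n + 1)). shiftable (EG_Q \<tau>)}"

definition staircase :: "nat \<Rightarrow> nat list" where
  "staircase N = rev [1..<N]"

text \<open>The bounds on \<open>i\<close> say $N-n-1 \le i \le N-2$, and those on \<open>j\<close> say $2 \le j \le N-i$,
  without truncated subtraction.\<close>

definition n_row_shiftable :: "nat \<Rightarrow> nat \<Rightarrow> nat list list \<Rightarrow> bool" where
  "n_row_shiftable N n T \<longleftrightarrow>
     standard_tableau (staircase N) T \<and>
     (\<forall>i j. N \<le> i + n + 1 \<and> i + 2 \<le> N \<and> 2 \<le> j \<and> i + j \<le> N
        \<longrightarrow> tab_entry T i j < tab_entry T (i + 1) (j - 1))"


section \<open>Commuting shuffles\<close>

text \<open>\<open>cs_indexed \<sigma> \<tau> \<rho> I J\<close>: the word \<open>\<rho>\<close> is a commuting shuffle of \<open>\<sigma>\<close> and \<open>\<tau>\<close> with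
  \<open>\<sigma>\<close>-index set \<open>I\<close> and \<open>\<tau>\<close>-index set \<open>J\<close>.\<close>

inductive cs_indexed :: "nat list \<Rightarrow> nat list \<Rightarrow> nat list \<Rightarrow> nat set \<Rightarrow> nat set \<Rightarrow> bool"
  for \<sigma> \<tau> :: "nat list" where
  base: "cs_indexed \<sigma> \<tau> (\<sigma> @ \<tau>) {1..length \<sigma>} {length \<sigma> + 1..length \<sigma> + length \<tau>}"
| swap: "\<lbrakk>cs_indexed \<sigma> \<tau> \<rho> I J; i \<in> I; i + 1 \<in> J;
          \<bar>int (\<rho> ! (i - 1)) - int (\<rho> ! i)\<bar> > 1\<rbrakk>
         \<Longrightarrow> cs_indexed \<sigma> \<tau> (\<rho>[i - 1 := \<rho> ! i, i := \<rho> ! (i - 1)])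
               ((I \<union> {i + 1}) - {i}) ((J \<union> {i}) - {i + 1})"

definition CS_words :: "nat list \<Rightarrow> nat list \<Rightarrow> nat list set" where
  "CS_words \<sigma> \<tau> = {\<rho>. \<exists>I J. cs_indexed \<sigma> \<tau> \<rho> I J}"

text \<open>Here \<open>\<sigma> @ \<tau>\<close> is automatically a reduced word, of \<open>longest_perm (m + n)\<close>.\<close>

definition CS :: "nat \<Rightarrow> nat \<Rightarrow> nat list set" where
  "CS m n = (\<Union>\<sigma> \<in> reduced_words (m + n) (v_perm m n). \<Union>\<tau> \<in> shiftable_words n. CS_words \<sigma> \<tau>)"

end

theory Submission
  imports Defs
begin

text \<open>
  Read a word from left to right as a sequence of steps, the letter \<open>x\<close> exchanging the entries in
  positions \<open>x\<close> and \<open>x + 1\<close>. The word is reduced iff every step puts a new pair of values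
  \<open>a < b\<close> out of order. A reduced word of the longest permutation therefore lists all pairs, each
  once, and for \<open>a < b < c\<close> it lists them either as \<open>ab, ac, bc\<close> or as \<open>bc, ac, ab\<close>. All three
  conditions of the theorem express that \<open>ab\<close> comes before \<open>bc\<close> whenever \<open>a < b < c\<close> and
  \<open>m \<le> b\<close>; this is \<open>lex_word 1 m \<rho>\<close>.

  \<^emph>\<open>Chains.\<close> A permutation fails to be an \<open>L\<close>-permutation exactly if it contains \<open>c\<close>, \<open>a\<close>, \<open>b\<close>
  in this order with \<open>a < b < c\<close> and \<open>m \<le> b\<close>: the missing path vertex \<open>b\<close> then separates \<open>a\<close> from
  the maximum. Such a moment occurs iff \<open>bc\<close> comes before \<open>ab\<close> (\<open>prefixes_L_perms_iff\<close>). A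
  reduced word of the longest permutation passes through as many permutations as any chain of the
  weak order can have, so its chain has maximum length as soon as it stays inside the tubing lattice
  (\<open>LMC_iff_prefixes_L_perms\<close>).

  \<^emph>\<open>Shuffles.\<close> Call a step small if the smaller of its two values is below \<open>m\<close>, and big
  otherwise. In \<open>\<sigma> @ \<tau>\<close> the steps of \<open>\<sigma>\<close> are the small ones. Exchanging two distant letters
  exchanges two disjoint pairs, whereas the condition above compares only pairs with a common value,
  so it survives (\<open>lex_word_swap\<close>). Conversely it forces a big step followed by a small one to have
  distant letters (\<open>small_after_big_distant\<close>), so bubble sort turns the word into some \<open>\<sigma> @ \<tau>\<close>.

  \<^emph>\<open>Insertion.\<close> The rows of the tableau are peeled off one at a time. The letters bumped out of
  the first row form a word, \<open>bumped \<alpha>\<close>, whose insertion produces the remaining rows, and \<open>\<alpha>\<close> and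
  \<open>bumped \<alpha> @ first_row \<alpha>\<close> are reduced words of the same permutation. The first row cuts the
  positions into blocks of consecutive positions; the last value in a block is its smallest one, and
  the permutation of \<open>bumped \<alpha>\<close> arises by moving it to the front of the block. So the
  inversions of \<open>bumped \<alpha>\<close> are those of \<open>\<alpha>\<close> except the pairs consisting of the minimum of a block
  and another element of it (\<open>pos_bumped_less_iff\<close>).

  Let \<open>\<alpha>\<close> be a reduced word of the longest permutation of the values \<open>s, ..., N\<close>. Then \<open>bumped \<alpha>\<close>
  is one for \<open>s + 1, ..., N\<close> and the first row ends up with all of \<open>N - s\<close> letters; hence the
  staircase. If \<open>m\<close> is at least \<open>s + 2\<close>, then \<open>\<alpha>\<close> satisfies the condition iff \<open>bumped \<alpha>\<close> does
  (\<open>lex_word_bumped_iff\<close>). For smaller \<open>m\<close> one has to require in addition that, at all times, the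
  second row is empty or shorter than the first one (\<open>lex_word_peel\<close>). Iterating,
  \<open>lex_word 1 m \<rho>\<close> means that, at all times and from row \<open>m - 1\<close> on, the next row is either
  empty or strictly shorter (\<open>lex_word_iff_row_strict\<close>), and since the entry of the recording
  tableau in row \<open>i\<close> and column \<open>j\<close> is the time at which row \<open>i\<close> gets its \<open>j\<close>-th cell, this is
  \<open>n\<close>-row-shiftability.
\<close>

section \<open>Words, positions and inversions\<close>

text \<open>The inverse permutation: \<open>pos \<alpha> u\<close> is the position of the value \<open>u\<close> in \<open>word_perm \<alpha>\<close>.\<close>

definition pos :: "nat list \<Rightarrow> nat \<Rightarrow> nat" where
  "pos \<alpha> = word_perm (rev \<alpha>)"

text \<open>
  For a position function \<open>p\<close> these are the inversions by value: the pairs whose larger element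
  stands first.
\<close>

definition invs :: "(nat \<Rightarrow> nat) \<Rightarrow> (nat \<times> nat) set" where
  "invs p = {(a, b). a < b \<and> p b < p a}"

text \<open>
  Agrees with minimality of the length (\<open>reduced_words_iff\<close>), but can be tested one letter at a
  time (\<open>reduced_snoc\<close>) and does not mention the size of the symmetric group.
\<close>

definition reduced :: "nat list \<Rightarrow> bool" where
  "reduced \<alpha> \<longleftrightarrow> card (invs (pos \<alpha>)) = length \<alpha>"

lemma word_perm_append: "word_perm (\<alpha> @ \<beta>) = word_perm \<alpha> \<circ> word_perm \<beta>"
  by (induction \<alpha>) (auto simp: comp_assoc)

lemma pos_Nil [simp]: "pos [] = id"
  by (simp add: pos_def)

lemma pos_append: "pos (\<alpha> @ \<beta>) = pos \<beta> \<circ> pos \<alpha>"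
  by (simp add: pos_def word_perm_append)

lemma pos_snoc: "pos (\<alpha> @ [x]) = adj_transp x \<circ> pos \<alpha>"
  by (simp add: pos_append) (simp add: pos_def)

lemma pos_word_perm [simp]: "pos \<alpha> (word_perm \<alpha> u) = u"
  by (induction \<alpha> arbitrary: u) (auto simp: pos_def word_perm_append)

lemma word_perm_pos [simp]: "word_perm \<alpha> (pos \<alpha> u) = u"
  using pos_word_perm[of "rev \<alpha>" u] by (simp add: pos_def)

lemma pos_eq_iff [simp]: "pos \<alpha> u = pos \<alpha> v \<longleftrightarrow> u = v"
  by (metis word_perm_pos)

lemma bij_pos: "bij (pos \<alpha>)"
  by (rule o_bij[of "word_perm \<alpha>"]) auto

lemma pos_cong: "word_perm \<alpha> = word_perm \<beta> \<Longrightarrow> pos \<alpha> = pos \<beta>"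
  by (metis ext pos_word_perm word_perm_pos)

text \<open>
  An adjacent transposition changes the relative order of its own two positions only, so a step
  changes the inversion set by a single pair.
\<close>

lemma adj_transp_less_iff:
  assumes "\<not> (i = x \<and> j = Suc x)" "\<not> (i = Suc x \<and> j = x)"
  shows "adj_transp x i < adj_transp x j \<longleftrightarrow> i < j"
  using assms by (auto simp: transpose_def)

lemma invs_insert:
  assumes "inj p" "p a = x" "p b = Suc x" "a < b"
  shows "invs (adj_transp x \<circ> p) = insert (a, b) (invs p)" "(a, b) \<notin> invs p"
proof -
  have *: "p d = x \<longrightarrow> d = a" "p d = Suc x \<longrightarrow> d = b" for d
    using assms by (metis injD)+
  show "invs (adj_transp x \<circ> p) = insert (a, b) (invs p)"
  proof (rule set_eqI, clarify)
    fix c d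
    show "(c, d) \<in> invs (adj_transp x \<circ> p) \<longleftrightarrow> (c, d) \<in> insert (a, b) (invs p)"
    proof (cases "(c = a \<and> d = b) \<or> (c = b \<and> d = a)")
      case True
      then show ?thesis using assms by (auto simp: invs_def)
    next
      case False
      then have "adj_transp x (p d) < adj_transp x (p c) \<longleftrightarrow> p d < p c"
        using * by (intro adj_transp_less_iff) blast+
      with False show ?thesis by (auto simp: invs_def)
    qed
  qed
  show "(a, b) \<notin> invs p" using assms by (auto simp: invs_def)
qed

lemma invs_remove:
  assumes "inj p" "p a = x" "p b = Suc x" "b < a"
  shows "invs (adj_transp x \<circ> p) \<subseteq> invs p"
proof clarify
  fix c d
  assume cd: "(c, d) \<in> invs (adj_transp x \<circ> p)"
  have *: "p d = x \<longrightarrow> d = a" "p d = Suc x \<longrightarrow> d = b" for d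
    using assms by (metis injD)+
  show "(c, d) \<in> invs p"
  proof (cases "(c = a \<and> d = b) \<or> (c = b \<and> d = a)")
    case True
    then show ?thesis using assms cd by (auto simp: invs_def)
  next
    case False
    then have "adj_transp x (p d) < adj_transp x (p c) \<longleftrightarrow> p d < p c"
      using * by (intro adj_transp_less_iff) blast+
    with cd show ?thesis by (auto simp: invs_def)
  qed
qed

lemma invs_snoc_up:
  assumes "word_perm \<alpha> x < word_perm \<alpha> (Suc x)"
  shows "invs (pos (\<alpha> @ [x])) = insert (word_perm \<alpha> x, word_perm \<alpha> (Suc x)) (invs (pos \<alpha>))"
    "(word_perm \<alpha> x, word_perm \<alpha> (Suc x)) \<notin> invs (pos \<alpha>)"
  using invs_insert[OF bij_is_inj[OF bij_pos], of \<alpha> "word_perm \<alpha> x" x "word_perm \<alpha> (Suc x)"] assms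
  by (simp_all add: pos_snoc)

lemma invs_snoc_down:
  assumes "\<not> word_perm \<alpha> x < word_perm \<alpha> (Suc x)"
  shows "invs (pos (\<alpha> @ [x])) \<subseteq> invs (pos \<alpha>)"
proof -
  have "word_perm \<alpha> x \<noteq> word_perm \<alpha> (Suc x)"
    by (metis n_not_Suc_n pos_word_perm)
  then show ?thesis
    using invs_remove[OF bij_is_inj[OF bij_pos], of \<alpha> "word_perm \<alpha> x" x "word_perm \<alpha> (Suc x)"] assms
    by (simp add: pos_snoc)
qed

lemma invs_id [simp]: "invs id = {}" "invs (\<lambda>a. a) = {}"
  by (auto simp: invs_def)

lemma finite_invs [simp]: "finite (invs (pos \<alpha>))"
proof (induction \<alpha> rule: rev_induct)
  case (snoc x \<alpha>)
  then show ?case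
    by (cases "word_perm \<alpha> x < word_perm \<alpha> (Suc x)")
      (auto simp: invs_snoc_up dest: invs_snoc_down finite_subset)
qed simp

lemma card_invs_le: "card (invs (pos \<alpha>)) \<le> length \<alpha>"
proof (induction \<alpha> rule: rev_induct)
  case (snoc x \<alpha>)
  show ?case
  proof (cases "word_perm \<alpha> x < word_perm \<alpha> (Suc x)")
    case True
    then show ?thesis using snoc by (simp add: invs_snoc_up)
  next
    case False
    from card_mono[OF finite_invs invs_snoc_down[OF False]] show ?thesis using snoc by simp
  qed
qed simp

lemma reduced_Nil [simp]: "reduced []"
  by (simp add: reduced_def)

lemma reduced_snoc: "reduced (\<alpha> @ [x]) \<longleftrightarrow> reduced \<alpha> \<and> word_perm \<alpha> x < word_perm \<alpha> (Suc x)"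
proof (cases "word_perm \<alpha> x < word_perm \<alpha> (Suc x)")
  case True
  then show ?thesis by (simp add: reduced_def invs_snoc_up)
next
  case False
  from card_mono[OF finite_invs invs_snoc_down[OF False]] card_invs_le[of \<alpha>] False
  show ?thesis by (simp add: reduced_def)
qed

lemma reduced_appendD: "reduced (\<alpha> @ \<beta>) \<Longrightarrow> reduced \<alpha>"
proof (induction \<beta> rule: rev_induct)
  case (snoc x \<beta>)
  then show ?case using reduced_snoc[of "\<alpha> @ \<beta>" x] by simp
qed simp

text \<open>In a reduced word every step creates an inversion, and none is ever removed.\<close>

lemma invs_append_mono: "reduced (\<alpha> @ \<beta>) \<Longrightarrow> invs (pos \<alpha>) \<subseteq> invs (pos (\<alpha> @ \<beta>))"
proof (induction \<beta> rule: rev_induct)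
  case (snoc x \<beta>)
  then have "invs (pos \<alpha>) \<subseteq> invs (pos (\<alpha> @ \<beta>))" "invs (pos (\<alpha> @ \<beta>)) \<subseteq> invs (pos ((\<alpha> @ \<beta>) @ [x]))"
    using reduced_snoc[of "\<alpha> @ \<beta>" x] invs_snoc_up[of "\<alpha> @ \<beta>" x] by auto
  then show ?case by simp
qed simp

lemma reduced_cong:
  assumes "reduced \<alpha>" "word_perm \<beta> = word_perm \<alpha>" "length \<beta> = length \<alpha>"
  shows "reduced \<beta>"
  using assms pos_cong[OF assms(2)] by (simp add: reduced_def)

lemma reduced_take: "reduced \<alpha> \<Longrightarrow> reduced (take k \<alpha>)"
  by (metis append_take_drop_id reduced_appendD)

lemma invs_take_mono:
  assumes "reduced \<alpha>" "k \<le> l"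
  shows "invs (pos (take k \<alpha>)) \<subseteq> invs (pos (take l \<alpha>))"
proof -
  have "take l \<alpha> = take k \<alpha> @ drop k (take l \<alpha>)"
    using assms(2) by (metis append_take_drop_id min.absorb1 take_take)
  then show ?thesis
    using invs_append_mono[of "take k \<alpha>" "drop k (take l \<alpha>)"] reduced_take[OF assms(1), of l] by simp
qed

lemma pos_fixes:
  assumes "\<forall>x\<in>set \<alpha>. u \<noteq> x \<and> u \<noteq> Suc x"
  shows "pos \<alpha> u = u" "word_perm \<alpha> u = u"
proof -
  show "word_perm \<alpha> u = u"
    using assms by (induction \<alpha>) (auto simp: transpose_def)
  then show "pos \<alpha> u = u" by (metis pos_word_perm)
qed

lemma word_perm_permutes:
  assumes "set \<alpha> \<subseteq> {s..<N}"
  shows "word_perm \<alpha> permutes {s..N}" "pos \<alpha> permutes {s..N}"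
proof -
  have *: "set \<alpha> \<subseteq> {s..<N} \<Longrightarrow> word_perm \<alpha> permutes {s..N}" for \<alpha>
  proof (induction \<alpha>)
    case (Cons x \<alpha>)
    then have "word_perm \<alpha> permutes {s..N}" "adj_transp x permutes {s..N}"
      by (auto intro: permutes_swap_id)
    then show ?case by (simp only: word_perm.simps permutes_compose)
  qed (simp add: permutes_id)
  show "word_perm \<alpha> permutes {s..N}" "pos \<alpha> permutes {s..N}"
    using *[of \<alpha>] *[of "rev \<alpha>"] assms by (auto simp: pos_def)
qed

lemma invs_iff: "a < b \<Longrightarrow> (a, b) \<in> invs (pos \<alpha>) \<longleftrightarrow> \<not> pos \<alpha> a < pos \<alpha> b"
  by (auto simp: invs_def not_less nat_less_le)

lemma set_take_letters: "set \<alpha> \<subseteq> S \<Longrightarrow> set (take k \<alpha>) \<subseteq> S"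
  using set_take_subset by fastforce

lemma pos_ge:
  assumes "set \<alpha> \<subseteq> {s..<N}" "s \<le> u"
  shows "s \<le> pos \<alpha> u" "s \<le> word_perm \<alpha> u"
proof -
  have "\<pi> permutes {s..N} \<Longrightarrow> s \<le> \<pi> u" for \<pi>
    using assms(2) permutes_in_image[of \<pi> "{s..N}" u] permutes_not_in[of \<pi> "{s..N}" u]
    by (cases "u \<in> {s..N}") auto
  then show "s \<le> pos \<alpha> u" "s \<le> word_perm \<alpha> u"
    using word_perm_permutes[OF assms(1)] by auto
qed

lemma pos_le:
  assumes "set \<alpha> \<subseteq> {s..<N}" "u \<le> N"
  shows "pos \<alpha> u \<le> N"
  using assms(2) permutes_in_image[of "pos \<alpha>" "{s..N}" u] permutes_not_in[of "pos \<alpha>" "{s..N}" u]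
    word_perm_permutes(2)[OF assms(1)] by (cases "u \<in> {s..N}") auto

lemma permutes_invs_bounded:
  assumes "p permutes {s..N}" "(b, c) \<in> invs p"
  shows "s \<le> b" "c \<le> N"
proof -
  have bc: "b < c" "p c < p b" using assms(2) by (auto simp: invs_def)
  have in_image: "p u \<in> {s..N} \<longleftrightarrow> u \<in> {s..N}" and outside: "u \<notin> {s..N} \<Longrightarrow> p u = u" for u
    using permutes_in_image[OF assms(1)] permutes_not_in[OF assms(1)] by auto
  show "s \<le> b"
  proof (rule ccontr)
    assume "\<not> s \<le> b"
    then have "p b = b" using outside by simp
    then have "p c = c" using bc(2) in_image[of c] outside[of c] \<open>\<not> s \<le> b\<close> by auto
    then show False using bc \<open>p b = b\<close> by simp
  qed
  show "c \<le> N"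
  proof (rule ccontr)
    assume "\<not> c \<le> N"
    then have "p c = c" using outside by simp
    then have "p b = b" using bc(2) in_image[of b] outside[of b] \<open>\<not> c \<le> N\<close> by auto
    then show False using bc \<open>p c = c\<close> by simp
  qed
qed

lemma invs_bounded:
  assumes "set \<alpha> \<subseteq> {s..<N}" "(b, c) \<in> invs (pos \<alpha>)"
  shows "s \<le> b" "c \<le> N"
  using permutes_invs_bounded[OF word_perm_permutes(2)[OF assms(1)] assms(2)] .

section \<open>The first row of the insertion\<close>

text \<open>The state is the first row together with the word of letters passed on to the second row.\<close>

definition row_step :: "nat \<Rightarrow> nat list \<times> nat list \<Rightarrow> nat list \<times> nat list" where
  "row_step x = (\<lambda>(r, b). case eg_row x r of (r', None) \<Rightarrow> (r', b) | (r', Some y) \<Rightarrow> (r', b @ [y]))"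

definition first_row :: "nat list \<Rightarrow> nat list" where
  "first_row \<alpha> = fst (fold row_step \<alpha> ([], []))"

definition bumped :: "nat list \<Rightarrow> nat list" where
  "bumped \<alpha> = snd (fold row_step \<alpha> ([], []))"

lemma first_row_Nil [simp]: "first_row [] = []" and bumped_Nil [simp]: "bumped [] = []"
  by (simp_all add: first_row_def bumped_def)

lemma row_snoc:
  "first_row (\<alpha> @ [x]) = fst (eg_row x (first_row \<alpha>))"
  "bumped (\<alpha> @ [x]) = (case snd (eg_row x (first_row \<alpha>)) of None \<Rightarrow> bumped \<alpha> | Some y \<Rightarrow> bumped \<alpha> @ [y])"
  by (auto simp: first_row_def bumped_def row_step_def split: prod.splits option.splits)

lemma eg_row_cases:
  assumes "sorted_wrt (<) r"
  obtains (append) "\<forall>y\<in>set r. y < x" "eg_row x r = (r @ [x], None)"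
  | (special) A B where "r = A @ x # B" "eg_row x r = (r, Some (Suc x))"
  | (bump) A z B where "r = A @ z # B" "x < z" "\<forall>y\<in>set A. y < x" "eg_row x r = (A @ x # B, Some z)"
proof (cases "\<forall>y\<in>set r. y < x")
  case True
  then show ?thesis using append by (auto simp: eg_row_def)
next
  case False
  then obtain A z B where r: "r = A @ z # B" "\<not> z < x" "\<forall>y\<in>set A. y < x"
    using split_list_first_prop[of r "\<lambda>y. \<not> y < x"] by auto
  have B: "\<forall>y\<in>set B. z < y" and A: "\<forall>y\<in>set A. y < z"
    using assms r by (auto simp: sorted_wrt_append)
  have "Min {y \<in> set r. x \<le> y} = z"
    by (rule Min_eqI) (use r B in auto)
  then have eg: "eg_row x r = (if z = x then (r, Some (z + 1))
     else (map (\<lambda>y. if y = z then x else y) r, Some z))"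
    using False by (auto simp: eg_row_def)
  have "map (\<lambda>y. if y = z then x else y) A = A" "map (\<lambda>y. if y = z then x else y) B = B"
    using A B by (auto intro!: map_idI)
  then have "map (\<lambda>y. if y = z then x else y) r = A @ x # B"
    using r by simp
  then show ?thesis using eg r special bump by (cases "z = x") auto
qed

lemma first_row_sorted [simp]: "sorted_wrt (<) (first_row \<alpha>)"
proof (induction \<alpha> rule: rev_induct)
  case (snoc x \<alpha>)
  show ?case
  proof (cases rule: eg_row_cases[OF snoc, of x, case_names append special bump])
    case (bump A z B)
    then have "\<forall>y\<in>set B. x < y"
      using snoc by (auto simp: sorted_wrt_append)
    with bump show ?thesis
      using snoc by (simp add: row_snoc sorted_wrt_append)
  qed (use snoc in \<open>simp_all add: row_snoc sorted_wrt_append\<close>)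
qed simp

lemma distinct_first_row [simp]: "distinct (first_row \<alpha>)"
  using first_row_sorted strict_sorted_iff by blast

text \<open>
  The three outcomes of inserting \<open>x\<close> into the first row: it is appended, it is already there, or
  it replaces \<open>z\<close>.
\<close>

lemma insertion_cases:
  obtains (append) "\<forall>y\<in>set (first_row \<alpha>). y < x" "first_row (\<alpha> @ [x]) = first_row \<alpha> @ [x]"
      "bumped (\<alpha> @ [x]) = bumped \<alpha>"
  | (special) A B where "first_row \<alpha> = A @ x # B" "first_row (\<alpha> @ [x]) = A @ x # B"
      "bumped (\<alpha> @ [x]) = bumped \<alpha> @ [Suc x]" "\<forall>y\<in>set A. y < x" "\<forall>y\<in>set B. x < y"
  | (bump) A z B where "first_row \<alpha> = A @ z # B" "x < z" "\<forall>y\<in>set A. y < x" "\<forall>y\<in>set B. z < y"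
      "first_row (\<alpha> @ [x]) = A @ x # B" "bumped (\<alpha> @ [x]) = bumped \<alpha> @ [z]"
proof (cases rule: eg_row_cases[OF first_row_sorted[of \<alpha>], of x, case_names append special bump])
  case append
  then show ?thesis using that(1) by (simp add: row_snoc)
next
  case (special A B)
  then show ?thesis
    using that(2)[of A B] first_row_sorted[of \<alpha>] by (simp add: row_snoc sorted_wrt_append)
next
  case (bump A z B)
  then show ?thesis
    using that(3)[of A z B] first_row_sorted[of \<alpha>] by (simp add: row_snoc sorted_wrt_append)
qed

lemma length_bumped: "length (bumped \<alpha>) + length (first_row \<alpha>) = length \<alpha>"
proof (induction \<alpha> rule: rev_induct)
  case (snoc x \<alpha>)
  show ?case
    by (rule insertion_cases[of \<alpha> x]) (use snoc in auto)
qed simp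

lemma word_perm_commute:
  "\<forall>y\<in>set B. Suc x < y \<or> Suc y < x \<Longrightarrow> word_perm (x # B) = word_perm (B @ [x])"
proof (induction B)
  case (Cons y B)
  have "adj_transp x \<circ> adj_transp y = adj_transp y \<circ> adj_transp x"
    using Cons.prems by (auto simp: transpose_def fun_eq_iff)
  then have "word_perm (x # y # B) = adj_transp y \<circ> word_perm (x # B)"
    by (simp only: word_perm.simps comp_assoc[symmetric])
  moreover have "word_perm ((y # B) @ [x]) = adj_transp y \<circ> word_perm (B @ [x])"
    by simp
  moreover have "word_perm (x # B) = word_perm (B @ [x])"
    using Cons.prems by (intro Cons.IH) auto
  ultimately show ?case by (simp only:)
qed simp

lemma braid: "adj_transp x \<circ> adj_transp (Suc x) \<circ> adj_transp x
    = adj_transp (Suc x) \<circ> adj_transp x \<circ> adj_transp (Suc x)"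
proof
  fix i
  show "(adj_transp x \<circ> adj_transp (Suc x) \<circ> adj_transp x) i
    = (adj_transp (Suc x) \<circ> adj_transp x \<circ> adj_transp (Suc x)) i"
    by (cases "i = x"; cases "i = Suc x"; cases "i = Suc (Suc x)") (simp_all add: transpose_def)
qed

lemma word_perm_braid: "word_perm [x, Suc x, x] = word_perm [Suc x, x, Suc x]"
  using braid[of x] by (simp add: comp_assoc)

lemma word_perm_replace:
  "word_perm V = word_perm V' \<Longrightarrow> word_perm (U @ V @ W) = word_perm (U @ V' @ W)"
  by (simp add: word_perm_append)

text \<open>
  If \<open>x\<close> is already in the row, then so is \<open>x + 1\<close>: otherwise the new letter \<open>x\<close> commutes with
  all later letters of the row and cancels against the old one, contradicting reducedness.
\<close>

lemma special_insertion_adjacent: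
  assumes "reduced (\<alpha> @ [x])" and "word_perm (bumped \<alpha> @ first_row \<alpha>) = word_perm \<alpha>"
    and "first_row \<alpha> = A @ x # B"
  obtains B' where "B = Suc x # B'" "\<forall>y\<in>set B'. Suc x < y"
proof (cases "\<forall>y\<in>set B. Suc x < y")
  case True
  then have "word_perm (B @ [x]) = word_perm (x # B)"
    by (intro word_perm_commute[symmetric]) auto
  then have "word_perm ((bumped \<alpha> @ A @ [x]) @ (B @ [x]) @ []) = word_perm ((bumped \<alpha> @ A @ [x]) @ (x # B) @ [])"
    by (rule word_perm_replace)
  moreover have "word_perm (\<alpha> @ [x]) = word_perm ((bumped \<alpha> @ A @ [x]) @ (B @ [x]) @ [])"
    using assms(2)[symmetric] assms(3) by (simp add: word_perm_append comp_assoc)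
  moreover have "word_perm ((bumped \<alpha> @ A) @ [x, x] @ B) = word_perm ((bumped \<alpha> @ A) @ [] @ B)"
    by (rule word_perm_replace) auto
  ultimately have "word_perm (\<alpha> @ [x]) = word_perm (bumped \<alpha> @ A @ B)"
    by simp
  from pos_cong[OF this] have "length (\<alpha> @ [x]) \<le> length (bumped \<alpha> @ A @ B)"
    using assms(1) card_invs_le[of "bumped \<alpha> @ A @ B"] by (simp add: reduced_def)
  moreover have "length (bumped \<alpha>) + length (A @ x # B) = length \<alpha>"
    using length_bumped[of \<alpha>] assms(3) by simp
  ultimately show ?thesis by simp
next
  case False
  have *: "sorted_wrt (<) (A @ x # B)"
    using first_row_sorted[of \<alpha>] assms(3) by simp
  with False obtain y where "y \<in> set B" "y = Suc x"
    by (fastforce simp: sorted_wrt_append)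
  then obtain b B' where B: "B = b # B'" "b \<le> Suc x"
    using * by (cases B) (auto simp: sorted_wrt_append)
  moreover from this * have "b = Suc x" by (simp add: sorted_wrt_append)
  ultimately show ?thesis
    using * that[of B'] by (auto simp: sorted_wrt_append)
qed

text \<open>
  Each outcome of an insertion is an instance of the Coxeter relations. When \<open>x\<close> replaces \<open>z\<close>, both
  letters commute with what separates them from their new places; when \<open>x\<close> is already there, the
  braid relation turns \<open>x, x + 1, x\<close> into \<open>x + 1, x, x + 1\<close>, whose first letter is the one bumped.
\<close>

lemma word_perm_bumped_first_row:
  "reduced \<alpha> \<Longrightarrow> word_perm (bumped \<alpha> @ first_row \<alpha>) = word_perm \<alpha>"
proof (induction \<alpha> rule: rev_induct)
  case (snoc x \<alpha>)
  then have IH: "word_perm (bumped \<alpha> @ first_row \<alpha>) = word_perm \<alpha>"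
    using reduced_appendD by blast
  then have old: "word_perm (\<alpha> @ [x]) = word_perm (bumped \<alpha> @ first_row \<alpha> @ [x])"
    by (metis append_assoc word_perm_append)
  show ?case
  proof (cases rule: insertion_cases[of \<alpha> x, case_names append special bump])
    case append
    then show ?thesis using old by simp
  next
    case (special A B)
    obtain B' where B: "B = Suc x # B'" "\<forall>y\<in>set B'. Suc x < y"
      using special_insertion_adjacent[OF snoc.prems IH special(1)] by blast
    have "word_perm (B' @ [x]) = word_perm (x # B')"
      by (rule word_perm_commute[symmetric]) (use B in auto)
    from word_perm_replace[OF this, of "bumped \<alpha> @ A @ [x, Suc x]" "[]"]
    have "word_perm (\<alpha> @ [x]) = word_perm ((bumped \<alpha> @ A) @ [x, Suc x, x] @ B')"
      using old special B by simp
    also have "\<dots> = word_perm ((bumped \<alpha> @ A) @ [Suc x, x, Suc x] @ B')"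
      by (rule word_perm_replace[OF word_perm_braid])
    also have "\<dots> = word_perm (bumped \<alpha> @ (A @ [Suc x]) @ (x # Suc x # B'))"
      by simp
    also have "\<dots> = word_perm (bumped \<alpha> @ (Suc x # A) @ (x # Suc x # B'))"
      by (rule word_perm_replace[OF word_perm_commute[symmetric]]) (use special in auto)
    finally show ?thesis
      using special B by simp
  next
    case (bump A z B)
    have "word_perm (B @ [x]) = word_perm (x # B)"
      by (rule word_perm_commute[symmetric]) (use bump in auto)
    from word_perm_replace[OF this, of "bumped \<alpha> @ A @ [z]" "[]"]
    have "word_perm (\<alpha> @ [x]) = word_perm (bumped \<alpha> @ (A @ [z]) @ (x # B))"
      using old bump by simp
    also have "\<dots> = word_perm (bumped \<alpha> @ (z # A) @ (x # B))"
      by (rule word_perm_replace[OF word_perm_commute[symmetric]]) (use bump in auto)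
    finally show ?thesis
      using bump by simp
  qed
qed simp

lemma special_insertion_mem:
  assumes "reduced (\<alpha> @ [x])" "x \<in> set (first_row \<alpha>)"
  shows "Suc x \<in> set (first_row \<alpha>)"
proof -
  obtain A B where *: "first_row \<alpha> = A @ x # B"
    using split_list[OF assms(2)] by blast
  obtain B' where "B = Suc x # B'"
    by (rule special_insertion_adjacent[OF assms(1) word_perm_bumped_first_row[OF reduced_appendD[OF assms(1)]] *])
  then show ?thesis using * by simp
qed

lemma reduced_bumped_first_row: "reduced \<alpha> \<Longrightarrow> reduced (bumped \<alpha> @ first_row \<alpha>)"
  by (rule reduced_cong) (simp_all add: word_perm_bumped_first_row length_bumped)

lemma reduced_bumped: "reduced \<alpha> \<Longrightarrow> reduced (bumped \<alpha>)"
  using reduced_bumped_first_row reduced_appendD by blast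

lemma invs_bumped: "reduced \<alpha> \<Longrightarrow> invs (pos (bumped \<alpha>)) \<subseteq> invs (pos \<alpha>)"
  using invs_append_mono[OF reduced_bumped_first_row] pos_cong[OF word_perm_bumped_first_row] by metis

lemma pos_bumped: "reduced \<alpha> \<Longrightarrow> pos (bumped \<alpha>) u = word_perm (first_row \<alpha>) (pos \<alpha> u)"
  using pos_cong[OF word_perm_bumped_first_row, of \<alpha>] by (metis comp_apply pos_append word_perm_pos)

text \<open>
  For an increasing word \<open>r\<close>, the positions fall into blocks: \<open>i\<close> and \<open>i + 1\<close> belong to the same
  block iff \<open>i\<close> is a letter of \<open>r\<close>. The permutation of \<open>r\<close> rotates every block, moving each
  position one to the right and the last one to the front; this lemma and the next are the two parts
  of that description.
\<close>

lemma row_perm_mem: "sorted_wrt (<) r \<Longrightarrow> i \<in> set r \<Longrightarrow> word_perm r i = Suc i"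
proof (induction r rule: rev_induct)
  case (snoc x r)
  have "word_perm r (Suc x) = Suc x"
    by (rule pos_fixes(2)) (use snoc.prems in \<open>auto simp: sorted_wrt_append\<close>)
  moreover have "i \<noteq> x \<Longrightarrow> i \<in> set r \<and> i < x"
    using snoc.prems by (auto simp: sorted_wrt_append)
  ultimately show ?case
    using snoc by (cases "i = x") (auto simp: word_perm_append sorted_wrt_append transpose_def)
qed simp

lemma row_perm_nonmem:
  "sorted_wrt (<) r \<Longrightarrow> i \<notin> set r \<Longrightarrow> j \<le> i \<Longrightarrow> {j..<i} \<subseteq> set r \<Longrightarrow> j = 0 \<or> j - 1 \<notin> set r
    \<Longrightarrow> word_perm r i = j"
proof (induction r arbitrary: i rule: rev_induct)
  case (snoc x r)
  have *: "\<forall>y\<in>set r. y < x" using snoc.prems by (auto simp: sorted_wrt_append)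
  show ?case
  proof (cases "i = Suc x")
    case True
    then have "j \<le> x" using snoc.prems by (cases "j = Suc x") auto
    moreover from this have "{j..<x} \<subseteq> set r"
      using snoc.prems(4) True by fastforce
    ultimately have "word_perm r x = j"
      using snoc.prems * by (intro snoc.IH) (auto simp: sorted_wrt_append)
    then show ?thesis using True by (simp add: word_perm_append)
  next
    case False
    have "i \<noteq> x" using snoc.prems by auto
    have "x \<notin> {j..<i}"
    proof
      assume "x \<in> {j..<i}"
      then have "Suc x \<in> {j..<i}" using False by auto
      then have "Suc x \<in> set (r @ [x])" using snoc.prems(4) by blast
      then show False using * by auto
    qed
    then have "{j..<i} \<subseteq> set r" using snoc.prems(4) by auto
    then have "word_perm r i = j"
      using snoc.prems by (intro snoc.IH) (auto simp: sorted_wrt_append)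
    then show ?thesis using False \<open>i \<noteq> x\<close> by (simp add: word_perm_append transpose_def)
  qed
qed simp

lemma block_start: "\<exists>j\<le>i. {j..<i} \<subseteq> R \<and> (j = 0 \<or> j - 1 \<notin> R)" for i :: nat
proof (induction i)
  case (Suc i)
  show ?case
  proof (cases "i \<in> R")
    case True
    obtain j where j: "j \<le> i" "{j..<i} \<subseteq> R" "j = 0 \<or> j - 1 \<notin> R"
      using Suc.IH by blast
    moreover have "{j..<Suc i} \<subseteq> R"
      using j(2) True by (simp add: atLeastLessThanSuc)
    ultimately show ?thesis by (intro exI[of _ j]) simp
  next
    case False
    then show ?thesis by (intro exI[of _ "Suc i"]) simp
  qed
qed simp

lemma row_perm_nonmem_le:
  assumes "sorted_wrt (<) r" "i \<notin> set r" "l \<le> i"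
  shows "word_perm r i \<le> l \<longleftrightarrow> {l..<i} \<subseteq> set r"
proof -
  obtain j where j: "j \<le> i" "{j..<i} \<subseteq> set r" "j = 0 \<or> j - 1 \<notin> set r"
    using block_start by blast
  then have *: "word_perm r i = j"
    using assms by (intro row_perm_nonmem)
  show ?thesis
  proof (cases "j \<le> l")
    case True
    then show ?thesis using * j(2) by auto
  next
    case False
    then have "j - 1 \<in> {l..<i}" "j - 1 \<notin> set r" using j by auto
    then show ?thesis using * False by blast
  qed
qed

text \<open>
  A rotation of the blocks reverses the order of two positions only if the right one ends the block
  of the left one.
\<close>

lemma row_perm_less_iff:
  assumes "sorted_wrt (<) r" "i < j"
  shows "word_perm r j < word_perm r i \<longleftrightarrow> j \<notin> set r \<and> {i..<j} \<subseteq> set r"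
proof (cases "j \<in> set r")
  case True
  moreover have "i \<notin> set r \<Longrightarrow> word_perm r i \<le> i"
    using row_perm_nonmem_le[OF assms(1), of i i] by simp
  ultimately show ?thesis
    using assms row_perm_mem[OF assms(1)] by (cases "i \<in> set r") fastforce+
next
  case j: False
  show ?thesis
  proof (cases "i \<in> set r")
    case True
    have "word_perm r j \<noteq> word_perm r i"
      using assms(2) by (metis nat_neq_iff pos_word_perm)
    moreover have "word_perm r j \<le> i \<longleftrightarrow> {i..<j} \<subseteq> set r"
      using row_perm_nonmem_le[OF assms(1) j] assms(2) by simp
    ultimately show ?thesis using j row_perm_mem[OF assms(1) True] by auto
  next
    case False
    have "word_perm r i \<le> i"
      using row_perm_nonmem_le[OF assms(1) False, of i] by simp
    moreover have "i < word_perm r j"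
      using row_perm_nonmem_le[OF assms(1) j, of i] assms(2) False by fastforce
    ultimately show ?thesis using False assms(2) by fastforce
  qed
qed

text \<open>
  Peeling off the first row moves the last value of each block to the front, so two values change
  their relative order iff they lie in the same block and one of them ends it.
\<close>

lemma pos_bumped_less_iff:
  assumes "reduced \<alpha>" "pos \<alpha> u < pos \<alpha> v"
  shows "pos (bumped \<alpha>) v < pos (bumped \<alpha>) u \<longleftrightarrow>
    pos \<alpha> v \<notin> set (first_row \<alpha>) \<and> {pos \<alpha> u..<pos \<alpha> v} \<subseteq> set (first_row \<alpha>)"
  using row_perm_less_iff[OF first_row_sorted assms(2)] pos_bumped[OF assms(1)] by simp

text \<open>Otherwise the pair would be an inversion of \<open>bumped \<alpha>\<close> but not of \<open>\<alpha>\<close>.\<close>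

lemma block_end_minimal:
  assumes "reduced \<alpha>" "pos \<alpha> u < pos \<alpha> v"
    and "pos \<alpha> v \<notin> set (first_row \<alpha>)" "{pos \<alpha> u..<pos \<alpha> v} \<subseteq> set (first_row \<alpha>)"
  shows "v < u"
proof (rule ccontr)
  assume "\<not> v < u"
  with assms(2) have "u < v" by (metis nat_neq_iff)
  moreover have "pos (bumped \<alpha>) v < pos (bumped \<alpha>) u"
    using assms pos_bumped_less_iff by blast
  ultimately have "(u, v) \<in> invs (pos \<alpha>)"
    using invs_bumped[OF assms(1)] by (auto simp: invs_def)
  then show False using assms(2) by (auto simp: invs_def)
qed

text \<open>
  All bumped letters are larger than the smallest letter of the word, so \<open>bumped \<alpha>\<close> fixes the value
  \<open>s\<close>; this is what makes an induction over \<open>s\<close> possible.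
\<close>

lemma row_letters:
  assumes "reduced \<alpha>" "set \<alpha> \<subseteq> {s..<N}"
  shows "set (first_row \<alpha>) \<subseteq> {s..<N}" "set (bumped \<alpha>) \<subseteq> {Suc s..<N}"
proof -
  have "set (first_row \<alpha>) \<subseteq> {s..<N} \<and> set (bumped \<alpha>) \<subseteq> {Suc s..<N}"
    using assms
  proof (induction \<alpha> rule: rev_induct)
    case (snoc x \<alpha>)
    then have IH: "set (first_row \<alpha>) \<subseteq> {s..<N}" "set (bumped \<alpha>) \<subseteq> {Suc s..<N}"
      using reduced_appendD by fastforce+
    have x: "s \<le> x" "x < N" using snoc.prems by auto
    show ?case
    proof (cases rule: insertion_cases[of \<alpha> x, case_names append special bump])
      case (special A B)
      then have "Suc x \<in> set (first_row \<alpha>)"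
        using special_insertion_mem[OF snoc.prems(1)] by simp
      then have "Suc x < N" using IH(1) by auto
      then show ?thesis using special IH x by auto
    next
      case append
      then show ?thesis using IH x by simp
    next
      case (bump A z B)
      then have "z < N" "set A \<subseteq> {s..<N}" "set B \<subseteq> {s..<N}" using IH(1) by auto
      then show ?thesis using bump IH x by simp
    qed
  qed simp
  then show "set (first_row \<alpha>) \<subseteq> {s..<N}" "set (bumped \<alpha>) \<subseteq> {Suc s..<N}" by auto
qed

lemma bumped_snoc: "bumped (\<alpha> @ [x]) = bumped \<alpha> \<or> (\<exists>y. bumped (\<alpha> @ [x]) = bumped \<alpha> @ [y])"
  by (cases "snd (eg_row x (first_row \<alpha>))") (simp_all add: row_snoc)

lemma bumped_append: "\<exists>\<gamma>. bumped (\<alpha> @ \<beta>) = bumped \<alpha> @ \<gamma>"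
proof (induction \<beta> rule: rev_induct)
  case (snoc x \<beta>)
  then show ?case using bumped_snoc[of "\<alpha> @ \<beta>" x] by auto
qed simp

text \<open>
  Together with the next lemma: the prefixes of \<open>bumped \<alpha>\<close> are the words bumped by prefixes of
  \<open>\<alpha>\<close>, so statements about all prefixes pass between the two words.
\<close>

lemma bumped_take: "\<exists>l. bumped (take k \<alpha>) = take l (bumped \<alpha>)"
proof -
  obtain \<gamma> where "bumped (take k \<alpha> @ drop k \<alpha>) = bumped (take k \<alpha>) @ \<gamma>"
    using bumped_append by blast
  then have "bumped (take k \<alpha>) = take (length (bumped (take k \<alpha>))) (bumped \<alpha>)"
    by simp
  then show ?thesis by blast
qed

lemma take_bumped: "\<exists>k. take l (bumped \<alpha>) = bumped (take k \<alpha>)"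
proof (induction \<alpha> rule: rev_induct)
  case (snoc x \<alpha>)
  then obtain k where k: "take l (bumped \<alpha>) = bumped (take k \<alpha>)" by blast
  have *: "\<exists>k'. bumped (take k \<alpha>) = bumped (take k' (\<alpha> @ [x]))"
    by (rule exI[of _ "min k (length \<alpha>)"]) (auto simp: min_def)
  show ?case
  proof (cases "l \<le> length (bumped \<alpha>)")
    case True
    then have "take l (bumped (\<alpha> @ [x])) = take l (bumped \<alpha>)"
      using bumped_snoc[of \<alpha> x] by auto
    then show ?thesis using k * by simp
  next
    case False
    then have "take l (bumped (\<alpha> @ [x])) = bumped (\<alpha> @ [x])"
      using bumped_snoc[of \<alpha> x] by auto
    moreover have "bumped (\<alpha> @ [x]) = bumped (take (Suc (length \<alpha>)) (\<alpha> @ [x]))"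
      by simp
    ultimately show ?thesis by metis
  qed
qed simp

section \<open>Removing the first row\<close>

text \<open>
  Holds for the inversions at every moment of a word in which \<open>ab\<close> comes before \<open>bc\<close>. The values
  are at least \<open>s\<close> because \<open>s - 1\<close> rows have been peeled off.
\<close>

definition lex_closed :: "nat \<Rightarrow> nat \<Rightarrow> (nat \<Rightarrow> nat) \<Rightarrow> bool" where
  "lex_closed s m p \<longleftrightarrow>
     (\<forall>a b c. s \<le> a \<and> a < b \<and> b < c \<and> m \<le> b \<and> (b, c) \<in> invs p \<longrightarrow> (a, b) \<in> invs p)"

definition lex_word :: "nat \<Rightarrow> nat \<Rightarrow> nat list \<Rightarrow> bool" where
  "lex_word s m \<alpha> \<longleftrightarrow> (\<forall>k. lex_closed s m (pos (take k \<alpha>)))"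

text \<open>Reduced words of the permutation that reverses the values \<open>s, ..., N\<close> and fixes the others.\<close>

definition longest_word :: "nat \<Rightarrow> nat \<Rightarrow> nat list \<Rightarrow> bool" where
  "longest_word s N \<alpha> \<longleftrightarrow> reduced \<alpha> \<and> set \<alpha> \<subseteq> {s..<N} \<and>
     (\<forall>u v. s \<le> u \<and> u < v \<and> v \<le> N \<longrightarrow> (u, v) \<in> invs (pos \<alpha>))"

lemma lex_closedD:
  "lex_closed s m p \<Longrightarrow> s \<le> a \<Longrightarrow> a < b \<Longrightarrow> b < c \<Longrightarrow> m \<le> b \<Longrightarrow> (b, c) \<in> invs p \<Longrightarrow> (a, b) \<in> invs p"
  unfolding lex_closed_def by blast

text \<open>Any middle value \<open>b\<close> satisfies \<open>s + 1 \<le> b\<close>, so all \<open>m \<le> s + 1\<close> give the same condition.\<close>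

lemma lex_closed_weaken:
  assumes "lex_closed s m p" "m \<le> m' \<or> m \<le> Suc s"
  shows "lex_closed s m' p"
  unfolding lex_closed_def
proof (intro allI impI, elim conjE)
  fix a b c
  assume "s \<le> a" "a < b" "b < c" "m' \<le> b" "(b, c) \<in> invs p"
  then show "(a, b) \<in> invs p"
    using assms(2) by (intro lex_closedD[OF assms(1), of a b c]) auto
qed

lemma lex_word_weaken: "lex_word s m \<alpha> \<Longrightarrow> m \<le> m' \<or> m \<le> Suc s \<Longrightarrow> lex_word s m' \<alpha>"
  using lex_closed_weaken unfolding lex_word_def by blast

lemma lex_word_bumped_prefix:
  "lex_word s m (bumped \<alpha>) \<longleftrightarrow> (\<forall>k. lex_closed s m (pos (bumped (take k \<alpha>))))"
  unfolding lex_word_def by (metis bumped_take take_bumped)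

text \<open>
  The value \<open>s\<close> ends the first block: it stands in front after the peeling, because no bumped letter
  moves it.
\<close>

lemma first_block:
  assumes "reduced \<alpha>" "set \<alpha> \<subseteq> {s..<N}"
  shows "pos \<alpha> s \<notin> set (first_row \<alpha>)" "{s..<pos \<alpha> s} \<subseteq> set (first_row \<alpha>)"
proof -
  have "pos (bumped \<alpha>) s = s"
    by (intro pos_fixes(1)) (use row_letters(2)[OF assms] in fastforce)
  then have *: "word_perm (first_row \<alpha>) (pos \<alpha> s) = s"
    using pos_bumped[OF assms(1)] by simp
  have ge: "s \<le> pos \<alpha> s"
    using pos_ge[OF assms(2)] by simp
  show "pos \<alpha> s \<notin> set (first_row \<alpha>)"
    using * ge row_perm_mem[OF first_row_sorted, of "pos \<alpha> s" \<alpha>] by auto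
  then show "{s..<pos \<alpha> s} \<subseteq> set (first_row \<alpha>)"
    using row_perm_nonmem_le[OF first_row_sorted _ ge, of \<alpha>] * by simp
qed

text \<open>
  As long as \<open>s\<close> stands before \<open>s + 1\<close>, these two values end the first and the second block. No block
  can appear between them: whatever leaves the front of the second block because of a letter further
  left is absorbed by the first block in the same step.
\<close>

lemma adjacent_blocks:
  assumes "reduced \<alpha>" "set \<alpha> \<subseteq> {s..<N}" "pos \<alpha> s < pos \<alpha> (Suc s)"
  shows "pos \<alpha> (Suc s) \<notin> set (first_row \<alpha>) \<and> {Suc (pos \<alpha> s)..<pos \<alpha> (Suc s)} \<subseteq> set (first_row \<alpha>)"
  using assms
proof (induction \<alpha> rule: rev_induct)
  case (snoc x \<alpha>)
  define R where "R = set (first_row \<alpha>)"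
  define q where "q = pos \<alpha> s"
  define t where "t = pos \<alpha> (Suc s)"
  have reduced: "reduced \<alpha>" and letters: "set \<alpha> \<subseteq> {s..<N}" and x: "s \<le> x"
    using snoc.prems reduced_appendD by auto
  have "(s, Suc s) \<notin> invs (pos (\<alpha> @ [x]))"
    using snoc.prems(3) by (simp add: invs_def)
  then have "(s, Suc s) \<notin> invs (pos \<alpha>)"
    using invs_append_mono[OF snoc.prems(1)] by blast
  then have qt: "q < t"
    by (simp add: invs_iff q_def t_def)
  then have IH: "t \<notin> R" "{Suc q..<t} \<subseteq> R"
    using snoc.IH[OF reduced letters] by (auto simp: R_def q_def t_def)
  have q: "q \<notin> R" "{s..<q} \<subseteq> R"
    using first_block[OF reduced letters] by (auto simp: R_def q_def)
  have new: "pos (\<alpha> @ [x]) s = adj_transp x q" "pos (\<alpha> @ [x]) (Suc s) = adj_transp x t"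
    by (simp_all add: pos_snoc q_def t_def)
  \<comment> \<open>The positions up to \<open>t\<close> other than \<open>q\<close> and \<open>t\<close> are letters of the row.\<close>
  have xcases: "x \<in> R \<or> x = q \<or> t \<le> x"
    using x q(2) IH(2) by (metis Suc_leI atLeastLessThan_iff linorder_neqE_nat not_le subsetD)
  show ?case
  proof (cases rule: insertion_cases[of \<alpha> x, case_names append special bump])
    case append
    have "x \<notin> R" using append(1) by (auto simp: R_def)
    have R': "set (first_row (\<alpha> @ [x])) = insert x R"
      using append(2) by (simp add: R_def)
    show ?thesis
    proof (cases "x = q")
      case True
      then have "t = Suc q"
        using IH(2) qt append(1) by (fastforce simp: R_def)
      then show ?thesis using snoc.prems(3) new True by simp
    next
      case False
      then have "t \<le> x" using xcases \<open>x \<notin> R\<close> by blast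
      then have "adj_transp x q = q" "adj_transp x t = (if x = t then Suc t else t)"
        using qt by (auto simp: transpose_def)
      moreover have "Suc x \<notin> R" using append(1) by (auto simp: R_def)
      ultimately show ?thesis
        using new R' IH \<open>t \<le> x\<close> by (auto simp: less_Suc_eq)
    qed
  next
    case (special A B)
    have "x \<in> R" "Suc x \<in> R"
      using special(1) special_insertion_mem[OF snoc.prems(1)] by (auto simp: R_def)
    then have "adj_transp x q = q" "adj_transp x t = t"
      using q(1) IH(1) by (auto simp: transpose_def)
    then show ?thesis
      using new IH special(1,2) by (simp add: R_def)
  next
    case (bump A z B)
    have "x \<notin> R" "z \<in> R" using bump(1-4) by (auto simp: R_def)
    have R': "set (first_row (\<alpha> @ [x])) = insert x (R - {z})"
      using bump by (auto simp: R_def)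
    have between: "y \<notin> R" if "x < y" "y < z" for y
      using bump(1-4) that by (auto simp: R_def)
    show ?thesis
    proof (cases "x = q")
      case True
      have "t \<noteq> Suc q"
        using snoc.prems(3) new True by auto
      then have "Suc q \<in> R" using IH(2) qt by auto
      \<comment> \<open>The front value of the second block moves to the first block, which now ends at \<open>q + 1\<close>.\<close>
      then have "z = Suc q" using between[of "Suc q"] True bump(2) by (metis Suc_lessI lessI)
      moreover have "adj_transp x q = Suc q" "adj_transp x t = t"
        using True qt \<open>t \<noteq> Suc q\<close> by (auto simp: transpose_def)
      ultimately show ?thesis
        using new R' IH True qt by auto
    next
      case False
      then have "t \<le> x" using xcases \<open>x \<notin> R\<close> by blast
      then have "adj_transp x q = q" "adj_transp x t = (if x = t then Suc t else t)"
        using qt by (auto simp: transpose_def)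
      moreover have "Suc x \<notin> R - {z}" using between[of "Suc x"] bump(2) by (metis DiffE Suc_lessI insertI1 lessI)
      ultimately show ?thesis
        using new R' IH \<open>t \<le> x\<close> bump(2) by (auto simp: less_Suc_eq)
    qed
  qed
qed simp

text \<open>
  An inversion \<open>ab\<close> that is lost in the peeling has \<open>b\<close> in the block ended by \<open>a\<close>. But the condition
  puts \<open>b\<close> before \<open>s\<close> as well, hence into the first block, which is ended by \<open>s\<close> and not by \<open>a\<close>.
\<close>

lemma lex_closed_bumped:
  assumes "reduced \<alpha>" "set \<alpha> \<subseteq> {s..<N}" "lex_closed s m (pos \<alpha>)"
  shows "lex_closed (Suc s) m (pos (bumped \<alpha>))"
  unfolding lex_closed_def
proof clarify
  fix a b c
  assume abc: "Suc s \<le> a" "a < b" "b < c" "m \<le> b" "(b, c) \<in> invs (pos (bumped \<alpha>))"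
  then have "(b, c) \<in> invs (pos \<alpha>)" using invs_bumped[OF assms(1)] by blast
  then have "(a, b) \<in> invs (pos \<alpha>)" "(s, b) \<in> invs (pos \<alpha>)"
    using lex_closedD[OF assms(3), of _ b c] abc by auto
  then have less: "pos \<alpha> b < pos \<alpha> a" "pos \<alpha> b < pos \<alpha> s" by (auto simp: invs_def)
  show "(a, b) \<in> invs (pos (bumped \<alpha>))"
  proof (rule ccontr)
    assume "(a, b) \<notin> invs (pos (bumped \<alpha>))"
    then have "pos (bumped \<alpha>) a < pos (bumped \<alpha>) b"
      using abc(2) by (simp add: invs_iff)
    then have pending: "pos \<alpha> a \<notin> set (first_row \<alpha>)" "{pos \<alpha> b..<pos \<alpha> a} \<subseteq> set (first_row \<alpha>)"
      using pos_bumped_less_iff[OF assms(1) less(1)] by auto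
    have "pos \<alpha> a \<le> pos \<alpha> s"
      using first_block(1)[OF assms(1,2)] pending(2) less(2) by (meson atLeastLessThan_iff le_less_linear less_imp_le subsetD)
    moreover have "pos \<alpha> a \<noteq> pos \<alpha> s" using abc(1) by auto
    ultimately have "pos \<alpha> a < pos \<alpha> s" by (rule le_neq_trans)
    moreover have "s \<le> pos \<alpha> a" using pos_ge[OF assms(2)] abc(1) by simp
    ultimately have "pos \<alpha> a \<in> {s..<pos \<alpha> s}" by simp
    then show False using first_block(2)[OF assms(1,2)] pending(1) by blast
  qed
qed

text \<open>
  If \<open>bc\<close> is inverted before \<open>ab\<close>, then just before \<open>ab\<close> is inverted the three values stand in the
  order \<open>c, a, b\<close>, with \<open>a\<close> and \<open>b\<close> adjacent.
\<close>

lemma crossing_time: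
  assumes "reduced \<alpha>" "(a, b) \<in> invs (pos \<alpha>)" "b < c"
    and "(b, c) \<in> invs (pos (take k \<alpha>))" "(a, b) \<notin> invs (pos (take k \<alpha>))"
  obtains l where "pos (take l \<alpha>) b = Suc (pos (take l \<alpha>) a)" "pos (take l \<alpha>) c < pos (take l \<alpha>) a"
proof -
  define P where "P l \<longleftrightarrow> (a, b) \<in> invs (pos (take l \<alpha>))" for l
  define l where "l = (LEAST l. P l)"
  have "P (length \<alpha>)" using assms(2) by (simp add: P_def)
  then have Pl: "P l" unfolding l_def by (rule LeastI)
  have "k < l"
  proof (rule ccontr)
    assume "\<not> k < l"
    then show False
      using invs_take_mono[OF assms(1), of l k] Pl assms(5) by (auto simp: P_def)
  qed
  then obtain j where j: "l = Suc j" "k \<le> j" by (metis less_Suc_eq_le lessE less_imp_le_nat)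
  then have "\<not> P j" using not_less_Least[of j P] l_def by simp
  have "j < length \<alpha>"
  proof (rule ccontr)
    assume "\<not> j < length \<alpha>"
    then show False using Pl \<open>\<not> P j\<close> j(1) by (simp add: P_def)
  qed
  then have take: "take l \<alpha> = take j \<alpha> @ [\<alpha> ! j]"
    by (simp add: j(1) take_Suc_conv_app_nth)
  have "reduced (take j \<alpha> @ [\<alpha> ! j])" using reduced_take[OF assms(1), of l] take by simp
  then have "word_perm (take j \<alpha>) (\<alpha> ! j) < word_perm (take j \<alpha>) (Suc (\<alpha> ! j))"
    by (simp add: reduced_snoc)
  from invs_snoc_up[OF this] Pl \<open>\<not> P j\<close> take
  have ab: "a = word_perm (take j \<alpha>) (\<alpha> ! j)" "b = word_perm (take j \<alpha>) (Suc (\<alpha> ! j))"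
    by (auto simp: P_def)
  have "(b, c) \<in> invs (pos (take j \<alpha>))"
    using invs_take_mono[OF assms(1) j(2)] assms(4) by blast
  then have bc: "pos (take j \<alpha>) c < pos (take j \<alpha>) b" by (simp add: invs_def)
  have "a < b" using assms(2) by (simp add: invs_def)
  then have "pos (take j \<alpha>) c \<noteq> pos (take j \<alpha>) a" using assms(3) by auto
  then show ?thesis
    using that[of j] ab bc by (metis Suc_lessI less_Suc_eq pos_word_perm)
qed

text \<open>
  Suppose that some prefix violates the condition and go to the moment when \<open>c, a, b\<close> stand in this
  order. If \<open>a\<close> is not \<open>s\<close>, then \<open>bc\<close> must be lost in the peeling; then \<open>b\<close> ends the block that
  contains \<open>c\<close>, hence also \<open>a\<close>, and \<open>ab\<close> would be an inversion. If \<open>a\<close> is \<open>s\<close>, then \<open>bc\<close> survives,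
  because \<open>s\<close> ends a block between \<open>c\<close> and \<open>b\<close>. As \<open>m\<close> is at least \<open>s + 2\<close>, the condition for
  \<open>s + 1, b, c\<close> makes \<open>(s + 1, b)\<close> survive too, although \<open>b\<close> lies in the second block, the one
  ended by \<open>s + 1\<close>.
\<close>

lemma lex_word_of_bumped:
  assumes "longest_word s N \<alpha>" "Suc (Suc s) \<le> m" "lex_word (Suc s) m (bumped \<alpha>)"
  shows "lex_word s m \<alpha>"
  unfolding lex_word_def lex_closed_def
proof (intro allI impI, elim conjE)
  fix k a b c
  assume abc: "s \<le> a" "a < b" "b < c" "m \<le> b" "(b, c) \<in> invs (pos (take k \<alpha>))"
  have reduced: "reduced \<alpha>" and letters: "set \<alpha> \<subseteq> {s..<N}"
    using assms(1) by (auto simp: longest_word_def)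
  show "(a, b) \<in> invs (pos (take k \<alpha>))"
  proof (rule ccontr)
    assume no: "(a, b) \<notin> invs (pos (take k \<alpha>))"
    have "c \<le> N"
      using invs_bounded(2)[OF set_take_letters[OF letters] abc(5)] .
    then have "(a, b) \<in> invs (pos \<alpha>)"
      using assms(1) abc by (auto simp: longest_word_def)
    then obtain l where l: "pos (take l \<alpha>) b = Suc (pos (take l \<alpha>) a)" "pos (take l \<alpha>) c < pos (take l \<alpha>) a"
      using crossing_time[OF reduced _ abc(3) abc(5) no] by blast
    define \<beta> where "\<beta> = take l \<alpha>"
    define R where "R = set (first_row \<beta>)"
    have redb: "reduced \<beta>" and lb: "set \<beta> \<subseteq> {s..<N}"
      using reduced_take[OF reduced] set_take_letters[OF letters] by (auto simp: \<beta>_def)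
    have closed: "lex_closed (Suc s) m (pos (bumped \<beta>))"
      using assms(3) by (simp add: lex_word_bumped_prefix \<beta>_def)
    have p: "pos \<beta> b = Suc (pos \<beta> a)" "pos \<beta> c < pos \<beta> a"
      using l by (simp_all add: \<beta>_def)
    have ab': "(a, b) \<notin> invs (pos (bumped \<beta>))"
      using invs_bumped[OF redb] p(1) by (auto simp: invs_def)
    show False
    proof (cases "a = s")
      case False
      then have "(b, c) \<notin> invs (pos (bumped \<beta>))"
        using lex_closedD[OF closed, of a b c] abc ab' by auto
      then have "pos (bumped \<beta>) b < pos (bumped \<beta>) c"
        using abc(3) by (simp add: invs_iff)
      then have "pos \<beta> b \<notin> R" "{pos \<beta> c..<pos \<beta> b} \<subseteq> R"
        using pos_bumped_less_iff[OF redb, of c b] p by (auto simp: R_def)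
      then have "pos (bumped \<beta>) b < pos (bumped \<beta>) a"
        using pos_bumped_less_iff[OF redb, of a b] p by (auto simp: R_def)
      then show False using ab' abc(2) by (simp add: invs_def)
    next
      case True
      have "pos \<beta> s \<notin> R" using first_block(1)[OF redb lb] by (simp add: R_def)
      moreover have "pos \<beta> s \<in> {pos \<beta> c..<pos \<beta> b}" using p True by simp
      ultimately have "\<not> {pos \<beta> c..<pos \<beta> b} \<subseteq> R" by blast
      then have "\<not> pos (bumped \<beta>) b < pos (bumped \<beta>) c"
        using pos_bumped_less_iff[OF redb, of c b] p by (auto simp: R_def)
      then have "(b, c) \<in> invs (pos (bumped \<beta>))"
        using abc(3) by (simp add: invs_iff)
      then have sb': "(Suc s, b) \<in> invs (pos (bumped \<beta>))"
        using lex_closedD[OF closed, of "Suc s" b c] abc assms(2) by auto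
      then have less: "pos \<beta> b < pos \<beta> (Suc s)"
        using invs_bumped[OF redb] by (auto simp: invs_def)
      then have "pos \<beta> (Suc s) \<notin> R" "{Suc (pos \<beta> s)..<pos \<beta> (Suc s)} \<subseteq> R"
        using adjacent_blocks[OF redb lb] p(1) True by (auto simp: R_def)
      then have "pos (bumped \<beta>) (Suc s) < pos (bumped \<beta>) b"
        using pos_bumped_less_iff[OF redb less] p(1) True by (simp add: R_def)
      then show False using sb' by (simp add: invs_def)
    qed
  qed
qed

lemma lex_word_bumped_iff:
  assumes "longest_word s N \<alpha>" "Suc (Suc s) \<le> m"
  shows "lex_word s m \<alpha> \<longleftrightarrow> lex_word (Suc s) m (bumped \<alpha>)"
proof
  assume "lex_word s m \<alpha>"
  then show "lex_word (Suc s) m (bumped \<alpha>)"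
    unfolding lex_word_bumped_prefix using assms(1)
    by (auto simp: lex_word_def longest_word_def intro!: lex_closed_bumped[of _ s N] reduced_take
        dest: in_set_takeD)
qed (use lex_word_of_bumped[OF assms] in blast)

text \<open>
  In the end \<open>s\<close> stands in position \<open>N\<close> and ends the only block, so the peeling loses exactly the
  inversions that involve \<open>s\<close>.
\<close>

lemma longest_word_bumped:
  assumes "longest_word s N \<alpha>"
  shows "longest_word (Suc s) N (bumped \<alpha>)" and "length (first_row \<alpha>) = N - s"
proof -
  have reduced: "reduced \<alpha>" and letters: "set \<alpha> \<subseteq> {s..<N}"
    and full: "\<And>u v. s \<le> u \<Longrightarrow> u < v \<Longrightarrow> v \<le> N \<Longrightarrow> (u, v) \<in> invs (pos \<alpha>)"
    using assms by (auto simp: longest_word_def)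
  have perm: "pos \<alpha> permutes {s..N}" using word_perm_permutes[OF letters] by simp
  have sN: "pos \<alpha> s = N" if "s \<le> N"
  proof -
    have "N \<in> pos \<alpha> ` {s..N}" using permutes_image[OF perm] that by simp
    then obtain v where v: "v \<in> {s..N}" "pos \<alpha> v = N" by force
    show ?thesis
    proof (cases "v = s")
      case False
      then have "N < pos \<alpha> s" using full[of s v] v by (auto simp: invs_def)
      then show ?thesis using pos_le[OF letters that] by simp
    qed (use v in simp)
  qed
  have "set (first_row \<alpha>) = {s..<N}"
  proof (cases "s \<le> N")
    case True
    then show ?thesis
      using first_block(2)[OF reduced letters] row_letters(1)[OF reduced letters] sN by auto
  qed (use row_letters(1)[OF reduced letters] in auto)
  then show "length (first_row \<alpha>) = N - s"
    by (metis card_atLeastLessThan distinct_card distinct_first_row)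
  show "longest_word (Suc s) N (bumped \<alpha>)"
    unfolding longest_word_def
  proof (intro conjI allI impI)
    fix u v
    assume uv: "Suc s \<le> u \<and> u < v \<and> v \<le> N"
    then have less: "pos \<alpha> v < pos \<alpha> u" using full[of u v] by (auto simp: invs_def)
    have "pos \<alpha> u \<noteq> pos \<alpha> s" "pos \<alpha> u \<le> N" "s \<le> pos \<alpha> u"
      using uv pos_le[OF letters, of u] pos_ge[OF letters, of u] by auto
    then have "pos \<alpha> u \<in> {s..<pos \<alpha> s}" using sN uv by simp
    then have "pos \<alpha> u \<in> set (first_row \<alpha>)" using first_block(2)[OF reduced letters] by blast
    then have "\<not> pos (bumped \<alpha>) u < pos (bumped \<alpha>) v"
      using pos_bumped_less_iff[OF reduced less] by simp
    then show "(u, v) \<in> invs (pos (bumped \<alpha>))"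
      using uv by (simp add: invs_iff)
  qed (use reduced_bumped[OF reduced] row_letters(2)[OF reduced letters] in auto)
qed

text \<open>
  The two values are the end \<open>d\<close> of the block that contains position \<open>y\<close>, and the value \<open>e\<close> in
  position \<open>y\<close> itself.
\<close>

lemma late_block:
  assumes "reduced \<alpha>" "set \<alpha> \<subseteq> {s..<N}" "y \<in> set (first_row \<alpha>)" "pos \<alpha> s < y"
  obtains d e where "s < d" "d < e" "(d, e) \<in> invs (pos \<alpha>)" "y < pos \<alpha> d"
proof -
  define R where "R = set (first_row \<alpha>)"
  have "N \<notin> R" using row_letters(1)[OF assms(1,2)] by (auto simp: R_def)
  have "y < N" using row_letters(1)[OF assms(1,2)] assms(3) by auto
  \<comment> \<open>The first position from \<open>y\<close> on that is not in the row ends the block of \<open>y\<close>.\<close>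
  define z where "z = (LEAST z. y \<le> z \<and> z \<notin> R)"
  have z: "y \<le> z" "z \<notin> R"
    using LeastI[of "\<lambda>z. y \<le> z \<and> z \<notin> R" N] \<open>N \<notin> R\<close> \<open>y < N\<close> by (simp_all add: z_def)
  have block: "{y..<z} \<subseteq> R"
  proof
    fix i assume "i \<in> {y..<z}"
    then show "i \<in> R"
      using not_less_Least[of i "\<lambda>z. y \<le> z \<and> z \<notin> R"] by (simp add: z_def)
  qed
  have "y < z" using z assms(3) by (auto simp: R_def nat_less_le)
  define d where "d = word_perm \<alpha> z"
  define e where "e = word_perm \<alpha> y"
  have "d < e"
    using block_end_minimal[OF assms(1), of e d] block z \<open>y < z\<close> by (simp add: d_def e_def R_def)
  have "s \<le> d"
    using pos_ge(2)[OF assms(2), of z] pos_ge(1)[OF assms(2), of s] assms(4) z(1) by (simp add: d_def)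
  moreover have "d \<noteq> s" using assms(4) \<open>y < z\<close> by (auto simp: d_def)
  ultimately show ?thesis
    using that[of d e] \<open>d < e\<close> \<open>y < z\<close> by (simp add: invs_def d_def e_def)
qed

lemma initial_row:
  assumes "reduced \<alpha>" "set \<alpha> \<subseteq> {s..<N}"
    and "\<forall>y\<in>set (first_row \<alpha>). \<not> pos \<alpha> s < y"
  shows "set (first_row \<alpha>) = {s..<pos \<alpha> s}" "length (first_row \<alpha>) = pos \<alpha> s - s"
proof -
  show "set (first_row \<alpha>) = {s..<pos \<alpha> s}"
    using first_block[OF assms(1,2)] row_letters(1)[OF assms(1,2)] assms(3)
    by (fastforce simp: nat_less_le not_less)
  then show "length (first_row \<alpha>) = pos \<alpha> s - s"
    by (metis card_atLeastLessThan distinct_card distinct_first_row)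
qed

text \<open>
  Under the full condition the row has no letters behind the first block: a later block ended by \<open>d\<close>
  has an inversion \<open>de\<close>, which forces \<open>d\<close> to stand before \<open>s\<close>.
\<close>

lemma lex_closed_initial_row:
  assumes "reduced \<alpha>" "set \<alpha> \<subseteq> {s..<N}" "lex_closed s (Suc s) (pos \<alpha>)"
  shows "set (first_row \<alpha>) = {s..<pos \<alpha> s}" "length (first_row \<alpha>) = pos \<alpha> s - s"
proof -
  have "\<forall>y\<in>set (first_row \<alpha>). \<not> pos \<alpha> s < y"
  proof (intro ballI notI)
    fix y assume y: "y \<in> set (first_row \<alpha>)"
    assume "pos \<alpha> s < y"
    from late_block[OF assms(1,2) y this] obtain d e where
      de: "s < d" "d < e" "(d, e) \<in> invs (pos \<alpha>)" "y < pos \<alpha> d" .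
    then have "(s, d) \<in> invs (pos \<alpha>)" using lex_closedD[OF assms(3), of s d e] by auto
    then show False using de \<open>pos \<alpha> s < y\<close> by (auto simp: invs_def)
  qed
  from initial_row[OF assms(1,2) this]
  show "set (first_row \<alpha>) = {s..<pos \<alpha> s}" "length (first_row \<alpha>) = pos \<alpha> s - s" .
qed

text \<open>
  Under the full condition the first two rows have as many letters as there are values before \<open>s\<close> in
  \<open>\<alpha>\<close> and before \<open>s + 1\<close> in \<open>bumped \<alpha>\<close>. If the latter number is positive, then \<open>s + 1\<close> itself stands
  before \<open>s\<close> in \<open>\<alpha>\<close>, and this makes the first row longer.
\<close>

lemma second_row_shorter:
  assumes "reduced \<alpha>" "set \<alpha> \<subseteq> {s..<N}" "lex_closed s (Suc s) (pos \<alpha>)"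
  shows "first_row (bumped \<alpha>) = [] \<or> length (first_row (bumped \<alpha>)) < length (first_row \<alpha>)"
proof -
  note reduced' = reduced_bumped[OF assms(1)] and letters' = row_letters(2)[OF assms(1,2)]
  have closed': "lex_closed (Suc s) (Suc s) (pos (bumped \<alpha>))"
    by (rule lex_closed_bumped[OF assms])
  then have "lex_closed (Suc s) (Suc (Suc s)) (pos (bumped \<alpha>))"
    by (rule lex_closed_weaken) simp
  from lex_closed_initial_row[OF reduced' letters' this]
  have len': "length (first_row (bumped \<alpha>)) = pos (bumped \<alpha>) (Suc s) - Suc s" by simp
  note row = lex_closed_initial_row[OF assms]
  show ?thesis
  proof (cases "pos (bumped \<alpha>) (Suc s) \<le> Suc s")
    case True
    then show ?thesis using len' by simp
  next
    case False
    define c where "c = word_perm (bumped \<alpha>) (Suc s)"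
    have "Suc s \<le> c" using pos_ge(2)[OF letters'] by (simp add: c_def)
    moreover have "c \<noteq> Suc s" using False by (metis c_def order_refl pos_word_perm)
    ultimately have "(Suc s, c) \<in> invs (pos (bumped \<alpha>))"
      using False by (simp add: invs_def c_def)
    then have "(Suc s, c) \<in> invs (pos \<alpha>)" using invs_bumped[OF assms(1)] by blast
    then have "(s, Suc s) \<in> invs (pos \<alpha>)"
      using lex_closedD[OF assms(3), of s "Suc s" c] by (auto simp: invs_def)
    then have less: "pos \<alpha> (Suc s) < pos \<alpha> s" by (simp add: invs_def)
    then have "pos \<alpha> (Suc s) \<in> set (first_row \<alpha>)"
      using row(1) pos_ge(1)[OF assms(2), of "Suc s"] by simp
    then have "pos (bumped \<alpha>) (Suc s) = Suc (pos \<alpha> (Suc s))"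
      using pos_bumped[OF assms(1)] row_perm_mem[OF first_row_sorted] by simp
    then show ?thesis using len' row(2) less False by linarith
  qed
qed

text \<open>
  Triples with middle value at least \<open>s + 2\<close> are covered by \<open>lex_word_of_bumped\<close>. In a violation by
  \<open>s, s + 1, c\<close>, consider the moment when \<open>s\<close> and \<open>s + 1\<close> are adjacent and about to be exchanged: then
  both rows have as many letters as there are values before \<open>s\<close>, and \<open>c\<close> is one of these.
\<close>

lemma lex_word_of_shorter_second_row:
  assumes "longest_word s N \<alpha>" "lex_word (Suc s) (Suc s) (bumped \<alpha>)"
    and shorter: "\<And>k. first_row (bumped (take k \<alpha>)) = [] \<or>
      length (first_row (bumped (take k \<alpha>))) < length (first_row (take k \<alpha>))"
  shows "lex_word s s \<alpha>"
proof -
  have reduced: "reduced \<alpha>" and letters: "set \<alpha> \<subseteq> {s..<N}"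
    using assms(1) by (auto simp: longest_word_def)
  have "lex_word (Suc s) (Suc (Suc s)) (bumped \<alpha>)"
    by (rule lex_word_weaken[OF assms(2)]) simp
  then have high: "lex_word s (Suc (Suc s)) \<alpha>"
    using lex_word_of_bumped[OF assms(1)] by simp
  show ?thesis
    unfolding lex_word_def lex_closed_def
  proof (intro allI impI, elim conjE)
    fix k a b c
    assume abc: "s \<le> a" "a < b" "b < c" "s \<le> b" "(b, c) \<in> invs (pos (take k \<alpha>))"
    show "(a, b) \<in> invs (pos (take k \<alpha>))"
    proof (cases "Suc (Suc s) \<le> b")
      case True
      then show ?thesis using high abc by (auto simp: lex_word_def intro: lex_closedD)
    next
      case False
      then have ab: "a = s" "b = Suc s" using abc by auto
      show ?thesis
      proof (rule ccontr)
        assume no: "(a, b) \<notin> invs (pos (take k \<alpha>))"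
        have "c \<le> N"
          using invs_bounded(2)[OF set_take_letters[OF letters] abc(5)] .
        then have "(a, b) \<in> invs (pos \<alpha>)"
          using assms(1) abc by (auto simp: longest_word_def)
        then obtain l where l: "pos (take l \<alpha>) b = Suc (pos (take l \<alpha>) a)" "pos (take l \<alpha>) c < pos (take l \<alpha>) a"
          using crossing_time[OF reduced _ abc(3) abc(5) no] by blast
        define \<beta> where "\<beta> = take l \<alpha>"
        have redb: "reduced \<beta>" and lb: "set \<beta> \<subseteq> {s..<N}"
          using reduced_take[OF reduced] set_take_letters[OF letters] by (auto simp: \<beta>_def)
        have p: "pos \<beta> (Suc s) = Suc (pos \<beta> s)" "pos \<beta> c < pos \<beta> s"
          using l ab by (simp_all add: \<beta>_def)
        have "\<forall>y\<in>set (first_row \<beta>). \<not> pos \<beta> s < y"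
        proof (intro ballI notI)
          fix y assume y: "y \<in> set (first_row \<beta>)"
          assume "pos \<beta> s < y"
          from late_block[OF redb lb y this] obtain d e where
            de: "s < d" "d < e" "(d, e) \<in> invs (pos \<beta>)" "y < pos \<beta> d" .
          have "d \<noteq> Suc s" using de(4) p(1) \<open>pos \<beta> s < y\<close> by auto
          then have "(Suc s, d) \<in> invs (pos \<beta>)"
            using high de by (auto simp: lex_word_def \<beta>_def intro: lex_closedD)
          then show False using de(4) p(1) \<open>pos \<beta> s < y\<close> by (auto simp: invs_def)
        qed
        note row = initial_row[OF redb lb this]
        have closed': "lex_closed (Suc s) (Suc (Suc s)) (pos (bumped \<beta>))"
          by (rule lex_closed_weaken[of _ "Suc s"])
            (use assms(2) in \<open>simp_all add: lex_word_bumped_prefix \<beta>_def\<close>)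
        \<comment> \<open>The second block is the single position of \<open>s + 1\<close>, so the peeling does not move that value.\<close>
        have "word_perm (first_row \<beta>) (Suc (pos \<beta> s)) = Suc (pos \<beta> s)"
          by (rule row_perm_nonmem) (use row(1) in auto)
        then have "length (first_row (bumped \<beta>)) = length (first_row \<beta>)"
          using lex_closed_initial_row(2)[OF reduced_bumped[OF redb] row_letters(2)[OF redb lb] closed']
            row(2) pos_bumped[OF redb] p(1) by simp
        moreover have "s \<le> pos \<beta> c" using pos_ge(1)[OF lb] abc by simp
        ultimately show False using shorter[of l] row(2) p(2) by (auto simp: \<beta>_def)
      qed
    qed
  qed
qed

text \<open>Rows are counted from 0 here.\<close>

definition row_length :: "nat \<Rightarrow> nat list \<Rightarrow> nat" where
  "row_length i \<alpha> = length (first_row ((bumped ^^ i) \<alpha>))"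

lemma row_length_0: "row_length 0 \<alpha> = length (first_row \<alpha>)"
  and row_length_Suc: "row_length (Suc i) \<alpha> = row_length i (bumped \<alpha>)"
  by (simp_all add: row_length_def funpow_swap1)

definition row_strict :: "nat \<Rightarrow> nat list \<Rightarrow> bool" where
  "row_strict i \<alpha> \<longleftrightarrow>
     (\<forall>k. row_length (Suc i) (take k \<alpha>) = 0 \<or> row_length (Suc i) (take k \<alpha>) < row_length i (take k \<alpha>))"

lemma row_strict_Suc: "row_strict (Suc i) \<alpha> \<longleftrightarrow> row_strict i (bumped \<alpha>)"
  unfolding row_strict_def row_length_Suc[of i] row_length_Suc[of "Suc i"]
  by (metis bumped_take take_bumped)

lemma row_length_Nil [simp]: "row_length i [] = 0"
  by (induction i) (simp_all add: row_length_0 row_length_Suc)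

lemma lex_word_diag: "m \<le> Suc s \<Longrightarrow> lex_word s m \<alpha> \<longleftrightarrow> lex_word s s \<alpha>"
  using lex_word_weaken[of s m \<alpha> s] lex_word_weaken[of s s \<alpha> m] by auto

lemma lex_word_peel:
  assumes "longest_word s N \<alpha>"
  shows "lex_word s s \<alpha> \<longleftrightarrow> row_strict 0 \<alpha> \<and> lex_word (Suc s) (Suc s) (bumped \<alpha>)"
proof
  assume lex: "lex_word s s \<alpha>"
  have "lex_word s (Suc s) \<alpha>" by (rule lex_word_weaken[OF lex]) simp
  then have closed: "lex_closed s (Suc s) (pos (take k \<alpha>))" for k
    by (simp add: lex_word_def)
  have "reduced (take k \<alpha>)" "set (take k \<alpha>) \<subseteq> {s..<N}" for k
    using assms by (simp_all add: longest_word_def reduced_take set_take_letters)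
  note * = second_row_shorter[OF this closed] lex_closed_bumped[OF this closed]
  then show "row_strict 0 \<alpha> \<and> lex_word (Suc s) (Suc s) (bumped \<alpha>)"
    by (simp add: row_strict_def row_length_0 row_length_Suc lex_word_bumped_prefix)
next
  assume "row_strict 0 \<alpha> \<and> lex_word (Suc s) (Suc s) (bumped \<alpha>)"
  then show "lex_word s s \<alpha>"
    by (intro lex_word_of_shorter_second_row[OF assms])
      (auto simp: row_strict_def row_length_0 row_length_Suc)
qed

lemma all_nat_split: "(\<forall>i. P i) \<longleftrightarrow> P 0 \<and> (\<forall>i. P (Suc i))"
  by (metis not0_implies_Suc)

text \<open>
  As long as \<open>s + 2 \<le> m\<close>, a row is peeled off without any condition on it; from then on every
  peeling contributes one strictness condition.
\<close>

lemma lex_word_iff_row_strict: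
  "longest_word s N \<alpha> \<Longrightarrow> lex_word s m \<alpha> \<longleftrightarrow> (\<forall>i. m \<le> Suc (s + i) \<longrightarrow> row_strict i \<alpha>)"
proof (induction "N - s" arbitrary: s m \<alpha>)
  case 0
  then have "\<alpha> = []" by (auto simp: longest_word_def)
  then show ?case by (simp add: lex_word_def lex_closed_def row_strict_def)
next
  case (Suc d)
  have IH: "lex_word (Suc s) m' (bumped \<alpha>) \<longleftrightarrow> (\<forall>i. m' \<le> Suc (Suc s + i) \<longrightarrow> row_strict (Suc i) \<alpha>)" for m'
  proof -
    have "d = N - Suc s" using Suc.hyps(2) by simp
    from Suc.hyps(1)[OF this longest_word_bumped(1)[OF Suc.prems], of m']
    show ?thesis by (simp only: row_strict_Suc)
  qed
  show ?case
  proof (cases "m \<le> Suc s")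
    case True
    then have "lex_word s m \<alpha> \<longleftrightarrow> row_strict 0 \<alpha> \<and> (\<forall>i. row_strict (Suc i) \<alpha>)"
      unfolding lex_word_diag[OF True] lex_word_peel[OF Suc.prems] IH[of "Suc s"] by simp
    then show ?thesis
      using True all_nat_split[of "\<lambda>i. m \<le> Suc (s + i) \<longrightarrow> row_strict i \<alpha>"] by simp
  next
    case False
    then have "lex_word s m \<alpha> \<longleftrightarrow> (\<forall>i. m \<le> Suc (Suc s + i) \<longrightarrow> row_strict (Suc i) \<alpha>)"
      using lex_word_bumped_iff[OF Suc.prems] IH[of m] by simp
    then show ?thesis using False all_nat_split[of "\<lambda>i. m \<le> Suc (s + i) \<longrightarrow> row_strict i \<alpha>"] by simp
  qed
qed

section \<open>The recording tableau\<close>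

lemma first_row_nonempty: "\<alpha> \<noteq> [] \<Longrightarrow> first_row \<alpha> \<noteq> []"
proof (induction \<alpha> rule: rev_induct)
  case (snoc x \<alpha>)
  show ?case
    by (rule insertion_cases[of \<alpha> x]) simp_all
qed simp

lemma length_bumped_less: "\<alpha> \<noteq> [] \<Longrightarrow> length (bumped \<alpha>) < length \<alpha>"
  using length_bumped[of \<alpha>] first_row_nonempty[of \<alpha>] by (cases "first_row \<alpha>") auto

function insertion_rows :: "nat list \<Rightarrow> nat list list" where
  "insertion_rows \<alpha> = (if \<alpha> = [] then [] else first_row \<alpha> # insertion_rows (bumped \<alpha>))"
  by auto
termination
  by (relation "measure length") (auto simp: length_bumped_less)

declare insertion_rows.simps [simp del]

text \<open>
  The insertion tableau is built row by row from \<open>first_row\<close> and \<open>bumped\<close>, and the new cell is at the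
  end of the one row that gets longer.
\<close>

lemma eg_insert_insertion_rows:
  "\<exists>i. eg_insert x (insertion_rows \<alpha>) = (insertion_rows (\<alpha> @ [x]), i) \<and>
     (\<forall>j. row_length j (\<alpha> @ [x]) = row_length j \<alpha> + (if j = i then 1 else 0)) \<and>
     (\<forall>j<i. 0 < row_length j \<alpha>)"
proof (induction "length \<alpha>" arbitrary: \<alpha> x rule: less_induct)
  case less
  show ?case
  proof (cases "\<alpha> = []")
    case True
    have "first_row [x] = [x]" "bumped [x] = []"
      using row_snoc[of "[]" x] by (simp_all add: eg_row_def)
    moreover have "row_length j [x] = (if j = 0 then 1 else 0)" for j
      using calculation by (cases j) (simp_all add: row_length_0 row_length_Suc)
    ultimately show ?thesis
      using True by (intro exI[of _ 0]) (simp add: insertion_rows.simps)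
  next
    case False
    obtain r u where eg: "eg_row x (first_row \<alpha>) = (r, u)" by fastforce
    have rows: "insertion_rows \<alpha> = first_row \<alpha> # insertion_rows (bumped \<alpha>)"
      "insertion_rows (\<alpha> @ [x]) = r # insertion_rows (bumped (\<alpha> @ [x]))"
      using False eg by (simp_all add: insertion_rows.simps[of \<alpha>] insertion_rows.simps[of "\<alpha> @ [x]"] row_snoc)
    have len: "row_length 0 (\<alpha> @ [x]) = length r" "row_length 0 \<alpha> = length (first_row \<alpha>)"
      using eg by (simp_all add: row_length_0 row_snoc)
    have pos: "0 < row_length 0 \<alpha>"
      using first_row_nonempty[OF False] len by simp
    show ?thesis
    proof (cases u)
      case None
      then have b: "bumped (\<alpha> @ [x]) = bumped \<alpha>" using eg by (simp add: row_snoc)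
      then have "length r = Suc (length (first_row \<alpha>))"
        using length_bumped[of \<alpha>] length_bumped[of "\<alpha> @ [x]"] len by (simp add: row_length_0)
      moreover have "row_length (Suc j) (\<alpha> @ [x]) = row_length (Suc j) \<alpha>" for j
        by (simp add: row_length_Suc b)
      ultimately have "row_length j (\<alpha> @ [x]) = row_length j \<alpha> + (if j = 0 then 1 else 0)" for j
        using len by (cases j) simp_all
      then show ?thesis
        using rows eg None b by (intro exI[of _ 0]) simp
    next
      case (Some y)
      then have b: "bumped (\<alpha> @ [x]) = bumped \<alpha> @ [y]" using eg by (simp add: row_snoc)
      then have "length r = length (first_row \<alpha>)"
        using length_bumped[of \<alpha>] length_bumped[of "\<alpha> @ [x]"] len by (simp add: row_length_0)
      moreover obtain i where i: "eg_insert y (insertion_rows (bumped \<alpha>)) = (insertion_rows (bumped \<alpha> @ [y]), i)"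
        "\<forall>j. row_length j (bumped \<alpha> @ [y]) = row_length j (bumped \<alpha>) + (if j = i then 1 else 0)"
        "\<forall>j<i. 0 < row_length j (bumped \<alpha>)"
        using less[OF length_bumped_less[OF False], of y] by blast
      moreover have "row_length (Suc j) (\<alpha> @ [x]) = row_length (Suc j) \<alpha> + (if j = i then 1 else 0)" for j
        using i(2) by (simp add: row_length_Suc b)
      ultimately have "row_length j (\<alpha> @ [x]) = row_length j \<alpha> + (if j = Suc i then 1 else 0)" for j
        using len by (cases j) simp_all
      moreover have "0 < row_length j \<alpha>" if "j < Suc i" for j
        using that i(3) pos by (cases j) (simp_all add: row_length_Suc)
      ultimately show ?thesis
        using rows eg Some b i(1) by (intro exI[of _ "Suc i"]) simp
    qed
  qed
qed

lemma row_length_snoc: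
  "\<exists>i. \<forall>j. row_length j (\<alpha> @ [x]) = row_length j \<alpha> + (if j = i then 1 else 0)"
  using eg_insert_insertion_rows[of x \<alpha>] by blast

lemma row_length_mono_append: "row_length i \<alpha> \<le> row_length i (\<alpha> @ \<beta>)"
proof (induction \<beta> rule: rev_induct)
  case (snoc x \<beta>)
  obtain i0 where "\<forall>j. row_length j ((\<alpha> @ \<beta>) @ [x]) = row_length j (\<alpha> @ \<beta>) + (if j = i0 then 1 else 0)"
    using row_length_snoc by blast
  then show ?case using snoc by simp
qed simp

lemma row_length_take_le: "row_length i (take k \<alpha>) \<le> row_length i \<alpha>"
  using row_length_mono_append[of i "take k \<alpha>" "drop k \<alpha>"] by simp

lemma EG_snoc: "EG (\<alpha> @ [x]) = eg_step (Suc (length \<alpha>), x) (EG \<alpha>)"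
  by (simp add: EG_def enumerate_append_eq)

lemma EG_P: "fst (EG \<alpha>) = insertion_rows \<alpha>"
proof (induction \<alpha> rule: rev_induct)
  case Nil
  then show ?case by (simp add: EG_def insertion_rows.simps)
next
  case (snoc x \<alpha>)
  then show ?case
    using eg_insert_insertion_rows[of x \<alpha>]
    by (auto simp: EG_snoc eg_step_def split: prod.splits)
qed

text \<open>
  An entry of the recording tableau is the time at which its cell appears. Stated with \<open>\<le> k\<close> for all
  \<open>k\<close>, this determines the entry and is directly comparable with row lengths of prefixes.
\<close>

lemma EG_Q_spec:
  "(\<forall>i. i < length (EG_Q \<alpha>) \<longleftrightarrow> 0 < row_length i \<alpha>) \<and>
   (\<forall>i<length (EG_Q \<alpha>). length (EG_Q \<alpha> ! i) = row_length i \<alpha> \<and>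
     (\<forall>j<row_length i \<alpha>. \<forall>k. EG_Q \<alpha> ! i ! j \<le> k \<longleftrightarrow> j < row_length i (take k \<alpha>)))"
proof (induction \<alpha> rule: rev_induct)
  case Nil
  then show ?case by (simp add: EG_Q_def EG_def)
next
  case (snoc x \<alpha>)
  define Q where "Q = EG_Q \<alpha>"
  define Q' where "Q' = EG_Q (\<alpha> @ [x])"
  obtain i0 where i0: "eg_insert x (insertion_rows \<alpha>) = (insertion_rows (\<alpha> @ [x]), i0)"
    "\<And>j. row_length j (\<alpha> @ [x]) = row_length j \<alpha> + (if j = i0 then 1 else 0)"
    "\<forall>j<i0. 0 < row_length j \<alpha>"
    using eg_insert_insertion_rows[of x \<alpha>] by blast
  have lenQ: "i < length Q \<longleftrightarrow> 0 < row_length i \<alpha>" for i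
    using snoc by (simp add: Q_def)
  have rowQ: "length (Q ! i) = row_length i \<alpha>" if "i < length Q" for i
    using snoc that by (simp add: Q_def)
  have entQ: "Q ! i ! j \<le> k \<longleftrightarrow> j < row_length i (take k \<alpha>)" if "j < row_length i \<alpha>" for i j k
    using snoc that lenQ[of i] by (auto simp: Q_def)
  have Q': "Q' = add_cell i0 (Suc (length \<alpha>)) Q"
    using i0(1) EG_P[of \<alpha>] by (cases "EG \<alpha>") (simp add: Q'_def Q_def EG_Q_def EG_snoc eg_step_def)
  have i0_le: "i0 \<le> length Q"
    using i0(3) lenQ by (metis less_irrefl not_le_imp_less)
  have row_i0: "row_length i0 \<alpha> = 0" if "i0 = length Q"
    using lenQ[of i0] that by simp
  have len': "i < length Q' \<longleftrightarrow> 0 < row_length i (\<alpha> @ [x])" for i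
    using i0_le lenQ[of i] by (auto simp: Q' add_cell_def i0(2))
  have row': "Q' ! i = (if i = i0 then (if i0 < length Q then Q ! i0 else []) @ [Suc (length \<alpha>)] else Q ! i)"
    if "i < length Q'" for i
    using that i0_le by (auto simp: Q' add_cell_def nth_append split: if_splits)
  have rlen': "length (Q' ! i) = row_length i (\<alpha> @ [x])" if "i < length Q'" for i
    using row'[OF that] that rowQ[of i] row_i0 i0_le
    by (auto simp: i0(2) Q' add_cell_def split: if_splits)
  have ent': "Q' ! i ! j \<le> k \<longleftrightarrow> j < row_length i (take k (\<alpha> @ [x]))"
    if ij: "i < length Q'" "j < row_length i (\<alpha> @ [x])" for i j k
  proof (cases "j < row_length i \<alpha>")
    case True
    then have iQ: "i < length Q" using lenQ[of i] by simp
    then have eq: "Q' ! i ! j = Q ! i ! j"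
      using row'[OF ij(1)] rowQ[OF iQ] True by (auto simp: nth_append)
    show ?thesis
    proof (cases "k \<le> length \<alpha>")
      case True
      then show ?thesis using eq entQ[OF \<open>j < row_length i \<alpha>\<close>] by simp
    next
      case False
      moreover have "Q ! i ! j \<le> length \<alpha>" using entQ[OF True, of "length \<alpha>"] True by simp
      ultimately show ?thesis using eq ij by simp
    qed
  next
    case False
    then have i: "i = i0" and j: "j = row_length i0 \<alpha>"
      using ij(2) i0(2)[of i] by (auto split: if_splits)
    have "Q' ! i ! j = Suc (length \<alpha>)"
      using row'[OF ij(1)] i j rowQ[of i0] row_i0 i0_le by (auto simp: nth_append)
    moreover have "\<not> j < row_length i (take k (\<alpha> @ [x]))" if "k \<le> length \<alpha>"
      using row_length_take_le[of i0 k \<alpha>] that i j by simp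
    moreover have "j < row_length i (take k (\<alpha> @ [x]))" if "\<not> k \<le> length \<alpha>"
      using ij that by simp
    ultimately show ?thesis by (cases "k \<le> length \<alpha>") auto
  qed
  show ?case
    using len' rlen' ent' by (simp add: Q'_def)
qed

abbreviation below :: "nat set \<Rightarrow> nat \<Rightarrow> nat" where
  "below R y \<equiv> card (R \<inter> {..<y})"

lemma below_insert: "finite R \<Longrightarrow> x \<notin> R \<Longrightarrow> below (insert x R) y = below R y + (if x < y then 1 else 0)"
  by auto

lemma below_remove: "finite R \<Longrightarrow> z \<in> R \<Longrightarrow> below R y = below (R - {z}) y + (if z < y then 1 else 0)"
  using below_insert[of "R - {z}" z y] by (simp add: insert_absorb)

lemma below_mono: "finite R \<Longrightarrow> y \<le> y' \<Longrightarrow> below R y \<le> below R y'"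
  by (rule card_mono) auto

lemma below_strict: "finite R \<Longrightarrow> x \<in> R \<Longrightarrow> x < y \<Longrightarrow> below R x < below R y"
  by (rule psubset_card_mono) auto

text \<open>
  Inserting \<open>x\<close> adds \<open>x\<close> and possibly removes the next larger entry, so the count of entries up to
  \<open>y\<close> grows only if no old entry lies between \<open>x\<close> and \<open>y\<close>.
\<close>

lemma below_first_row_snoc:
  "below (set (first_row (\<alpha> @ [x]))) (Suc y) \<le> below (set (first_row \<alpha>)) (Suc y) \<or>
   (x \<le> y \<and> below (set (first_row (\<alpha> @ [x]))) (Suc y) \<le> Suc (below (set (first_row \<alpha>)) x))"
proof (cases rule: insertion_cases[of \<alpha> x, case_names append special bump])
  case append
  then have "x \<notin> set (first_row \<alpha>)" by auto
  moreover have "x \<le> y \<Longrightarrow> set (first_row \<alpha>) \<inter> {..<Suc y} = set (first_row \<alpha>) \<inter> {..<x}"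
    using append(1) by auto
  ultimately show ?thesis
    using append by (simp add: below_insert del: Int_insert_left)
next
  case (bump A z B)
  define R where "R = set (first_row \<alpha>)"
  have R: "finite R" "x \<notin> R" "z \<in> R" "set (first_row (\<alpha> @ [x])) = insert x (R - {z})"
    using bump by (auto simp: R_def)
  have "below (insert x (R - {z})) (Suc y) = below (R - {z}) (Suc y) + (if x < Suc y then 1 else 0)"
    using R by (intro below_insert) auto
  moreover have "R \<inter> {..<Suc y} = R \<inter> {..<x}" if "x \<le> y" "y < z"
    using bump that by (auto simp: R_def)
  ultimately show ?thesis
    using R below_remove[OF R(1,3), of "Suc y"] bump(2)
    by (cases "x \<le> y"; cases "y < z") (auto simp: R_def[symmetric])
qed simp

text \<open>
  This says that the \<open>j\<close>-th entry of the second row exceeds the \<open>j\<close>-th entry of the first, without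
  referring to indices. A letter \<open>z\<close> passed on to the second row meets a first row that already has
  more entries below \<open>z\<close> than the second row, so there is room for it.
\<close>

lemma columns_increase:
  "below (set (first_row (bumped \<alpha>))) (Suc y) \<le> below (set (first_row \<alpha>)) y"
proof (induction \<alpha> arbitrary: y rule: rev_induct)
  case (snoc x \<alpha>)
  define R where "R = set (first_row \<alpha>)"
  define S where "S = set (first_row (bumped \<alpha>))"
  define R' where "R' = set (first_row (\<alpha> @ [x]))"
  define S' where "S' = set (first_row (bumped (\<alpha> @ [x])))"
  have IH: "below S (Suc y) \<le> below R y" for y
    using snoc by (simp add: R_def S_def)
  have fin: "finite R" "finite R'" by (simp_all add: R_def R'_def)
  \<comment> \<open>Suffices in both cases in which a letter \<open>z\<close> is passed on.\<close>
  have combine: "below S' (Suc y) \<le> below R' y"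
    if b: "bumped (\<alpha> @ [x]) = bumped \<alpha> @ [z]" and le: "\<And>y. below R y \<le> below R' y"
      and key: "\<And>y. z \<le> y \<Longrightarrow> Suc (below S z) \<le> below R' y" for z
    using below_first_row_snoc[of "bumped \<alpha>" z y] IH[of y] le[of y] key[of y]
    unfolding S_def[symmetric] b[symmetric] S'_def[symmetric] by linarith
  have "below S' (Suc y) \<le> below R' y"
  proof (cases rule: insertion_cases[of \<alpha> x, case_names append special bump])
    case append
    have "x \<notin> R" using append(1) by (auto simp: R_def)
    then have "below R y \<le> below R' y"
      using append(2) below_insert[OF fin(1), of x y] by (simp add: R_def R'_def del: Int_insert_left)
    then show ?thesis
      using IH[of y] append(3) by (simp add: S_def S'_def)
  next
    case (special A B)
    then have "R' = R" "x \<in> R" by (simp_all add: R_def R'_def)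
    show ?thesis
    proof (rule combine[OF special(3)])
      fix y assume "Suc x \<le> y"
      then show "Suc (below S (Suc x)) \<le> below R' y"
        using IH[of x] below_strict[OF fin(1) \<open>x \<in> R\<close>, of y] \<open>R' = R\<close> by simp
    qed (simp add: \<open>R' = R\<close>)
  next
    case (bump A z B)
    have R: "x \<notin> R" "z \<in> R" "R' = insert x (R - {z})"
      using bump by (auto simp: R_def R'_def)
    have "below R' y = below (R - {z}) y + (if x < y then 1 else 0)" for y
      unfolding R(3) using R fin by (intro below_insert) auto
    then have count: "below R y + (if x < y then 1 else 0) = below R' y + (if z < y then 1 else 0)" for y
      using below_remove[OF fin(1) R(2), of y] by simp
    show ?thesis
    proof (rule combine[OF bump(6)])
      show "below R y \<le> below R' y" for y
        using count[of y] bump(2) by (auto split: if_splits)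
    next
      fix y assume "z \<le> y"
      have "below S z \<le> below R (z - 1)" using IH[of "z - 1"] bump(2) by simp
      also have "\<dots> \<le> below R z" by (rule below_mono) (use fin in auto)
      finally have "Suc (below S z) \<le> below R' z" using count[of z] bump(2) by simp
      also have "\<dots> \<le> below R' y" by (rule below_mono) (use fin \<open>z \<le> y\<close> in auto)
      finally show "Suc (below S z) \<le> below R' y" .
    qed
  qed
  then show ?case by (simp add: S'_def R'_def)
qed simp

text \<open>The column condition above, evaluated beyond all entries.\<close>

lemma row_length_Suc_le: "row_length (Suc i) \<alpha> \<le> row_length i \<alpha>"
proof (induction i arbitrary: \<alpha>)
  case 0
  define y where "y = Suc (Max (insert 0 (set (first_row \<alpha>) \<union> set (first_row (bumped \<alpha>)))))"
  have "z < y" if "z \<in> set (first_row \<alpha>) \<union> set (first_row (bumped \<alpha>))" for z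
    using that by (auto simp: y_def less_Suc_eq_le)
  then have "set (first_row (bumped \<alpha>)) \<inter> {..<Suc y} = set (first_row (bumped \<alpha>))"
    "set (first_row \<alpha>) \<inter> {..<y} = set (first_row \<alpha>)"
    by fastforce+
  then show ?case
    using columns_increase[of \<alpha> y] by (simp add: row_length_0 row_length_Suc distinct_card)
next
  case (Suc i)
  then show ?case using row_length_Suc by metis
qed

lemma longest_word_row_length: "longest_word s N \<alpha> \<Longrightarrow> row_length i \<alpha> = N - s - i"
proof (induction i arbitrary: s \<alpha>)
  case (Suc i)
  show ?case
    using Suc.IH[OF longest_word_bumped(1)[OF Suc.prems]] by (simp add: row_length_Suc)
qed (simp add: row_length_0 longest_word_bumped(2))

lemma nth_staircase: "i < N - 1 \<Longrightarrow> staircase N ! i = N - 1 - i"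
  by (simp add: staircase_def rev_nth)

context
  fixes N :: nat and \<rho> :: "nat list"
  assumes longest: "longest_word 1 N \<rho>"
begin

lemma tab_cells_EG_Q: "(i, j) \<in> tab_cells (EG_Q \<rho>) \<longleftrightarrow> 1 \<le> i \<and> 1 \<le> j \<and> i + j \<le> N"
proof (cases "1 \<le> i \<and> i - 1 < length (EG_Q \<rho>)")
  case True
  then have "length (EG_Q \<rho> ! (i - 1)) = N - 1 - (i - 1)" "0 < N - 1 - (i - 1)"
    using EG_Q_spec[of \<rho>] longest_word_row_length[OF longest] by auto
  then show ?thesis using True by (auto simp: tab_cells_def)
next
  case False
  then have "1 \<le> i \<Longrightarrow> \<not> 0 < N - 1 - (i - 1)"
    using EG_Q_spec[of \<rho>] longest_word_row_length[OF longest] by auto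
  then show ?thesis using False by (auto simp: tab_cells_def)
qed

lemma tab_entry_EG_Q_le:
  assumes "(i, j) \<in> tab_cells (EG_Q \<rho>)"
  shows "tab_entry (EG_Q \<rho>) i j \<le> k \<longleftrightarrow> j \<le> row_length (i - 1) (take k \<rho>)"
proof -
  have ij: "1 \<le> i" "1 \<le> j" "i + j \<le> N" using assms tab_cells_EG_Q by auto
  then have "j - 1 < row_length (i - 1) \<rho>" using longest_word_row_length[OF longest] by simp
  then have "EG_Q \<rho> ! (i - 1) ! (j - 1) \<le> k \<longleftrightarrow> j - 1 < row_length (i - 1) (take k \<rho>)"
    using EG_Q_spec[of \<rho>] by auto
  then show ?thesis using ij by (auto simp: tab_entry_def)
qed

text \<open>Every step lengthens exactly one row, by one cell.\<close>

lemma inj_tab_entry_EG_Q: "inj_on (\<lambda>(i, j). tab_entry (EG_Q \<rho>) i j) (tab_cells (EG_Q \<rho>))"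
proof (rule inj_onI, clarify)
  fix i j i' j'
  assume cells: "(i, j) \<in> tab_cells (EG_Q \<rho>)" "(i', j') \<in> tab_cells (EG_Q \<rho>)"
    and eq: "tab_entry (EG_Q \<rho>) i j = tab_entry (EG_Q \<rho>) i' j'"
  define t where "t = tab_entry (EG_Q \<rho>) i j"
  have ge: "1 \<le> i" "1 \<le> j" "1 \<le> i'" "1 \<le> j'" using cells tab_cells_EG_Q by auto
  note le = tab_entry_EG_Q_le[OF cells(1)] tab_entry_EG_Q_le[OF cells(2)]
  have "t \<noteq> 0" using le(1)[of 0] ge by (auto simp: t_def)
  then obtain k where k: "t = Suc k" by (cases t) auto
  have at: "j \<le> row_length (i - 1) (take t \<rho>)" "\<not> j \<le> row_length (i - 1) (take k \<rho>)"
    "j' \<le> row_length (i' - 1) (take t \<rho>)" "\<not> j' \<le> row_length (i' - 1) (take k \<rho>)"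
    using le(1)[of t] le(1)[of k] le(2)[of t] le(2)[of k] eq k by (auto simp: t_def)
  then have "k < length \<rho>" using k by (intro not_le_imp_less notI) simp
  then have "take t \<rho> = take k \<rho> @ [\<rho> ! k]" by (simp add: k take_Suc_conv_app_nth)
  moreover obtain i0 where
    "\<And>i. row_length i (take k \<rho> @ [\<rho> ! k]) = row_length i (take k \<rho>) + (if i = i0 then 1 else 0)"
    using row_length_snoc by blast
  ultimately have step: "row_length i (take t \<rho>) = row_length i (take k \<rho>) + (if i = i0 then 1 else 0)" for i
    by simp
  have "i - 1 = i0" using at(1,2) step[of "i - 1"] by (auto split: if_splits)
  moreover have "i' - 1 = i0" using at(3,4) step[of "i' - 1"] by (auto split: if_splits)
  ultimately have "i = i'" using ge by linarith
  then show "i = i' \<and> j = j'"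
    using at step[of "i - 1"] \<open>i - 1 = i0\<close> by auto
qed

lemma map_length_EG_Q: "map length (EG_Q \<rho>) = staircase N"
proof (rule nth_equalityI)
  have "i < length (EG_Q \<rho>) \<longleftrightarrow> i < N - 1" for i
    using EG_Q_spec[of \<rho>] longest_word_row_length[OF longest, of i] by auto
  then have len: "length (EG_Q \<rho>) = N - 1" by (metis linorder_neqE_nat less_irrefl)
  then show "length (map length (EG_Q \<rho>)) = length (staircase N)" by (simp add: staircase_def)
  show "map length (EG_Q \<rho>) ! i = staircase N ! i" if "i < length (map length (EG_Q \<rho>))" for i
    using that len EG_Q_spec[of \<rho>] longest_word_row_length[OF longest, of i]
    by (simp add: nth_staircase)
qed

lemma bij_tab_entry_EG_Q:
  "bij_betw (\<lambda>(i, j). tab_entry (EG_Q \<rho>) i j) (tab_cells (EG_Q \<rho>)) {1..length \<rho>}"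
  unfolding bij_betw_def
proof (intro conjI inj_tab_entry_EG_Q equalityI subsetI)
  fix t
  assume "t \<in> (\<lambda>(i, j). tab_entry (EG_Q \<rho>) i j) ` tab_cells (EG_Q \<rho>)"
  then obtain i j where ij: "(i, j) \<in> tab_cells (EG_Q \<rho>)" "t = tab_entry (EG_Q \<rho>) i j" by auto
  have ge: "1 \<le> i" "1 \<le> j" "i + j \<le> N" using ij tab_cells_EG_Q by auto
  have "t \<noteq> 0" using tab_entry_EG_Q_le[OF ij(1), of 0] ge ij(2) by auto
  moreover have "j \<le> row_length (i - 1) (take (length \<rho>) \<rho>)"
    using longest_word_row_length[OF longest, of "i - 1"] ge by simp
  then have "t \<le> length \<rho>" using tab_entry_EG_Q_le[OF ij(1)] ij(2) by blast
  ultimately show "t \<in> {1..length \<rho>}" by simp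
next
  fix t
  assume t: "t \<in> {1..length \<rho>}"
  then obtain k where k: "t = Suc k" "k < length \<rho>" by (cases t) auto
  then have take: "take t \<rho> = take k \<rho> @ [\<rho> ! k]" by (simp add: take_Suc_conv_app_nth)
  obtain i0 where step:
    "\<And>i. row_length i (take k \<rho> @ [\<rho> ! k]) = row_length i (take k \<rho>) + (if i = i0 then 1 else 0)"
    using row_length_snoc by blast
  define j where "j = row_length i0 (take t \<rho>)"
  have j: "j = Suc (row_length i0 (take k \<rho>))" using step[of i0] take by (simp add: j_def)
  have "j \<le> N - 1 - i0"
    using row_length_take_le[of i0 t \<rho>] longest_word_row_length[OF longest, of i0] by (simp add: j_def)
  then have cell: "(Suc i0, j) \<in> tab_cells (EG_Q \<rho>)"
    using j unfolding tab_cells_EG_Q by linarith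
  have "tab_entry (EG_Q \<rho>) (Suc i0) j \<le> t"
    using tab_entry_EG_Q_le[OF cell, of t] by (simp add: j_def)
  moreover have "\<not> tab_entry (EG_Q \<rho>) (Suc i0) j \<le> k"
    using tab_entry_EG_Q_le[OF cell, of k] j by simp
  ultimately have "tab_entry (EG_Q \<rho>) (Suc i0) j = t" using k(1) by linarith
  then show "t \<in> (\<lambda>(i, j). tab_entry (EG_Q \<rho>) i j) ` tab_cells (EG_Q \<rho>)"
    using cell by force
qed

text \<open>
  To compare two entries it suffices to know that, at all times, the presence of one cell implies the
  presence of the other.
\<close>

lemma tab_entry_EG_Q_less:
  assumes "(i, j) \<in> tab_cells (EG_Q \<rho>)" "(i', j') \<in> tab_cells (EG_Q \<rho>)" "(i, j) \<noteq> (i', j')"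
    and "\<And>k. j' \<le> row_length (i' - 1) (take k \<rho>) \<Longrightarrow> j \<le> row_length (i - 1) (take k \<rho>)"
  shows "tab_entry (EG_Q \<rho>) i j < tab_entry (EG_Q \<rho>) i' j'"
proof -
  have "tab_entry (EG_Q \<rho>) i j \<le> tab_entry (EG_Q \<rho>) i' j'"
    using tab_entry_EG_Q_le[OF assms(1)] tab_entry_EG_Q_le[OF assms(2)] assms(4) by blast
  moreover have "tab_entry (EG_Q \<rho>) i j \<noteq> tab_entry (EG_Q \<rho>) i' j'"
    using inj_onD[OF inj_tab_entry_EG_Q _ assms(1,2)] assms(3) by auto
  ultimately show ?thesis by simp
qed

lemma card_tab_cells: "card (tab_cells T) = sum_list (map length T)"
proof -
  have "tab_cells T = (SIGMA i:{1..length T}. {1..length (T ! (i - 1))})"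
    by (auto simp: tab_cells_def)
  then have "card (tab_cells T) = (\<Sum>i\<in>{1..length T}. length (T ! (i - 1)))"
    by simp
  also have "\<dots> = (\<Sum>i<length T. length (T ! i))"
    by (rule sum.reindex_bij_witness[of _ Suc "\<lambda>i. i - 1"]) auto
  also have "\<dots> = sum_list (map length T)"
    by (simp add: sum_list_sum_nth atLeast0LessThan)
  finally show ?thesis .
qed

lemma standard_EG_Q: "standard_tableau (staircase N) (EG_Q \<rho>)"
  unfolding standard_tableau_def
proof (intro conjI allI impI)
  show "sorted_wrt (\<ge>) (staircase N)" by (simp add: staircase_def sorted_wrt_rev)
  show "0 \<notin> set (staircase N)" by (simp add: staircase_def)
  show "map length (EG_Q \<rho>) = staircase N" by (rule map_length_EG_Q)
  have "sum_list (staircase N) = length \<rho>"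
    using bij_betw_same_card[OF bij_tab_entry_EG_Q] card_tab_cells[of "EG_Q \<rho>"] map_length_EG_Q by simp
  then show "bij_betw (\<lambda>(i, j). tab_entry (EG_Q \<rho>) i j) (tab_cells (EG_Q \<rho>)) {1..sum_list (staircase N)}"
    using bij_tab_entry_EG_Q by simp
next
  fix i j
  assume "(i, j) \<in> tab_cells (EG_Q \<rho>) \<and> (i, j + 1) \<in> tab_cells (EG_Q \<rho>)"
  then show "tab_entry (EG_Q \<rho>) i j < tab_entry (EG_Q \<rho>) i (j + 1)"
    by (intro tab_entry_EG_Q_less) auto
next
  fix i j
  assume cells: "(i, j) \<in> tab_cells (EG_Q \<rho>) \<and> (i + 1, j) \<in> tab_cells (EG_Q \<rho>)"
  then have "1 \<le> i" using tab_cells_EG_Q by simp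
  then have "row_length i \<beta> \<le> row_length (i - 1) \<beta>" for \<beta>
    using row_length_Suc_le[of "i - 1" \<beta>] by simp
  then show "tab_entry (EG_Q \<rho>) i j < tab_entry (EG_Q \<rho>) (i + 1) j"
    using cells by (intro tab_entry_EG_Q_less) (auto intro: order_trans)
qed

text \<open>
  The inequality between the cells \<open>(i, j)\<close> and \<open>(i + 1, j - 1)\<close> says that row \<open>i + 1\<close> cannot reach
  length \<open>j - 1\<close> before row \<open>i\<close> has length \<open>j\<close>.
\<close>

lemma diagonal_iff_row_strict:
  "(\<forall>j. 2 \<le> j \<and> Suc i + j \<le> N \<longrightarrow>
       tab_entry (EG_Q \<rho>) (Suc i) j < tab_entry (EG_Q \<rho>) (Suc (Suc i)) (j - 1))
     \<longleftrightarrow> row_strict i \<rho>"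
proof
  assume diag: "\<forall>j. 2 \<le> j \<and> Suc i + j \<le> N \<longrightarrow>
       tab_entry (EG_Q \<rho>) (Suc i) j < tab_entry (EG_Q \<rho>) (Suc (Suc i)) (j - 1)"
  show "row_strict i \<rho>"
    unfolding row_strict_def
  proof (intro allI disjCI)
    fix k
    assume notless: "\<not> row_length (Suc i) (take k \<rho>) < row_length i (take k \<rho>)"
    define r where "r = row_length (Suc i) (take k \<rho>)"
    show "row_length (Suc i) (take k \<rho>) = 0"
    proof (rule ccontr)
      assume "row_length (Suc i) (take k \<rho>) \<noteq> 0"
      then have "1 \<le> r" by (simp add: r_def)
      have "r \<le> N - 1 - Suc i"
        using row_length_take_le[of "Suc i" k \<rho>] longest_word_row_length[OF longest, of "Suc i"]
        by (simp add: r_def)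
      then have "Suc i + Suc r \<le> N" using \<open>1 \<le> r\<close> by linarith
      then have cells: "(Suc i, Suc r) \<in> tab_cells (EG_Q \<rho>)" "(Suc (Suc i), r) \<in> tab_cells (EG_Q \<rho>)"
        using \<open>1 \<le> r\<close> by (auto simp: tab_cells_EG_Q)
      have "tab_entry (EG_Q \<rho>) (Suc i) (Suc r) < tab_entry (EG_Q \<rho>) (Suc (Suc i)) r"
        using diag[rule_format, of "Suc r"] \<open>1 \<le> r\<close> \<open>Suc i + Suc r \<le> N\<close> by simp
      moreover have "tab_entry (EG_Q \<rho>) (Suc (Suc i)) r \<le> k"
        using tab_entry_EG_Q_le[OF cells(2), of k] by (simp add: r_def)
      ultimately have "Suc r \<le> row_length i (take k \<rho>)"
        using tab_entry_EG_Q_le[OF cells(1), of k] by simp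
      then show False using notless by (simp add: r_def)
    qed
  qed
next
  assume strict: "row_strict i \<rho>"
  show "\<forall>j. 2 \<le> j \<and> Suc i + j \<le> N \<longrightarrow>
       tab_entry (EG_Q \<rho>) (Suc i) j < tab_entry (EG_Q \<rho>) (Suc (Suc i)) (j - 1)"
  proof (intro allI impI)
    fix j
    assume j: "2 \<le> j \<and> Suc i + j \<le> N"
    show "tab_entry (EG_Q \<rho>) (Suc i) j < tab_entry (EG_Q \<rho>) (Suc (Suc i)) (j - 1)"
    proof (rule tab_entry_EG_Q_less)
      fix k
      assume "j - 1 \<le> row_length (Suc (Suc i) - 1) (take k \<rho>)"
      then have "j - 1 \<le> row_length (Suc i) (take k \<rho>)" by simp
      moreover have "row_length (Suc i) (take k \<rho>) = 0 \<or>
          row_length (Suc i) (take k \<rho>) < row_length i (take k \<rho>)"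
        using strict by (simp add: row_strict_def)
      ultimately show "j \<le> row_length (Suc i - 1) (take k \<rho>)" using j by auto
    qed (use j in \<open>auto simp: tab_cells_EG_Q\<close>)
  qed
qed

lemma n_row_shiftable_iff_lex_word:
  assumes "N = m + n"
  shows "n_row_shiftable N n (EG_Q \<rho>) \<longleftrightarrow> lex_word 1 m \<rho>"
proof -
  \<comment> \<open>The conditions for row 0, which occur if \<open>m = 1\<close>, hold because entries are positive.\<close>
  have row0: "0 < tab_entry (EG_Q \<rho>) 1 j" if "1 \<le> j" "1 + j \<le> N" for j
    using tab_entry_EG_Q_le[of 1 j 0] that by (simp add: tab_cells_EG_Q)
  have "n_row_shiftable N n (EG_Q \<rho>) \<longleftrightarrow>
    (\<forall>i j. m \<le> i + 1 \<and> 2 \<le> j \<and> i + j \<le> N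
        \<longrightarrow> tab_entry (EG_Q \<rho>) i j < tab_entry (EG_Q \<rho>) (i + 1) (j - 1))" (is "_ \<longleftrightarrow> (\<forall>i. ?D i)")
    unfolding n_row_shiftable_def using standard_EG_Q assms by auto
  also have "\<dots> \<longleftrightarrow> ?D 0 \<and> (\<forall>i. ?D (Suc i))"
    by (rule all_nat_split)
  also have "\<dots> \<longleftrightarrow> (\<forall>i. ?D (Suc i))"
    using row0 by (auto simp: tab_entry_def[of _ 0])
  also have "\<dots> \<longleftrightarrow> (\<forall>i. m \<le> Suc (1 + i) \<longrightarrow> row_strict i \<rho>)"
    unfolding diagonal_iff_row_strict[symmetric] by auto
  also have "\<dots> \<longleftrightarrow> lex_word 1 m \<rho>"
    using lex_word_iff_row_strict[OF longest] by simp
  finally show ?thesis .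
qed

lemma shiftable_iff_lex_word: "shiftable (EG_Q \<rho>) \<longleftrightarrow> lex_word 1 1 \<rho>"
proof -
  have "shiftable (EG_Q \<rho>) \<longleftrightarrow>
    (\<forall>i j. 1 \<le> i \<and> 2 \<le> j \<and> i + j \<le> N
        \<longrightarrow> tab_entry (EG_Q \<rho>) i j < tab_entry (EG_Q \<rho>) (i + 1) (j - 1))" (is "_ \<longleftrightarrow> (\<forall>i. ?D i)")
    unfolding shiftable_def tab_cells_EG_Q using standard_EG_Q by auto
  also have "\<dots> \<longleftrightarrow> ?D 0 \<and> (\<forall>i. ?D (Suc i))"
    by (rule all_nat_split)
  also have "\<dots> \<longleftrightarrow> (\<forall>i. row_strict i \<rho>)"
    unfolding diagonal_iff_row_strict[symmetric] by simp
  also have "\<dots> \<longleftrightarrow> lex_word 1 1 \<rho>"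
    using lex_word_iff_row_strict[OF longest] by simp
  finally show ?thesis .
qed

end

section \<open>Reduced words\<close>

lemma increasing_permutes_id:
  assumes "w permutes {1..N}" "\<And>i. 1 \<le> i \<Longrightarrow> i < N \<Longrightarrow> w i < w (Suc i)"
  shows "w = id"
proof
  have in_range: "1 \<le> w i \<and> w i \<le> N" if "1 \<le> i" "i \<le> N" for i
    using permutes_in_image[OF assms(1), of i] that by auto
  \<comment> \<open>An increasing sequence in \<open>{1..N}\<close> is bounded below by the identity from the left end, and above from the right end.\<close>
  have ge: "Suc i \<le> N \<Longrightarrow> Suc i \<le> w (Suc i)" for i
  proof (induction i)
    case (Suc i)
    then show ?case using assms(2)[of "Suc i"] by simp
  qed (use in_range[of 1] in simp)
  have le: "d < N \<Longrightarrow> w (N - d) \<le> N - d" for d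
  proof (induction d)
    case (Suc d)
    have eq: "Suc (N - Suc d) = N - d" using Suc.prems by simp
    have "w (N - Suc d) < w (Suc (N - Suc d))"
      by (rule assms(2)) (use Suc.prems in linarith)+
    also have "\<dots> \<le> N - d" using Suc unfolding eq by simp
    finally show ?case by linarith
  qed (use in_range[of N] in simp)
  fix i
  show "w i = id i"
  proof (cases "i \<in> {1..N}")
    case True
    then show ?thesis using ge[of "i - 1"] le[of "N - i"] by (auto intro: antisym)
  next
    case False
    then show ?thesis using permutes_not_in[OF assms(1) False] by simp
  qed
qed

text \<open>If \<open>p\<close> and \<open>q\<close> order every pair of values alike, then \<open>p \<circ> inv q\<close> is increasing.\<close>

lemma invs_determine:
  assumes "p permutes {1..N}" "q permutes {1..N}" "invs p = invs q"
  shows "p = q"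
proof -
  have "p \<circ> inv q = id"
  proof (rule increasing_permutes_id)
    show "p \<circ> inv q permutes {1..N}"
      using assms by (intro permutes_compose permutes_inv)
    fix i
    assume "1 \<le> i" "i < N"
    define a where "a = inv q i"
    define b where "b = inv q (Suc i)"
    have q: "q a = i" "q b = Suc i"
      using permutes_inverses(1)[OF assms(2)] by (auto simp: a_def b_def)
    then have "a \<noteq> b" by auto
    then have "a < b \<or> b < a" by auto
    then have "\<not> p b < p a"
    proof
      assume "a < b"
      then have "(a, b) \<notin> invs q" using q by (simp add: invs_def)
      then have "(a, b) \<notin> invs p" using assms(3) by simp
      then show ?thesis using \<open>a < b\<close> by (simp add: invs_def)
    next
      assume "b < a"
      then have "(b, a) \<in> invs q" using q by (simp add: invs_def)
      then have "(b, a) \<in> invs p" using assms(3) by simp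
      then show ?thesis by (simp add: invs_def)
    qed
    moreover have "p a \<noteq> p b" using \<open>a \<noteq> b\<close> inj_eq[OF permutes_inj[OF assms(1)]] by simp
    ultimately show "(p \<circ> inv q) i < (p \<circ> inv q) (Suc i)"
      by (simp add: a_def b_def)
  qed
  then have "p (inv q (q u)) = q u" for u by (simp add: fun_eq_iff)
  then show ?thesis using permutes_inverses(2)[OF assms(2)] by auto
qed

lemma finite_permutes_invs:
  assumes "p permutes {1..N}"
  shows "finite (invs p)"
proof (rule finite_subset)
  show "invs p \<subseteq> {1..N} \<times> {1..N}"
    using permutes_invs_bounded[OF assms] by (fastforce simp: invs_def)
qed simp

lemma inv_comp_adj:
  assumes "w permutes S"
  shows "inv (w \<circ> adj_transp i) = adj_transp i \<circ> inv w"
  using permutes_bij[OF assms] by (simp add: o_inv_distrib)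

lemma invs_ascent:
  assumes "w permutes {1..N}" "w i < w (Suc i)"
  shows "card (invs (inv (w \<circ> adj_transp i))) = Suc (card (invs (inv w)))"
proof -
  have inj: "inj (inv w)" using permutes_inv[OF assms(1)] permutes_inj by blast
  have "inv w (w i) = i" "inv w (w (Suc i)) = Suc i"
    using permutes_inverses(2)[OF assms(1)] by auto
  from invs_insert[OF inj this assms(2)] show ?thesis
    using finite_permutes_invs[OF permutes_inv[OF assms(1)]] by (simp add: inv_comp_adj[OF assms(1)])
qed

text \<open>Bubble sort: undo a descent and use induction on the number of inversions.\<close>

lemma exists_reduced_word:
  assumes "w permutes {1..N}"
  shows "\<exists>\<alpha>. set \<alpha> \<subseteq> {1..<N} \<and> word_perm \<alpha> = w \<and> reduced \<alpha>"
  using assms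
proof (induction "card (invs (inv w))" arbitrary: w rule: less_induct)
  case less
  show ?case
  proof (cases "\<forall>i. 1 \<le> i \<and> i < N \<longrightarrow> w i < w (Suc i)")
    case True
    then have "w = id" using increasing_permutes_id[OF less.prems] by blast
    then show ?thesis by (intro exI[of _ "[]"]) simp
  next
    case False
    then obtain i where i: "1 \<le> i" "i < N" "\<not> w i < w (Suc i)" by blast
    define u where "u = w \<circ> adj_transp i"
    have u: "u permutes {1..N}"
      unfolding u_def using i less.prems by (intro permutes_compose permutes_swap_id) auto
    have "w i \<noteq> w (Suc i)" using inj_eq[OF permutes_inj[OF less.prems]] by simp
    then have asc: "u i < u (Suc i)" using i(3) by (simp add: u_def)
    have w: "u \<circ> adj_transp i = w" by (simp add: u_def comp_assoc)
    have "card (invs (inv u)) < card (invs (inv w))"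
      using invs_ascent[OF u asc] w by simp
    then obtain \<alpha> where \<alpha>: "set \<alpha> \<subseteq> {1..<N}" "word_perm \<alpha> = u" "reduced \<alpha>"
      using less.hyps u by blast
    then show ?thesis
      using i asc w by (intro exI[of _ "\<alpha> @ [i]"]) (simp add: reduced_snoc word_perm_append)
  qed
qed

lemma reduced_words_iff:
  assumes "w permutes {1..N}"
  shows "\<alpha> \<in> reduced_words N w \<longleftrightarrow> set \<alpha> \<subseteq> {1..<N} \<and> word_perm \<alpha> = w \<and> reduced \<alpha>"
proof
  assume \<alpha>: "\<alpha> \<in> reduced_words N w"
  obtain \<beta> where \<beta>: "set \<beta> \<subseteq> {1..<N}" "word_perm \<beta> = w" "reduced \<beta>"
    using exists_reduced_word[OF assms] by blast
  have "length \<alpha> \<le> length \<beta>" "word_perm \<alpha> = w" "set \<alpha> \<subseteq> {1..<N}"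
    using \<alpha> \<beta> by (auto simp: reduced_words_def words_for_def)
  moreover have "pos \<alpha> = pos \<beta>" by (rule pos_cong) (use calculation \<beta> in simp)
  ultimately show "set \<alpha> \<subseteq> {1..<N} \<and> word_perm \<alpha> = w \<and> reduced \<alpha>"
    using \<beta>(3) card_invs_le[of \<alpha>] by (auto simp: reduced_def)
next
  assume \<alpha>: "set \<alpha> \<subseteq> {1..<N} \<and> word_perm \<alpha> = w \<and> reduced \<alpha>"
  have "length \<alpha> \<le> length \<beta>" if "word_perm \<beta> = w" for \<beta>
    using \<alpha> card_invs_le[of \<beta>] pos_cong[of \<alpha> \<beta>] that by (simp add: reduced_def)
  then show "\<alpha> \<in> reduced_words N w"
    using \<alpha> by (auto simp: reduced_words_def words_for_def)
qed

lemma longest_perm_involution: "longest_perm N (longest_perm N i) = i"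
  by (auto simp: longest_perm_def)

lemma longest_perm_permutes: "longest_perm N permutes {1..N}"
  by (rule bij_imp_permutes[OF bij_betw_byWitness[of _ "longest_perm N"]])
    (auto simp: longest_perm_def)

lemma invs_longest_perm: "invs (longest_perm N) = {(a, b). 1 \<le> a \<and> a < b \<and> b \<le> N}"
  by (auto simp: invs_def longest_perm_def)

lemma reduced_words_longest_perm: "\<rho> \<in> reduced_words N (longest_perm N) \<longleftrightarrow> longest_word 1 N \<rho>"
proof -
  have "word_perm \<rho> = longest_perm N \<longleftrightarrow> pos \<rho> = longest_perm N"
    using longest_perm_involution by (metis ext pos_word_perm word_perm_pos)
  moreover have "pos \<rho> = longest_perm N \<longleftrightarrow> (\<forall>u v. 1 \<le> u \<and> u < v \<and> v \<le> N \<longrightarrow> (u, v) \<in> invs (pos \<rho>))"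
    if letters: "set \<rho> \<subseteq> {1..<N}"
  proof
    assume all: "\<forall>u v. 1 \<le> u \<and> u < v \<and> v \<le> N \<longrightarrow> (u, v) \<in> invs (pos \<rho>)"
    have "invs (pos \<rho>) = invs (longest_perm N)"
    proof (rule set_eqI, clarify)
      fix a b
      have "(a, b) \<in> invs (pos \<rho>) \<Longrightarrow> 1 \<le> a \<and> a < b \<and> b \<le> N"
        using invs_bounded[OF letters, of a b] by (simp add: invs_def)
      then show "(a, b) \<in> invs (pos \<rho>) \<longleftrightarrow> (a, b) \<in> invs (longest_perm N)"
        using all unfolding invs_longest_perm by blast
    qed
    then show "pos \<rho> = longest_perm N"
      by (rule invs_determine[OF word_perm_permutes(2)[OF letters] longest_perm_permutes])
  qed (simp add: invs_longest_perm)
  ultimately show ?thesis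
    unfolding reduced_words_iff[OF longest_perm_permutes] longest_word_def by blast
qed

section \<open>Maximum chains of the tubing lattice\<close>

text \<open>
  Every edge across a vertex \<open>b \<ge> m\<close>, with one end below \<open>b\<close> and one above, would have to be a path
  edge, and path edges skip nothing; so \<open>b\<close> separates the graph. Conversely, if nothing is missing,
  walk along the path, after one step to \<open>m\<close> inside the complete part if \<open>a < m\<close>.
\<close>

lemma same_component_iff:
  assumes V: "V \<subseteq> {1..m + n}" "finite V" "a \<in> V"
  shows "same_component (L_edges m n) V a (Max V) \<longleftrightarrow> (\<forall>b. a < b \<and> m \<le> b \<and> b < Max V \<longrightarrow> b \<in> V)"
proof -
  define M where "M = Max V"
  define E where "E = {(x, y). x \<in> V \<and> y \<in> V \<and> {x, y} \<in> L_edges m n}"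
  have MV: "M \<in> V" unfolding M_def by (rule Max_in) (use V in auto)
  have aM: "a \<le> M" using V by (simp add: M_def)
  have M_le: "M \<le> m + n" and a_ge: "1 \<le> a" using V MV by auto
  have edge: "{x, y} \<in> L_edges m n \<longleftrightarrow>
      (1 \<le> x \<and> x < y \<and> y \<le> m) \<or> (m \<le> x \<and> x < m + n \<and> y = Suc x)" if "x < y" for x y
    using that by (fastforce simp: L_edges_def doubleton_eq_iff)
  show ?thesis
  proof
    assume comp: "same_component (L_edges m n) V a (Max V)"
    show "\<forall>b. a < b \<and> m \<le> b \<and> b < Max V \<longrightarrow> b \<in> V"
    proof (intro allI impI, rule ccontr)
      fix b
      assume b: "a < b \<and> m \<le> b \<and> b < Max V" "b \<notin> V"
      \<comment> \<open>The vertices below \<open>b\<close> cannot be left without visiting \<open>b\<close>.\<close>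
      have stay: "y < b" if "(x, y) \<in> E" "x < b" for x y
      proof (rule ccontr)
        assume "\<not> y < b"
        moreover have "y \<noteq> b" using that(1) b(2) by (auto simp: E_def)
        ultimately have "b < y" by simp
        then have "x < y" "{x, y} \<in> L_edges m n" using that by (auto simp: E_def)
        then show False using edge[of x y] b \<open>b < y\<close> \<open>x < b\<close> by auto
      qed
      have "(a, M) \<in> E\<^sup>*" using comp by (simp add: same_component_def E_def M_def)
      then have "M < b"
        by (induction rule: rtrancl_induct) (use b stay in auto)
      then show False using b by (simp add: M_def)
    qed
  next
    assume "\<forall>b. a < b \<and> m \<le> b \<and> b < Max V \<longrightarrow> b \<in> V"
    then have between: "b \<in> V" if "a < b" "m \<le> b" "b \<le> M" for b
      using that MV by (cases "b = M") (auto simp: M_def)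
    have path: "(k, k + d) \<in> E\<^sup>*" if "a \<le> k" "m \<le> k" "k \<in> V" "k + d \<le> M" for k d
      using that(4)
    proof (induction d)
      case (Suc d)
      have "(k + d, k + Suc d) \<in> E"
        using Suc.prems that between[of "k + Suc d"] between[of "k + d"] edge[of "k + d" "k + Suc d"] M_le
        by (cases d) (auto simp: E_def)
      then show ?case using Suc by (auto intro: rtrancl_into_rtrancl)
    qed simp
    have "(a, M) \<in> E\<^sup>*"
    proof (cases "m \<le> a")
      case True
      then show ?thesis using path[of a "M - a"] V(3) aM by simp
    next
      case False
      show ?thesis
      proof (cases "M \<le> m")
        case True
        then show ?thesis
          using edge[of a M] V(3) MV a_ge aM by (cases "a = M") (auto simp: E_def)
      next
        case M: False
        then have "m \<in> V" using between[of m] False by simp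
        then have "(a, m) \<in> E" using edge[of a m] V(3) a_ge False by (auto simp: E_def)
        moreover have "(m, M) \<in> E\<^sup>*" using path[of m "M - m"] \<open>m \<in> V\<close> M False by simp
        ultimately show ?thesis by (rule converse_rtrancl_into_rtrancl)
      qed
    qed
    then show "same_component (L_edges m n) V a (Max V)"
      using MV V(3) by (simp add: same_component_def E_def M_def)
  qed
qed

lemma L_perms_word_perm:
  assumes letters: "set \<alpha> \<subseteq> {1..<m + n}"
  shows "word_perm \<alpha> \<in> L_perms m n \<longleftrightarrow>
    (\<forall>a b c. a < b \<and> b < c \<and> m \<le> b \<and> pos \<alpha> c < pos \<alpha> a \<longrightarrow> pos \<alpha> b < pos \<alpha> a)"
proof -
  note perm = word_perm_permutes(1)[OF letters] and pos_perm = word_perm_permutes(2)[OF letters]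
  define V where "V i = word_perm \<alpha> ` {1..i}" for i
  have V: "u \<in> V i \<longleftrightarrow> 1 \<le> pos \<alpha> u \<and> pos \<alpha> u \<le> i" for u i
    unfolding V_def by (metis atLeastAtMost_iff image_iff pos_word_perm word_perm_pos)
  have V_sub: "V i \<subseteq> {1..m + n}" if "i \<le> m + n" for i
    using that permutes_in_image[OF perm] by (fastforce simp: V_def)
  have "word_perm \<alpha> \<in> L_perms m n \<longleftrightarrow>
      (\<forall>i\<in>{1..m + n}. \<forall>b. word_perm \<alpha> i < b \<and> m \<le> b \<and> b < Max (V i) \<longrightarrow> b \<in> V i)"
    unfolding L_perms_def graph_perm_def mem_Collect_eq V_def[symmetric]
    using perm V_sub same_component_iff[of "V _" m n] by (auto simp: V_def)
  also have "\<dots> \<longleftrightarrow>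
      (\<forall>a b c. a < b \<and> b < c \<and> m \<le> b \<and> pos \<alpha> c < pos \<alpha> a \<longrightarrow> pos \<alpha> b < pos \<alpha> a)" (is "?L \<longleftrightarrow> ?R")
  proof
    assume L: ?L
    show ?R
    proof (intro allI impI)
      fix a b c
      assume abc: "a < b \<and> b < c \<and> m \<le> b \<and> pos \<alpha> c < pos \<alpha> a"
      then have "(a, c) \<in> invs (pos \<alpha>)" by (auto simp: invs_def)
      then have ac: "1 \<le> a" "c \<le> m + n" using invs_bounded[OF letters] by auto
      have in_range: "pos \<alpha> u \<in> {1..m + n}" if "1 \<le> u" "u \<le> m + n" for u
        using permutes_in_image[OF pos_perm, of u] that by simp
      have "c \<in> V (pos \<alpha> a)" using V in_range[of c] abc ac by auto
      then have "c \<le> Max (V (pos \<alpha> a))" by (simp add: V_def)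
      then have "b \<in> V (pos \<alpha> a)"
        using L in_range[of a] abc ac by auto
      then have "pos \<alpha> b \<le> pos \<alpha> a" using V by simp
      then show "pos \<alpha> b < pos \<alpha> a" using abc by (simp add: nat_less_le)
    qed
  next
    assume R: ?R
    show ?L
    proof (intro ballI allI impI)
      fix i b
      assume i: "i \<in> {1..m + n}" and b: "word_perm \<alpha> i < b \<and> m \<le> b \<and> b < Max (V i)"
      define c where "c = Max (V i)"
      have "c \<in> V i" unfolding c_def by (rule Max_in) (use i in \<open>auto simp: V_def\<close>)
      then have c: "pos \<alpha> c \<le> i" using V by simp
      moreover have "pos \<alpha> c \<noteq> i" using b by (auto simp: c_def[symmetric])
      ultimately have "pos \<alpha> c < pos \<alpha> (word_perm \<alpha> i)" by simp
      then have "pos \<alpha> b < i" using R b c_def by (metis pos_word_perm)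
      moreover have "1 \<le> b" "b \<le> m + n"
        using b permutes_in_image[OF perm, of i] i V_sub[of i] \<open>c \<in> V i\<close> by (auto simp: c_def[symmetric])
      then have "1 \<le> pos \<alpha> b" using permutes_in_image[OF pos_perm, of b] by simp
      ultimately show "b \<in> V i" using V by simp
    qed
  qed
  finally show ?thesis .
qed

text \<open>
  A forbidden pattern \<open>c, a, b\<close> means that \<open>bc\<close> is inverted and \<open>ab\<close> is not. If the same happens
  with the order \<open>a, c, b\<close>, the forbidden pattern occurs at a later time, by \<open>crossing_time\<close>.
\<close>

lemma prefixes_L_perms_iff:
  assumes "longest_word 1 (m + n) \<rho>"
  shows "(\<forall>k. word_perm (take k \<rho>) \<in> L_perms m n) \<longleftrightarrow> lex_word 1 m \<rho>"
proof -
  have reduced: "reduced \<rho>" and letters: "set \<rho> \<subseteq> {1..<m + n}"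
    using assms by (auto simp: longest_word_def)
  note L = L_perms_word_perm[OF set_take_letters[OF letters]]
  show ?thesis
  proof
    assume all: "\<forall>k. word_perm (take k \<rho>) \<in> L_perms m n"
    show "lex_word 1 m \<rho>"
      unfolding lex_word_def lex_closed_def
    proof (intro allI impI, elim conjE, rule ccontr)
      fix k a b c
      assume abc: "1 \<le> a" "a < b" "b < c" "m \<le> b" "(b, c) \<in> invs (pos (take k \<rho>))"
        and no: "(a, b) \<notin> invs (pos (take k \<rho>))"
      have "c \<le> m + n" using invs_bounded(2)[OF set_take_letters[OF letters] abc(5)] .
      then have "(a, b) \<in> invs (pos \<rho>)" using assms abc by (auto simp: longest_word_def)
      then obtain l where "pos (take l \<rho>) b = Suc (pos (take l \<rho>) a)" "pos (take l \<rho>) c < pos (take l \<rho>) a"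
        using crossing_time[OF reduced _ abc(3) abc(5) no] by blast
      then show False using all[rule_format, of l] abc unfolding L by fastforce
    qed
  next
    assume lex: "lex_word 1 m \<rho>"
    show "\<forall>k. word_perm (take k \<rho>) \<in> L_perms m n"
      unfolding L
    proof (intro allI impI, rule ccontr)
      fix k a b c
      assume abc: "a < b \<and> b < c \<and> m \<le> b \<and> pos (take k \<rho>) c < pos (take k \<rho>) a"
        and no: "\<not> pos (take k \<rho>) b < pos (take k \<rho>) a"
      then have "(a, c) \<in> invs (pos (take k \<rho>))" by (auto simp: invs_def)
      then have "1 \<le> a" using invs_bounded(1)[OF set_take_letters[OF letters]] by blast
      moreover have "(b, c) \<in> invs (pos (take k \<rho>))" using abc no by (auto simp: invs_def)
      ultimately have "(a, b) \<in> invs (pos (take k \<rho>))"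
        using lex abc by (auto simp: lex_word_def intro: lex_closedD)
      then show False using no by (simp add: invs_def)
    qed
  qed
qed

text \<open>The number of inversions separates the elements of a chain, and bounds its length.\<close>

lemma weak_le_invs:
  assumes "weak_le N u v"
  shows "u = v \<or> card (invs (inv u)) < card (invs (inv v))"
  using assms unfolding weak_le_def
proof (induction rule: rtranclp_induct)
  case (step v w)
  then obtain i where "v permutes {1..N}" "v i < v (Suc i)" "w = v \<circ> adj_transp i"
    by (auto simp: weak_cover_def)
  then have "card (invs (inv w)) = Suc (card (invs (inv v)))" using invs_ascent by blast
  then show ?case using step by auto
qed simp

lemma weak_le_take:
  assumes "reduced \<rho>" "set \<rho> \<subseteq> {1..<N}" "k \<le> l"
  shows "weak_le N (word_perm (take k \<rho>)) (word_perm (take l \<rho>))"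
  using assms(3)
proof (induction l rule: dec_induct)
  case base
  then show ?case by (simp add: weak_le_def)
next
  case (step l)
  show ?case
  proof (cases "l < length \<rho>")
    case True
    then have take: "take (Suc l) \<rho> = take l \<rho> @ [\<rho> ! l]" by (rule take_Suc_conv_app_nth)
    have "reduced (take l \<rho> @ [\<rho> ! l])" using reduced_take[OF assms(1), of "Suc l"] take by simp
    moreover have "\<rho> ! l \<in> {1..<N}" using assms(2) True nth_mem by blast
    ultimately have "weak_cover N (word_perm (take l \<rho>)) (word_perm (take (Suc l) \<rho>))"
      using word_perm_permutes(1)[OF set_take_letters[OF assms(2)]]
      by (auto simp: weak_cover_def take reduced_snoc word_perm_append)
    then show ?thesis using step.IH by (auto simp: weak_le_def)
  next
    case False
    then show ?thesis using step.IH by simp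
  qed
qed

lemma LMC_iff_prefixes_L_perms:
  assumes "longest_word 1 (m + n) \<rho>"
  shows "chain_of_word \<rho> \<in> LMC m n \<longleftrightarrow> (\<forall>k. word_perm (take k \<rho>) \<in> L_perms m n)"
proof
  assume "chain_of_word \<rho> \<in> LMC m n"
  then have sub: "chain_of_word \<rho> \<subseteq> L_perms m n"
    by (simp add: LMC_def tubing_chains_def)
  have "word_perm (take k \<rho>) \<in> chain_of_word \<rho>" for k
    unfolding chain_of_word_def
    by (rule image_eqI[of _ _ "min k (length \<rho>)"]) (auto simp: min_def)
  then show "\<forall>k. word_perm (take k \<rho>) \<in> L_perms m n" using sub by blast
next
  assume all: "\<forall>k. word_perm (take k \<rho>) \<in> L_perms m n"
  have reduced: "reduced \<rho>" and letters: "set \<rho> \<subseteq> {1..<m + n}"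
    using assms by (auto simp: longest_word_def)
  have "Complete_Partial_Order.chain (weak_le (m + n)) (chain_of_word \<rho>)"
    unfolding chain_of_word_def
  proof (rule chainI, elim imageE, clarify)
    fix k l
    assume "\<not> weak_le (m + n) (word_perm (take l \<rho>)) (word_perm (take k \<rho>))"
    then show "weak_le (m + n) (word_perm (take k \<rho>)) (word_perm (take l \<rho>))"
      using weak_le_take[OF reduced letters, of k l] weak_le_take[OF reduced letters, of l k] by linarith
  qed
  then have chain: "chain_of_word \<rho> \<in> tubing_chains m n"
    using all by (auto simp: tubing_chains_def chain_of_word_def)
  have "inj_on (\<lambda>k. word_perm (take k \<rho>)) {0..length \<rho>}"
  proof (rule inj_onI)
    fix k l
    assume kl: "k \<in> {0..length \<rho>}" "l \<in> {0..length \<rho>}" "word_perm (take k \<rho>) = word_perm (take l \<rho>)"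
    then have "length (take k \<rho>) = length (take l \<rho>)"
      using reduced_take[OF reduced, of k] reduced_take[OF reduced, of l] pos_cong[OF kl(3)] by (simp add: reduced_def)
    then show "k = l" using kl by simp
  qed
  then have card: "card (chain_of_word \<rho>) = Suc (length \<rho>)"
    unfolding chain_of_word_def by (simp add: card_image)
  have "card D \<le> Suc (length \<rho>)" if D: "D \<in> tubing_chains m n" for D
  proof -
    have perm: "w permutes {1..m + n}" if "w \<in> D" for w
      using D that by (auto simp: tubing_chains_def L_perms_def graph_perm_def)
    have "inj_on (\<lambda>w. card (invs (inv w))) D"
    proof (rule inj_onI)
      fix u v
      assume uv: "u \<in> D" "v \<in> D" "card (invs (inv u)) = card (invs (inv v))"
      then have "weak_le (m + n) u v \<or> weak_le (m + n) v u"
        using D by (auto simp: tubing_chains_def Complete_Partial_Order.chain_def)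
      then show "u = v" using weak_le_invs[of "m + n"] uv(3) by fastforce
    qed
    moreover have "(\<lambda>w. card (invs (inv w))) ` D \<subseteq> {..length \<rho>}"
    proof (rule image_subsetI)
      fix w
      assume "w \<in> D"
      then have p: "inv w permutes {1..m + n}" using perm permutes_inv by blast
      have "invs (inv w) \<subseteq> invs (pos \<rho>)"
      proof clarify
        fix a b
        assume ab: "(a, b) \<in> invs (inv w)"
        then have "a < b" by (simp add: invs_def)
        then show "(a, b) \<in> invs (pos \<rho>)"
          using assms permutes_invs_bounded[OF p ab] by (simp add: longest_word_def)
      qed
      from card_mono[OF finite_invs this] show "card (invs (inv w)) \<in> {..length \<rho>}"
        using reduced by (simp add: reduced_def)
    qed
    ultimately show ?thesis using card_inj_on_le[of _ D "{..length \<rho>}"] by simp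
  qed
  then show "chain_of_word \<rho> \<in> LMC m n"
    using chain card by (simp add: LMC_def)
qed

section \<open>Commuting shuffles\<close>

definition distant :: "nat \<Rightarrow> nat \<Rightarrow> bool" where
  "distant x y \<longleftrightarrow> Suc x < y \<or> Suc y < x"

lemma distant_sym: "distant x y \<longleftrightarrow> distant y x"
  by (auto simp: distant_def)

lemma distant_adj: "distant x y \<Longrightarrow> adj_transp x y = y" "distant x y \<Longrightarrow> adj_transp x (Suc y) = Suc y"
  by (auto simp: distant_def transpose_def)

lemma word_perm_swap:
  assumes "distant x y"
  shows "word_perm (\<alpha> @ [x, y] @ \<beta>) = word_perm (\<alpha> @ [y, x] @ \<beta>)"
proof (rule word_perm_replace)
  have "word_perm (x # [y]) = word_perm ([y] @ [x])"
    by (rule word_perm_commute) (use assms in \<open>auto simp: distant_def\<close>)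
  then show "word_perm [x, y] = word_perm [y, x]" by simp
qed

lemma reduced_swap: "distant x y \<Longrightarrow> reduced (\<alpha> @ [x, y] @ \<beta>) \<Longrightarrow> reduced (\<alpha> @ [y, x] @ \<beta>)"
  by (rule reduced_cong[of "\<alpha> @ [x, y] @ \<beta>"]) (simp_all add: word_perm_swap[of x y \<alpha> \<beta>, simplified])

text \<open>
  Only the prefix ending between the two letters changes. Let \<open>V\<close> be the inversions before both
  steps and \<open>P\<close>, \<open>Q\<close> the two disjoint pairs: the condition for \<open>V\<close> and for \<open>V \<union> {P, Q}\<close> implies it for
  \<open>V \<union> {Q}\<close>, because \<open>P\<close> has no value in common with \<open>Q\<close>.
\<close>

lemma lex_word_swap:
  assumes "distant x y" "reduced (\<alpha> @ [x, y] @ \<beta>)" "lex_word s m (\<alpha> @ [x, y] @ \<beta>)"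
  shows "lex_word s m (\<alpha> @ [y, x] @ \<beta>)"
  unfolding lex_word_def
proof
  fix k
  have closed: "lex_closed s m (pos (take j (\<alpha> @ [x, y] @ \<beta>)))" for j
    using assms(3) by (simp add: lex_word_def)
  consider "k \<le> length \<alpha>" | "k = Suc (length \<alpha>)" | "k \<ge> Suc (Suc (length \<alpha>))" by linarith
  then show "lex_closed s m (pos (take k (\<alpha> @ [y, x] @ \<beta>)))"
  proof cases
    case 1
    then show ?thesis using closed[of k] by simp
  next
    case 3
    then have "take k (\<alpha> @ [y, x] @ \<beta>) = \<alpha> @ [y, x] @ take (k - Suc (Suc (length \<alpha>))) \<beta>"
      "take k (\<alpha> @ [x, y] @ \<beta>) = \<alpha> @ [x, y] @ take (k - Suc (Suc (length \<alpha>))) \<beta>"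
      by (auto simp: take_Cons' Suc_diff_Suc)
    then show ?thesis
      using closed[of k] pos_cong[OF word_perm_swap[OF assms(1), of \<alpha>]] by simp
  next
    case 2
    define V where "V = invs (pos \<alpha>)"
    define w where "w = word_perm \<alpha>"
    have reduced: "reduced (\<alpha> @ [x])" "reduced ((\<alpha> @ [x]) @ [y])"
      using reduced_appendD[of "\<alpha> @ [x]" "y # \<beta>"] reduced_appendD[of "(\<alpha> @ [x]) @ [y]" \<beta>] assms(2) by auto
    have wy: "word_perm (\<alpha> @ [x]) y = w y" "word_perm (\<alpha> @ [x]) (Suc y) = w (Suc y)"
      using distant_adj[OF assms(1)] by (simp_all add: word_perm_append w_def)
    have less: "w x < w (Suc x)" "w y < w (Suc y)"
      using reduced(2) unfolding reduced_snoc wy by (simp_all add: w_def)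
    have invs_x: "invs (pos (\<alpha> @ [x])) = insert (w x, w (Suc x)) V"
      using invs_snoc_up less(1) by (simp add: w_def V_def)
    have invs_xy: "invs (pos ((\<alpha> @ [x]) @ [y])) = insert (w y, w (Suc y)) (insert (w x, w (Suc x)) V)"
      using invs_snoc_up[of "\<alpha> @ [x]" y] less(2) wy invs_x by simp
    have invs_y: "invs (pos (\<alpha> @ [y])) = insert (w y, w (Suc y)) V"
      using invs_snoc_up less(2) by (simp add: w_def V_def)
    have closed0: "lex_closed s m (pos \<alpha>)" using closed[of "length \<alpha>"] by simp
    have closed2: "lex_closed s m (pos ((\<alpha> @ [x]) @ [y]))"
      using closed[of "Suc (Suc (length \<alpha>))"] by simp
    have "lex_closed s m (pos (\<alpha> @ [y]))"
      unfolding lex_closed_def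
    proof (intro allI impI, elim conjE)
      fix a b c
      assume abc: "s \<le> a" "a < b" "b < c" "m \<le> b" "(b, c) \<in> invs (pos (\<alpha> @ [y]))"
      show "(a, b) \<in> invs (pos (\<alpha> @ [y]))"
      proof (cases "(b, c) \<in> V")
        case True
        then show ?thesis
          using lex_closedD[OF closed0, of a b c] abc invs_y by (auto simp: V_def)
      next
        case False
        then have "b = w y" using abc(5) invs_y by auto
        have "(a, b) \<in> invs (pos ((\<alpha> @ [x]) @ [y]))"
          using lex_closedD[OF closed2, of a b c] abc invs_y invs_xy by auto
        moreover have "b \<noteq> w (Suc x)"
        proof -
          have "y \<noteq> Suc x" using assms(1) by (auto simp: distant_def)
          then show ?thesis using \<open>b = w y\<close> by (metis pos_word_perm w_def)
        qed
        ultimately show ?thesis using invs_xy invs_y by auto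
      qed
    qed
    then show ?thesis using 2 by simp
  qed
qed

lemma split_at_pair:
  assumes "Suc k < length \<rho>"
  obtains \<alpha> x y \<beta> where "\<rho> = \<alpha> @ [x, y] @ \<beta>" "length \<alpha> = k"
proof
  show "\<rho> = take k \<rho> @ [\<rho> ! k, \<rho> ! Suc k] @ drop (Suc (Suc k)) \<rho>"
    using assms id_take_nth_drop[of k \<rho>] Cons_nth_drop_Suc[of "Suc k" \<rho>] by simp
  show "length (take k \<rho>) = k" using assms by simp
qed

lemma cs_indexed_lex_word:
  assumes "cs_indexed \<sigma> \<tau> \<rho> I J" "reduced (\<sigma> @ \<tau>)" "lex_word s m (\<sigma> @ \<tau>)"
  shows "reduced \<rho> \<and> lex_word s m \<rho> \<and> I \<subseteq> {1..length \<rho>} \<and> J \<subseteq> {1..length \<rho>}"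
  using assms(1)
proof (induction rule: cs_indexed.induct)
  case base
  then show ?case using assms(2,3) by auto
next
  case (swap \<rho> I J i)
  then have i: "1 \<le> i" "Suc i \<le> length \<rho>" by auto
  then have "Suc (i - 1) < length \<rho>" by simp
  then obtain \<alpha> x y \<beta> where \<rho>: "\<rho> = \<alpha> @ [x, y] @ \<beta>" "length \<alpha> = i - 1"
    by (rule split_at_pair)
  then have i': "i = Suc (length \<alpha>)" using i by simp
  have "\<rho> ! (i - 1) = x" "\<rho> ! i = y" using \<rho>(1) i' by (simp_all add: nth_append)
  moreover have "\<rho>[i - 1 := y, i := x] = \<alpha> @ [y, x] @ \<beta>"
    using \<rho>(1) i' by (simp add: list_update_append)
  moreover have "distant x y"
    using swap.hyps(4) calculation(1,2) by (auto simp: distant_def)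
  ultimately show ?case
    using swap i reduced_swap lex_word_swap \<rho>(1) by (auto simp: subset_iff)
qed

text \<open>The inverse of \<open>v_perm m n\<close>.\<close>

definition v_pos :: "nat \<Rightarrow> nat \<Rightarrow> nat \<Rightarrow> nat" where
  "v_pos m n u = (if m \<le> u \<and> u \<le> m + n then Suc u - m
     else if 1 \<le> u \<and> u < m then m + n + 1 - u else u)"

lemma v_pos_v_perm: "1 \<le> m \<Longrightarrow> v_pos m n (v_perm m n i) = i"
  and v_perm_v_pos: "1 \<le> m \<Longrightarrow> v_perm m n (v_pos m n i) = i"
  by (auto simp: v_pos_def v_perm_def)

lemma v_pos_permutes:
  assumes "1 \<le> m"
  shows "v_pos m n permutes {1..m + n}"
proof (rule bij_imp_permutes)
  show "bij_betw (v_pos m n) {1..m + n} {1..m + n}"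
  proof (rule bij_betw_byWitness[of _ "v_perm m n"])
    show "v_pos m n ` {1..m + n} \<subseteq> {1..m + n}" "v_perm m n ` {1..m + n} \<subseteq> {1..m + n}"
      using assms by (auto simp: v_pos_def v_perm_def)
  qed (simp_all add: v_pos_v_perm[OF assms] v_perm_v_pos[OF assms])
qed (use assms in \<open>auto simp: v_pos_def\<close>)

lemma v_perm_permutes:
  assumes "1 \<le> m"
  shows "v_perm m n permutes {1..m + n}"
proof -
  have "inv (v_pos m n) = v_perm m n"
    by (rule inv_equality) (simp_all add: v_pos_v_perm[OF assms] v_perm_v_pos[OF assms])
  then show ?thesis using permutes_inv[OF v_pos_permutes[OF assms]] by metis
qed

lemma invs_v_pos: "invs (v_pos m n) = {(a, b). 1 \<le> a \<and> a < m \<and> a < b \<and> b \<le> m + n}"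
proof (rule set_eqI, clarify)
  fix a b
  show "(a, b) \<in> invs (v_pos m n) \<longleftrightarrow> (a, b) \<in> {(a, b). 1 \<le> a \<and> a < m \<and> a < b \<and> b \<le> m + n}"
    unfolding invs_def v_pos_def
    by (cases "1 \<le> a"; cases "m \<le> a"; cases "a \<le> m + n"; cases "m \<le> b"; cases "b \<le> m + n") auto
qed

lemma word_perm_v_perm_iff: "1 \<le> m \<Longrightarrow> word_perm \<sigma> = v_perm m n \<longleftrightarrow> pos \<sigma> = v_pos m n"
  by (metis ext pos_word_perm v_perm_v_pos v_pos_v_perm word_perm_pos)

text \<open>The word \<open>\<tau>\<close> acts on the positions up to \<open>n + 1\<close>, where \<open>v_perm m n\<close> is increasing.\<close>

lemma reduced_append_v:
  assumes "1 \<le> m" "word_perm \<sigma> = v_perm m n" "reduced \<sigma>" "set \<tau> \<subseteq> {1..<n + 1}" "reduced \<tau>"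
  shows "reduced (\<sigma> @ \<tau>)"
  using assms(4,5)
proof (induction \<tau> rule: rev_induct)
  case (snoc x \<tau>)
  then have "reduced (\<sigma> @ \<tau>)" using reduced_appendD by auto
  have perm: "word_perm \<tau> permutes {1..n + 1}"
    by (rule word_perm_permutes) (use snoc.prems in auto)
  have "x \<in> {1..n + 1}" "Suc x \<in> {1..n + 1}" using snoc.prems by auto
  then have "word_perm \<tau> x \<in> {1..n + 1}" "word_perm \<tau> (Suc x) \<in> {1..n + 1}"
    using permutes_in_image[OF perm] by blast+
  moreover have "word_perm \<tau> x < word_perm \<tau> (Suc x)"
    using snoc.prems by (simp add: reduced_snoc)
  ultimately have "word_perm (\<sigma> @ \<tau>) x < word_perm (\<sigma> @ \<tau>) (Suc x)"
    using assms(1,2) by (simp add: word_perm_append v_perm_def)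
  with \<open>reduced (\<sigma> @ \<tau>)\<close> show ?case using reduced_snoc[of "\<sigma> @ \<tau>" x] by simp
qed (use assms in simp)

text \<open>
  The word \<open>\<sigma>\<close> inverts only pairs whose smaller value is below \<open>m\<close>, and all of them; \<open>\<tau>\<close> then acts on
  the values from \<open>m\<close> on, shifted by \<open>m - 1\<close>.
\<close>

lemma lex_word_append_v:
  assumes m: "1 \<le> m" and \<sigma>: "word_perm \<sigma> = v_perm m n" "reduced \<sigma>" "set \<sigma> \<subseteq> {1..<m + n}"
    and \<tau>: "set \<tau> \<subseteq> {1..<n + 1}" "reduced \<tau>" "lex_word 1 1 \<tau>"
  shows "lex_word 1 m (\<sigma> @ \<tau>)"
  unfolding lex_word_def lex_closed_def
proof (intro allI impI, elim conjE)
  fix k a b c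
  assume abc: "1 \<le> a" "a < b" "b < c" "m \<le> b" "(b, c) \<in> invs (pos (take k (\<sigma> @ \<tau>)))"
  have v: "pos \<sigma> = v_pos m n" using \<sigma>(1) word_perm_v_perm_iff[OF m] by simp
  show "(a, b) \<in> invs (pos (take k (\<sigma> @ \<tau>)))"
  proof (cases "k \<le> length \<sigma>")
    case True
    then have "(b, c) \<in> invs (pos \<sigma>)"
      using abc(5) invs_take_mono[OF \<sigma>(2), of k "length \<sigma>"] by auto
    then show ?thesis using abc(4) by (simp add: v invs_v_pos)
  next
    case False
    define \<tau>' where "\<tau>' = take (k - length \<sigma>) \<tau>"
    have take: "take k (\<sigma> @ \<tau>) = \<sigma> @ \<tau>'" using False by (simp add: \<tau>'_def)
    have letters: "set \<tau>' \<subseteq> {1..<n + 1}" using set_take_letters[OF \<tau>(1)] by (simp add: \<tau>'_def)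
    then have "set (\<sigma> @ \<tau>') \<subseteq> {1..<m + n}" using \<sigma>(3) m by fastforce
    then have "c \<le> m + n" using invs_bounded(2) abc(5) take by metis
    have p: "pos (\<sigma> @ \<tau>') u = pos \<tau>' (v_pos m n u)" for u by (simp add: pos_append v)
    have big: "v_pos m n u = Suc u - m" if "m \<le> u" "u \<le> m + n" for u
      using that by (simp add: v_pos_def)
    have bc: "(Suc b - m, Suc c - m) \<in> invs (pos \<tau>')"
      using abc(1-4) abc(5)[unfolded take] \<open>c \<le> m + n\<close> by (auto simp: invs_def p big)
    have "pos \<tau>' (v_pos m n b) < pos \<tau>' (v_pos m n a)"
    proof (cases "m \<le> a")
      case True
      have "(Suc a - m, Suc b - m) \<in> invs (pos \<tau>')"
        proof (rule lex_closedD)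
        show "lex_closed 1 1 (pos \<tau>')" using \<tau>(3) by (simp add: lex_word_def \<tau>'_def)
        show "(Suc b - m, Suc c - m) \<in> invs (pos \<tau>')" by (rule bc)
      qed (use True abc in linarith)+
      then show ?thesis using True abc \<open>c \<le> m + n\<close> by (simp add: big invs_def)
    next
      case False
      then have "v_pos m n a = m + n + 1 - a" using abc by (simp add: v_pos_def)
      then have "n + 1 < v_pos m n a" using False by simp
      then have "pos \<tau>' (v_pos m n a) = v_pos m n a"
        by (intro pos_fixes(1)) (use letters in fastforce)
      moreover have "pos \<tau>' (v_pos m n b) \<le> n + 1"
        by (rule pos_le[OF letters]) (use abc \<open>c \<le> m + n\<close> big[of b] in simp)
      ultimately show ?thesis using \<open>n + 1 < v_pos m n a\<close> by simp
    qed
    then show ?thesis using abc(2) unfolding take by (simp add: invs_def p)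
  qed
qed

lemma shiftable_words_iff: "\<tau> \<in> shiftable_words n \<longleftrightarrow> longest_word 1 (n + 1) \<tau> \<and> lex_word 1 1 \<tau>"
  unfolding shiftable_words_def mem_Collect_eq reduced_words_longest_perm
  using shiftable_iff_lex_word by blast

lemma CS_lex_word:
  assumes "1 \<le> m" "\<rho> \<in> CS m n"
  shows "lex_word 1 m \<rho>"
proof -
  obtain \<sigma> \<tau> I J where \<sigma>: "\<sigma> \<in> reduced_words (m + n) (v_perm m n)" and \<tau>: "\<tau> \<in> shiftable_words n"
    and cs: "cs_indexed \<sigma> \<tau> \<rho> I J"
    using assms(2) by (auto simp: CS_def CS_words_def)
  have "set \<sigma> \<subseteq> {1..<m + n}" "word_perm \<sigma> = v_perm m n" "reduced \<sigma>"
    using \<sigma> reduced_words_iff[OF v_perm_permutes[OF assms(1)]] by auto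
  moreover have "set \<tau> \<subseteq> {1..<n + 1}" "reduced \<tau>" "lex_word 1 1 \<tau>"
    using \<tau> by (auto simp: shiftable_words_iff longest_word_def)
  ultimately show ?thesis
    using cs_indexed_lex_word[OF cs] reduced_append_v lex_word_append_v assms(1) by blast
qed

text \<open>
  The value in position \<open>\<rho> ! k\<close> before that step, which in a reduced word is the smaller one of the
  two values exchanged.
\<close>

definition swapped :: "nat list \<Rightarrow> nat \<Rightarrow> nat" where
  "swapped \<rho> k = word_perm (take k \<rho>) (\<rho> ! k)"

definition small_steps :: "nat \<Rightarrow> nat list \<Rightarrow> nat set" where
  "small_steps m \<rho> = {Suc k | k. k < length \<rho> \<and> swapped \<rho> k < m}"

definition big_steps :: "nat \<Rightarrow> nat list \<Rightarrow> nat set" where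
  "big_steps m \<rho> = {Suc k | k. k < length \<rho> \<and> m \<le> swapped \<rho> k}"

lemma mem_small_steps: "j \<in> small_steps m \<rho> \<longleftrightarrow> 1 \<le> j \<and> j \<le> length \<rho> \<and> swapped \<rho> (j - 1) < m"
  and mem_big_steps: "j \<in> big_steps m \<rho> \<longleftrightarrow> 1 \<le> j \<and> j \<le> length \<rho> \<and> m \<le> swapped \<rho> (j - 1)"
  by (cases j; auto simp: small_steps_def big_steps_def)+

lemma finite_small_steps: "finite (small_steps m \<rho>)"
  by (rule finite_subset[of _ "{..length \<rho>}"]) (auto simp: mem_small_steps)

lemma reduced_invs_take_Suc:
  assumes "reduced \<rho>" "k < length \<rho>"
  shows "swapped \<rho> k < word_perm (take k \<rho>) (Suc (\<rho> ! k))"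
    "invs (pos (take (Suc k) \<rho>)) = insert (swapped \<rho> k, word_perm (take k \<rho>) (Suc (\<rho> ! k))) (invs (pos (take k \<rho>)))"
proof -
  have take: "take (Suc k) \<rho> = take k \<rho> @ [\<rho> ! k]" using assms(2) by (rule take_Suc_conv_app_nth)
  have "reduced (take k \<rho> @ [\<rho> ! k])" using reduced_take[OF assms(1), of "Suc k"] take by simp
  then show "swapped \<rho> k < word_perm (take k \<rho>) (Suc (\<rho> ! k))"
    by (simp add: reduced_snoc swapped_def)
  then show "invs (pos (take (Suc k) \<rho>)) = insert (swapped \<rho> k, word_perm (take k \<rho>) (Suc (\<rho> ! k))) (invs (pos (take k \<rho>)))"
    using invs_snoc_up[of "take k \<rho>" "\<rho> ! k"] take by (simp add: swapped_def)
qed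

lemma swapped_swap:
  assumes "distant x y"
  shows "swapped (\<alpha> @ [y, x] @ \<beta>) (length \<alpha>) = swapped (\<alpha> @ [x, y] @ \<beta>) (Suc (length \<alpha>))"
    "swapped (\<alpha> @ [y, x] @ \<beta>) (Suc (length \<alpha>)) = swapped (\<alpha> @ [x, y] @ \<beta>) (length \<alpha>)"
    "k \<noteq> length \<alpha> \<Longrightarrow> k \<noteq> Suc (length \<alpha>) \<Longrightarrow>
       swapped (\<alpha> @ [y, x] @ \<beta>) k = swapped (\<alpha> @ [x, y] @ \<beta>) k"
proof -
  have adj: "adj_transp x y = y" "adj_transp y x = x"
    using distant_adj assms distant_sym by auto
  show "swapped (\<alpha> @ [y, x] @ \<beta>) (length \<alpha>) = swapped (\<alpha> @ [x, y] @ \<beta>) (Suc (length \<alpha>))"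
    "swapped (\<alpha> @ [y, x] @ \<beta>) (Suc (length \<alpha>)) = swapped (\<alpha> @ [x, y] @ \<beta>) (length \<alpha>)"
    using adj by (simp_all add: swapped_def nth_append word_perm_append)
  assume k: "k \<noteq> length \<alpha>" "k \<noteq> Suc (length \<alpha>)"
  show "swapped (\<alpha> @ [y, x] @ \<beta>) k = swapped (\<alpha> @ [x, y] @ \<beta>) k"
  proof (cases "k < length \<alpha>")
    case True
    then show ?thesis by (simp add: swapped_def nth_append)
  next
    case False
    define l where "l = k - Suc (Suc (length \<alpha>))"
    have "k = length \<alpha> + Suc (Suc l)" using k False by (simp add: l_def)
    then show ?thesis
      using word_perm_swap[OF assms, of \<alpha> "take l \<beta>"] by (simp add: swapped_def nth_append)
  qed
qed

text \<open>
  Let \<open>bc\<close> be the pair of the big step and \<open>ad\<close> that of the small one, so \<open>a < m \<le> b\<close>. If the letters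
  are not distant, the pairs have a common value. It is not \<open>b = d\<close>, for \<open>b\<close> has just moved to the right
  of \<open>c\<close>. If it is \<open>c = d\<close>, then \<open>a, b, c\<close> stood next to each other before the two steps, and \<open>bc\<close> is
  inverted while \<open>ab\<close> is not.
\<close>

lemma small_after_big_distant:
  assumes reduced: "reduced \<rho>" and lex: "lex_word 1 m \<rho>" and letters: "set \<rho> \<subseteq> {1..<N}"
    and \<rho>: "\<rho> = \<alpha> @ [x, y] @ \<beta>"
    and big: "m \<le> swapped \<rho> (length \<alpha>)" and small: "swapped \<rho> (Suc (length \<alpha>)) < m"
  shows "distant x y"
proof (rule ccontr)
  assume "\<not> distant x y"
  define w where "w = word_perm \<alpha>"
  have b: "m \<le> w x" and a: "w (adj_transp x y) < m"
    using big small by (simp_all add: swapped_def \<rho> nth_append word_perm_append w_def)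
  have "reduced (\<alpha> @ [x])" "reduced ((\<alpha> @ [x]) @ [y])"
    using reduced_appendD[of "\<alpha> @ [x]" "y # \<beta>"] reduced_appendD[of "(\<alpha> @ [x]) @ [y]" \<beta>] reduced \<rho> by auto
  then have less: "w x < w (Suc x)" "w (adj_transp x y) < w (adj_transp x (Suc y))"
    unfolding reduced_snoc by (auto simp: word_perm_append w_def)
  consider "y = x" | "y = Suc x" | "Suc y = x"
    using \<open>\<not> distant x y\<close> by (fastforce simp: distant_def)
  then show False
  proof cases
    case 1
    then show ?thesis using less by simp
  next
    case 2
    then show ?thesis using a b by simp
  next
    case 3
    have "adj_transp x y = y" using 3 by (auto simp: transpose_def)
    then have "w y < m" using a by simp
    have closed: "lex_closed 1 m (pos (\<alpha> @ [x]))"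
      using lex[unfolded lex_word_def, rule_format, of "Suc (length \<alpha>)"] by (simp add: \<rho>)
    have "(w x, w (Suc x)) \<in> invs (pos (\<alpha> @ [x]))"
      using invs_snoc_up[of \<alpha> x] less(1) by (simp add: w_def)
    moreover have "1 \<le> w y"
      unfolding w_def by (rule pos_ge(2)[of _ _ N]) (use letters \<rho> in auto)
    ultimately have "(w y, w x) \<in> invs (pos (\<alpha> @ [x]))"
      using \<open>w y < m\<close> b less(1) lex_closedD[OF closed, of "w y" "w x" "w (Suc x)"] by simp
    then have "(w y, w x) \<in> invs (pos \<alpha>)"
      using invs_snoc_up[of \<alpha> x] less(1) by (auto simp: w_def)
    then show ?thesis using 3 by (simp add: invs_def w_def)
  qed
qed

text \<open>
  If all small steps come first, their inversions are those of \<open>v_perm m n\<close>. After that, the values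
  from \<open>m\<close> on occupy the positions up to \<open>n + 1\<close>, and the big steps only move these values, so the
  letters of \<open>\<tau>\<close> are at most \<open>n\<close>.
\<close>

lemma split_small_big:
  assumes m: "1 \<le> m" and longest: "longest_word 1 (m + n) (\<sigma> @ \<tau>)" and lex: "lex_word 1 m (\<sigma> @ \<tau>)"
    and small: "\<And>k. k < length \<sigma> \<Longrightarrow> swapped (\<sigma> @ \<tau>) k < m"
    and big: "\<And>k. length \<sigma> \<le> k \<Longrightarrow> k < length (\<sigma> @ \<tau>) \<Longrightarrow> m \<le> swapped (\<sigma> @ \<tau>) k"
  shows "\<sigma> \<in> reduced_words (m + n) (v_perm m n)" "\<tau> \<in> shiftable_words n"
proof -
  define \<rho> where "\<rho> = \<sigma> @ \<tau>"
  have reduced: "reduced \<rho>" and letters: "set \<rho> \<subseteq> {1..<m + n}"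
    and full: "\<And>u v. 1 \<le> u \<Longrightarrow> u < v \<Longrightarrow> v \<le> m + n \<Longrightarrow> (u, v) \<in> invs (pos \<rho>)"
    using longest by (auto simp: longest_word_def \<rho>_def)
  have red_\<sigma>: "reduced \<sigma>" and letters_\<sigma>: "set \<sigma> \<subseteq> {1..<m + n}"
    using reduced letters reduced_appendD by (auto simp: \<rho>_def)
  have before: "k \<le> length \<sigma> \<Longrightarrow> (a, b) \<in> invs (pos (take k \<rho>)) \<Longrightarrow> a < m" for k a b
  proof (induction k)
    case (Suc k)
    then show ?case
      using reduced_invs_take_Suc(2)[OF reduced, of k] small[of k] by (auto simp: \<rho>_def)
  qed simp
  have after: "length \<sigma> \<le> k \<Longrightarrow> k \<le> length \<rho> \<Longrightarrow> (a, b) \<in> invs (pos (take k \<rho>)) \<Longrightarrow> a < m \<Longrightarrow>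
      (a, b) \<in> invs (pos \<sigma>)" for k a b
  proof (induction k rule: dec_induct)
    case base
    then show ?case by (simp add: \<rho>_def)
  next
    case (step k)
    then show ?case
      using reduced_invs_take_Suc(2)[OF reduced, of k] big[of k] by (auto simp: \<rho>_def)
  qed
  have "invs (pos \<sigma>) = invs (v_pos m n)"
  proof (rule set_eqI, clarify)
    fix a b
    have "(a, b) \<in> invs (pos \<sigma>) \<Longrightarrow> 1 \<le> a \<and> a < m \<and> a < b \<and> b \<le> m + n"
      using before[of "length \<sigma>" a b] invs_bounded[OF letters_\<sigma>, of a b] by (simp add: \<rho>_def invs_def)
    moreover have "1 \<le> a \<Longrightarrow> a < m \<Longrightarrow> a < b \<Longrightarrow> b \<le> m + n \<Longrightarrow> (a, b) \<in> invs (pos \<sigma>)"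
      using after[of "length \<rho>" a b] full[of a b] by (simp add: \<rho>_def)
    ultimately show "(a, b) \<in> invs (pos \<sigma>) \<longleftrightarrow> (a, b) \<in> invs (v_pos m n)"
      unfolding invs_v_pos by blast
  qed
  then have v: "pos \<sigma> = v_pos m n"
    by (rule invs_determine[OF word_perm_permutes(2)[OF letters_\<sigma>] v_pos_permutes[OF m]])
  then have w: "word_perm \<sigma> = v_perm m n" using word_perm_v_perm_iff[OF m] by simp
  then show "\<sigma> \<in> reduced_words (m + n) (v_perm m n)"
    using reduced_words_iff[OF v_perm_permutes[OF m]] red_\<sigma> letters_\<sigma> by simp
  \<comment> \<open>Positions beyond \<open>n + 1\<close> hold values below \<open>m\<close>, which a big step does not touch.\<close>
  have v_less: "v_perm m n i < m" if "n + 1 < i" "i \<le> m + n" for i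
    using that by (auto simp: v_perm_def)
  have \<tau>: "j \<le> length \<tau> \<Longrightarrow> set (take j \<tau>) \<subseteq> {1..<n + 1} \<and> reduced (take j \<tau>)" for j
  proof (induction j)
    case (Suc j)
    define x where "x = \<tau> ! j"
    define u where "u = word_perm (take j \<tau>)"
    have IH: "set (take j \<tau>) \<subseteq> {1..<n + 1}" "reduced (take j \<tau>)" using Suc by auto
    have take: "take (Suc j) \<tau> = take j \<tau> @ [x]"
      using Suc.prems by (simp add: x_def take_Suc_conv_app_nth)
    have "x \<in> set \<rho>" using Suc.prems by (simp add: \<rho>_def x_def)
    then have x: "1 \<le> x" "x < m + n" using letters by auto
    have steps: "swapped \<rho> (length \<sigma> + j) = v_perm m n (u x)"
      "word_perm (take (length \<sigma> + j) \<rho>) (Suc (\<rho> ! (length \<sigma> + j))) = v_perm m n (u (Suc x))"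
      by (simp_all add: swapped_def \<rho>_def x_def u_def word_perm_append w nth_append)
    have ge: "m \<le> v_perm m n (u x)"
      using big[of "length \<sigma> + j"] Suc.prems steps(1) by (simp add: \<rho>_def)
    have less: "v_perm m n (u x) < v_perm m n (u (Suc x))"
      using reduced_invs_take_Suc(1)[OF reduced, of "length \<sigma> + j"] Suc.prems steps by (simp add: \<rho>_def)
    have perm: "u permutes {1..n + 1}" unfolding u_def by (rule word_perm_permutes(1)[OF IH(1)])
    have fixed: "u i = i" if "n + 1 < i" for i
      using permutes_not_in[OF perm, of i] that by simp
    have "x \<le> n + 1"
    proof (rule ccontr)
      assume "\<not> x \<le> n + 1"
      then show False using ge fixed[of x] v_less[of x] x by simp
    qed
    moreover have "Suc x \<le> n + 1"
    proof (rule ccontr)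
      assume "\<not> Suc x \<le> n + 1"
      then show False using ge less fixed[of "Suc x"] v_less[of "Suc x"] x by simp
    qed
    ultimately have "u x \<in> {1..n + 1}" "u (Suc x) \<in> {1..n + 1}"
      using x permutes_in_image[OF perm] by auto
    then have "u x < u (Suc x)" using less by (simp add: v_perm_def)
    then have "reduced (take j \<tau> @ [x])" using IH(2) by (simp add: reduced_snoc u_def)
    then show ?case using take IH(1) x \<open>Suc x \<le> n + 1\<close> by simp
  qed simp
  have red_\<tau>: "reduced \<tau>" and letters_\<tau>: "set \<tau> \<subseteq> {1..<n + 1}" using \<tau>[of "length \<tau>"] by simp_all
  have shift: "pos (\<sigma> @ \<tau>') (u + m - 1) = pos \<tau>' u" if "1 \<le> u" "u \<le> n + 1" for \<tau>' u
  proof -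
    have "v_pos m n (u + m - 1) = u" using that m by (auto simp: v_pos_def)
    then show ?thesis by (simp add: pos_append v)
  qed
  have "longest_word 1 (n + 1) \<tau>"
    unfolding longest_word_def
  proof (intro conjI allI impI red_\<tau> letters_\<tau>)
    fix u v
    assume uv: "1 \<le> u \<and> u < v \<and> v \<le> n + 1"
    then have "(u + m - 1, v + m - 1) \<in> invs (pos \<rho>)" using m by (intro full) auto
    then show "(u, v) \<in> invs (pos \<tau>)"
      using uv shift[of u \<tau>] shift[of v \<tau>] by (simp add: invs_def \<rho>_def)
  qed
  moreover have "lex_word 1 1 \<tau>"
    unfolding lex_word_def lex_closed_def
  proof (intro allI impI, elim conjE)
    fix j a b c
    assume abc: "1 \<le> a" "a < b" "b < c" "(b, c) \<in> invs (pos (take j \<tau>))"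
    have "c \<le> n + 1" using invs_bounded(2)[OF set_take_letters[OF letters_\<tau>] abc(4)] .
    have closed: "lex_closed 1 m (pos (\<sigma> @ take j \<tau>))"
      using lex[unfolded lex_word_def, rule_format, of "length \<sigma> + j"] by simp
    note sh = shift[of a "take j \<tau>"] shift[of b "take j \<tau>"] shift[of c "take j \<tau>"]
    have "(b + m - 1, c + m - 1) \<in> invs (pos (\<sigma> @ take j \<tau>))"
      using abc sh \<open>c \<le> n + 1\<close> m by (auto simp: invs_def)
    then have "(a + m - 1, b + m - 1) \<in> invs (pos (\<sigma> @ take j \<tau>))"
      using abc m lex_closedD[OF closed, of "a + m - 1" "b + m - 1" "c + m - 1"] by simp
    then show "(a, b) \<in> invs (pos (take j \<tau>))"
      using abc sh \<open>c \<le> n + 1\<close> by (simp add: invs_def)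
  qed
  ultimately show "\<tau> \<in> shiftable_words n" by (simp add: shiftable_words_iff)
qed

text \<open>
  Bubble sort: exchange a big step with a small one right after it, until all small steps come first.
  The sum of the indices of the small steps decreases.
\<close>

lemma lex_word_cs_indexed:
  assumes "1 \<le> m" "longest_word 1 (m + n) \<rho>" "lex_word 1 m \<rho>"
  shows "\<exists>\<sigma> \<in> reduced_words (m + n) (v_perm m n). \<exists>\<tau> \<in> shiftable_words n.
    cs_indexed \<sigma> \<tau> \<rho> (small_steps m \<rho>) (big_steps m \<rho>)"
  using assms(2,3)
proof (induction "\<Sum>(small_steps m \<rho>)" arbitrary: \<rho> rule: less_induct)
  case less
  have reduced: "reduced \<rho>" and letters: "set \<rho> \<subseteq> {1..<m + n}"
    using less.prems by (auto simp: longest_word_def)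
  show ?case
  proof (cases "\<exists>k. Suc k < length \<rho> \<and> m \<le> swapped \<rho> k \<and> swapped \<rho> (Suc k) < m")
    case True
    then obtain k where k: "Suc k < length \<rho>" "m \<le> swapped \<rho> k" "swapped \<rho> (Suc k) < m" by blast
    obtain \<alpha> x y \<beta> where \<rho>: "\<rho> = \<alpha> @ [x, y] @ \<beta>" "length \<alpha> = k"
      using split_at_pair[OF k(1)] by blast
    have dist: "distant x y"
      using small_after_big_distant[OF reduced less.prems(2) letters \<rho>(1)] k \<rho>(2) by simp
    define \<rho>' where "\<rho>' = \<alpha> @ [y, x] @ \<beta>"
    have len: "length \<rho>' = length \<rho>" by (simp add: \<rho> \<rho>'_def)
    have "word_perm \<rho>' = word_perm \<rho>" using word_perm_swap[OF dist] by (simp add: \<rho> \<rho>'_def)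
    then have longest: "longest_word 1 (m + n) \<rho>'"
    proof -
      have "pos \<rho>' = pos \<rho>" by (rule pos_cong) fact
      moreover have "reduced \<rho>'" by (rule reduced_cong[OF reduced]) fact+
      moreover have "set \<rho>' = set \<rho>" by (auto simp: \<rho> \<rho>'_def)
      ultimately show ?thesis using less.prems(1) by (simp add: longest_word_def)
    qed
    have lex: "lex_word 1 m \<rho>'"
      using lex_word_swap[OF dist] reduced less.prems(2) by (simp add: \<rho> \<rho>'_def)
    have sw: "swapped \<rho>' k = swapped \<rho> (Suc k)" "swapped \<rho>' (Suc k) = swapped \<rho> k"
      "\<And>j. j \<noteq> k \<Longrightarrow> j \<noteq> Suc k \<Longrightarrow> swapped \<rho>' j = swapped \<rho> j"
      using swapped_swap[OF dist, where \<alpha> = \<alpha> and \<beta> = \<beta>] \<rho> by (simp_all add: \<rho>'_def)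
    have small: "small_steps m \<rho> = (small_steps m \<rho>' \<union> {Suc k + 1}) - {Suc k}"
    proof (rule set_eqI)
      fix j
      show "j \<in> small_steps m \<rho> \<longleftrightarrow> j \<in> (small_steps m \<rho>' \<union> {Suc k + 1}) - {Suc k}"
        using k sw(3)[of "j - 1"] len
        by (cases "j = Suc k"; cases "j = Suc (Suc k)") (auto simp: mem_small_steps)
    qed
    have big: "big_steps m \<rho> = (big_steps m \<rho>' \<union> {Suc k}) - {Suc k + 1}"
    proof (rule set_eqI)
      fix j
      show "j \<in> big_steps m \<rho> \<longleftrightarrow> j \<in> (big_steps m \<rho>' \<union> {Suc k}) - {Suc k + 1}"
        using k sw(3)[of "j - 1"] len
        by (cases "j = Suc k"; cases "j = Suc (Suc k)") (auto simp: mem_big_steps)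
    qed
    have mem: "Suc k \<in> small_steps m \<rho>'" "Suc k + 1 \<notin> small_steps m \<rho>'" "Suc k + 1 \<in> big_steps m \<rho>'"
      using k sw len by (auto simp: mem_small_steps mem_big_steps)
    have "small_steps m \<rho> = insert (Suc k + 1) (small_steps m \<rho>' - {Suc k})"
      unfolding small by (simp add: insert_Diff_if)
    then have "\<Sum>(small_steps m \<rho>) = Suc k + 1 + \<Sum>(small_steps m \<rho>' - {Suc k})"
      using mem(2) finite_small_steps by simp
    moreover have "\<Sum>(small_steps m \<rho>') = Suc k + \<Sum>(small_steps m \<rho>' - {Suc k})"
      by (rule sum.remove[OF finite_small_steps mem(1)])
    ultimately have "\<Sum>(small_steps m \<rho>') < \<Sum>(small_steps m \<rho>)" by simp
    from less.hyps[OF this longest lex] obtain \<sigma> \<tau> where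
      \<sigma>\<tau>: "\<sigma> \<in> reduced_words (m + n) (v_perm m n)" "\<tau> \<in> shiftable_words n"
        "cs_indexed \<sigma> \<tau> \<rho>' (small_steps m \<rho>') (big_steps m \<rho>')" by blast
    have nth: "\<rho>' ! k = y" "\<rho>' ! Suc k = x" "\<rho>'[k := x, Suc k := y] = \<rho>"
      using \<rho> by (simp_all add: \<rho>'_def nth_append list_update_append)
    have "\<bar>int (\<rho>' ! (Suc k - 1)) - int (\<rho>' ! Suc k)\<bar> > 1"
      using dist nth by (auto simp: distant_def)
    from cs_indexed.swap[OF \<sigma>\<tau>(3) mem(1,3) this]
    have "cs_indexed \<sigma> \<tau> \<rho> (small_steps m \<rho>) (big_steps m \<rho>)"
      using nth small big by simp
    then show ?thesis using \<sigma>\<tau> by blast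
  next
    case False
    define K where "K = (LEAST k. k = length \<rho> \<or> m \<le> swapped \<rho> k)"
    have K: "K = length \<rho> \<or> m \<le> swapped \<rho> K"
      unfolding K_def by (rule LeastI[of _ "length \<rho>"]) simp
    have K_le: "K \<le> length \<rho>" unfolding K_def by (rule Least_le) simp
    have below: "swapped \<rho> k < m" if "k < K" for k
      using not_less_Least[of k "\<lambda>k. k = length \<rho> \<or> m \<le> swapped \<rho> k"] that by (simp add: K_def)
    have above: "K \<le> k \<Longrightarrow> k < length \<rho> \<Longrightarrow> m \<le> swapped \<rho> k" for k
    proof (induction k rule: dec_induct)
      case base
      then show ?case using K by simp
    next
      case (step k)
      then show ?case using False by (metis Suc_lessD not_le)
    qed
    define \<sigma> where "\<sigma> = take K \<rho>"
    define \<tau> where "\<tau> = drop K \<rho>"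
    have \<rho>: "\<rho> = \<sigma> @ \<tau>" "length \<sigma> = K" "length \<tau> = length \<rho> - K"
      using K_le by (simp_all add: \<sigma>_def \<tau>_def)
    have words: "\<sigma> \<in> reduced_words (m + n) (v_perm m n)" "\<tau> \<in> shiftable_words n"
      using split_small_big[OF assms(1), of n \<sigma> \<tau>, folded \<rho>(1), OF less.prems]
      unfolding \<rho>(2) using below above by blast+
    have "small_steps m \<rho> = {1..length \<sigma>}"
    proof (rule set_eqI)
      fix j
      show "j \<in> small_steps m \<rho> \<longleftrightarrow> j \<in> {1..length \<sigma>}"
        using below[of "j - 1"] above[of "j - 1"] K_le
        unfolding mem_small_steps \<rho>(2) atLeastAtMost_iff by linarith
    qed
    moreover have "big_steps m \<rho> = {length \<sigma> + 1..length \<sigma> + length \<tau>}"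
    proof (rule set_eqI)
      fix j
      show "j \<in> big_steps m \<rho> \<longleftrightarrow> j \<in> {length \<sigma> + 1..length \<sigma> + length \<tau>}"
        using below[of "j - 1"] above[of "j - 1"] K_le
        unfolding mem_big_steps \<rho>(2,3) atLeastAtMost_iff by linarith
    qed
    ultimately have "cs_indexed \<sigma> \<tau> \<rho> (small_steps m \<rho>) (big_steps m \<rho>)"
      using cs_indexed.base[of \<sigma> \<tau>] \<rho>(1) by simp
    then show ?thesis using words by blast
  qed
qed

lemma CS_iff_lex_word:
  assumes "1 \<le> m" "longest_word 1 (m + n) \<rho>"
  shows "\<rho> \<in> CS m n \<longleftrightarrow> lex_word 1 m \<rho>"
  using CS_lex_word[OF assms(1)] lex_word_cs_indexed[OF assms]
  unfolding CS_def CS_words_def by blast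

theorem theorem5p18:
  fixes m n :: nat and \<rho> :: "nat list"
  assumes "m \<ge> 1"
    and "\<rho> \<in> reduced_words (m + n) (longest_perm (m + n))"
  shows "(\<rho> \<in> CS m n \<longleftrightarrow> n_row_shiftable (m + n) n (EG_Q \<rho>)) \<and>
         (n_row_shiftable (m + n) n (EG_Q \<rho>) \<longleftrightarrow> chain_of_word \<rho> \<in> LMC m n)"
proof -
  have longest: "longest_word 1 (m + n) \<rho>"
    using assms(2) reduced_words_longest_perm by blast
  show ?thesis
    using CS_iff_lex_word[OF assms(1) longest] n_row_shiftable_iff_lex_word[OF longest refl]
      LMC_iff_prefixes_L_perms[OF longest] prefixes_L_perms_iff[OF longest] by blast
qed

end
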